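(* Let $\beta \ge \frac{1}{\Delta_G}(114 + 4\log|G|)$. Let $L \ge 0$. Let $B_1, B_2 \subseteq \Lambda$ be rectangles at $\ell^\infty$ distance at least $L$ from each other (i.e. the $\ell^\infty$ distance between any vertex $x$ of $B_1$ and any vertex $y$ of $B_2$ is at least $L$). Let $k_1, k_2 \ge 1$, and let $f_1 : G^{k_1} \to \mathbb{C}$, $f_2 : G^{k_2} \to \mathbb{C}$ be conjugacy invariant functions. For $i = 1,2$, let $\gamma^{(i)}_1, \ldots, \gamma^{(i)}_{k_i}$ be closed loops contained in $B_i$. Let $\Sigma \sim \mu_{\Lambda,\beta}$. Then $$\left|\mathrm{Cov}\left(f_1(\Sigma_{\gamma^{(1)}_1}, \ldots, \Sigma_{\gamma^{(1)}_{k_1}}),\, f_2(\Sigma_{\gamma^{(2)}_1}, \ldots, \Sigma_{\gamma^{(2)}_{k_2}})\right)\right| \le 4\,(4\cdot 10^{24}|G|^2)^{|B_1|+|B_2|}\, \|f_1\|_\infty \|f_2\|_\infty\, e^{-(\beta/2)\Delta_G(L-1)}.$$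
   Context: $G$ is a finite group with identity $1$; $\rho$ is a (finite-dimensional) unitary representation of $G$ with character $\chi = \mathrm{Tr}\,\rho$. $\Lambda = ([a_1,b_1]\times\cdots\times[a_4,b_4])\cap\mathbb{Z}^4$ is a finite lattice with $b_i - a_i$ the same for all $i\in\{1,2,3,4\}$ (the result holds for any such $\Lambda$). $\Lambda_0$ is the set of vertices of $\Lambda$; $\Lambda_1$ is the set of nearest-neighbor edges of $\Lambda$, each positively oriented ($e=(x,y)$ with $y = x+e_i$ for a standard basis vector $e_i$); $\Lambda_2$ is the set of plaquettes, i.e. unit squares whose four boundary edges are in $\Lambda$. For $\sigma\in G^{\Lambda_1}$ and $e=(x,y)\in\Lambda_1$ set $\sigma_{(y,x)} := \sigma_e^{-1}$. For a closed loop $\gamma$ in $\Lambda$ traversing oriented edges $e_1,\ldots,e_n$, set $\sigma_\gamma := \sigma_{e_1}\cdots\sigma_{e_n}$. For $p\in\Lambda_2$ with vertices $x_1,x_2,x_3,x_4$ in cyclic order, set $\sigma_p := \sigma_{(x_1,x_2)}\sigma_{(x_2,x_3)}\sigma_{(x_3,x_4)}\sigma_{(x_4,x_1)}$. Let $S_\Lambda(\sigma) := \sum_{p\in\Lambda_2}\mathrm{Re}(\chi(1)-\chi(\sigma_p))$, and for $\beta\ge 0$ let $\mu_{\Lambda,\beta}$ be the probability measure on $G^{\Lambda_1}$ given by $\mu_{\Lambda,\beta}(\sigma) = Z_{\Lambda,\beta}^{-1}e^{-\beta S_\Lambda(\sigma)}$, with $Z_{\Lambda,\beta}$ the normalizing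 constant. $\Sigma\sim\mu_{\Lambda,\beta}$ means $\Sigma$ is a $G^{\Lambda_1}$-valued random variable with law $\mu_{\Lambda,\beta}$. $\Delta_G := \min_{g\in G,\, g\ne 1}\mathrm{Re}(\chi(1)-\chi(g))$; the expression $1/\Delta_G$ presupposes that $G$ is nontrivial and $\Delta_G>0$. A function $f:G^k\to\mathbb{C}$ is conjugacy invariant if $f(h_1^{-1}g_1h_1,\ldots,h_k^{-1}g_kh_k) = f(g_1,\ldots,g_k)$ for all $g_1,\dots,g_k,h_1,\dots,h_k\in G$. A rectangle $B$ is a subset of $\Lambda$ of the form $[x_1,y_1]\times\cdots\times[x_4,y_4]$ (intersected with $\mathbb{Z}^4$), where $x_i=y_i$ is allowed; $|B|$ is the number of plaquettes contained in $B$. For complex-valued random variables, $\mathrm{Cov}(X,Y) = \mathbb{E}[XY]-\mathbb{E}[X]\mathbb{E}[Y]$. *)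

theory Defs
  imports "HOL-Probability.Probability" "HOL-Algebra.Coset"
begin

section \<open>Unitary representations\<close>

definition conj_transpose :: "complex^'n^'n \<Rightarrow> complex^'n^'n" where
  "conj_transpose A = (\<chi> i j. cnj (A $ j $ i))"

definition unitary_rep :: "('g, 'r) monoid_scheme \<Rightarrow> ('g \<Rightarrow> complex^'n^'n) \<Rightarrow> bool" where
  "unitary_rep G \<rho> \<longleftrightarrow>
     \<rho> \<one>\<^bsub>G\<^esub> = mat 1 \<and>
     (\<forall>g \<in> carrier G. \<forall>h \<in> carrier G. \<rho> (g \<otimes>\<^bsub>G\<^esub> h) = \<rho> g ** \<rho> h) \<and>
     (\<forall>g \<in> carrier G. conj_transpose (\<rho> g) ** \<rho> g = mat 1 \<and> \<rho> g ** conj_transpose (\<rho> g) = mat 1)"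

definition character :: "('g \<Rightarrow> complex^'n^'n) \<Rightarrow> 'g \<Rightarrow> complex" where
  "character \<rho> g = trace (\<rho> g)"

text \<open>The minimum is over a nonempty set only if the group is nontrivial.\<close>

definition gap :: "('g, 'r) monoid_scheme \<Rightarrow> ('g \<Rightarrow> complex^'n^'n) \<Rightarrow> real" where
  "gap G \<rho> = Min ((\<lambda>g. Re (character \<rho> \<one>\<^bsub>G\<^esub> - character \<rho> g)) ` (carrier G - {\<one>\<^bsub>G\<^esub>}))"

section \<open>The lattice\<close>

text \<open>
  A sublattice is identified with its set of vertices. The order on \<^typ>\<open>int^4\<close> is componentwise,
  so \<open>{a..b}\<close> is the box \<open>[a\<^sub>1,b\<^sub>1] \<times> \<dots> \<times> [a\<^sub>4,b\<^sub>4]\<close> intersected with the integer points.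
\<close>

type_synonym site = "int^4"
type_synonym edge = "site \<times> site"

definition is_cube :: "site set \<Rightarrow> bool" where
  "is_cube \<Lambda> \<longleftrightarrow> (\<exists>a b. a \<le> b \<and> (\<forall>i j. b $ i - a $ i = b $ j - a $ j) \<and> \<Lambda> = {a..b})"

definition is_rectangle :: "site set \<Rightarrow> bool" where
  "is_rectangle B \<longleftrightarrow> (\<exists>x y. x \<le> y \<and> B = {x..y})"

definition edges :: "site set \<Rightarrow> edge set" where
  "edges S = {(x, y). x \<in> S \<and> y \<in> S \<and> (\<exists>i. y = x + axis i 1)}"

definition oriented_edges :: "site set \<Rightarrow> edge set" where
  "oriented_edges S = edges S \<union> (edges S)\<inverse>"

text \<open>
  The triple \<open>(x, i, j)\<close> with \<open>i < j\<close> encodes the unit square with lowest corner \<open>x\<close> in the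
  directions \<open>i\<close>, \<open>j\<close>, so that every square occurs exactly once. The starting vertex and the
  orientation chosen for its boundary do not affect the real part of the character.
\<close>

type_synonym plaquette = "site \<times> 4 \<times> 4"

fun boundary :: "plaquette \<Rightarrow> edge list" where
  "boundary (x, i, j) =
     [(x, x + axis i 1),
      (x + axis i 1, x + axis i 1 + axis j 1),
      (x + axis i 1 + axis j 1, x + axis j 1),
      (x + axis j 1, x)]"

definition plaquettes :: "site set \<Rightarrow> plaquette set" where
  "plaquettes S = {(x, i, j). i < j \<and> set (boundary (x, i, j)) \<subseteq> oriented_edges S}"

definition closed_loop :: "site set \<Rightarrow> edge list \<Rightarrow> bool" where
  "closed_loop S es \<longleftrightarrow>
     es \<noteq> [] \<and> set es \<subseteq> oriented_edges S \<and>
     (\<forall>n. Suc n < length es \<longrightarrow> snd (es ! n) = fst (es ! Suc n)) \<and>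
     snd (last es) = fst (hd es)"

definition linf_dist :: "site \<Rightarrow> site \<Rightarrow> int" where
  "linf_dist x y = Max (range (\<lambda>i. \<bar>x $ i - y $ i\<bar>))"

section \<open>The lattice gauge theory\<close>

definition configs :: "('g, 'r) monoid_scheme \<Rightarrow> site set \<Rightarrow> (edge \<Rightarrow> 'g) set" where
  "configs G \<Lambda> = edges \<Lambda> \<rightarrow>\<^sub>E carrier G"

text \<open>The value on an oriented edge; negatively oriented edges carry the inverse.\<close>

definition edge_value :: "('g, 'r) monoid_scheme \<Rightarrow> (edge \<Rightarrow> 'g) \<Rightarrow> edge \<Rightarrow> 'g" where
  "edge_value G \<sigma> e =
     (if e \<in> edges UNIV then \<sigma> e else inv\<^bsub>G\<^esub> (\<sigma> (snd e, fst e)))"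

definition holonomy :: "('g, 'r) monoid_scheme \<Rightarrow> (edge \<Rightarrow> 'g) \<Rightarrow> edge list \<Rightarrow> 'g" where
  "holonomy G \<sigma> es = foldr (\<lambda>e g. edge_value G \<sigma> e \<otimes>\<^bsub>G\<^esub> g) es \<one>\<^bsub>G\<^esub>"

definition action ::
  "('g, 'r) monoid_scheme \<Rightarrow> ('g \<Rightarrow> complex^'n^'n) \<Rightarrow> site set \<Rightarrow> (edge \<Rightarrow> 'g) \<Rightarrow> real" where
  "action G \<rho> \<Lambda> \<sigma> =
     (\<Sum>p \<in> plaquettes \<Lambda>. Re (character \<rho> \<one>\<^bsub>G\<^esub> - character \<rho> (holonomy G \<sigma> (boundary p))))"

definition partition_fun ::
  "('g, 'r) monoid_scheme \<Rightarrow> ('g \<Rightarrow> complex^'n^'n) \<Rightarrow> site set \<Rightarrow> real \<Rightarrow> real" where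
  "partition_fun G \<rho> \<Lambda> \<beta> = (\<Sum>\<sigma> \<in> configs G \<Lambda>. exp (- \<beta> * action G \<rho> \<Lambda> \<sigma>))"

definition gauge_measure ::
  "('g, 'r) monoid_scheme \<Rightarrow> ('g \<Rightarrow> complex^'n^'n) \<Rightarrow> site set \<Rightarrow> real \<Rightarrow> (edge \<Rightarrow> 'g) measure" where
  "gauge_measure G \<rho> \<Lambda> \<beta> =
     point_measure (configs G \<Lambda>)
       (\<lambda>\<sigma>. ennreal (exp (- \<beta> * action G \<rho> \<Lambda> \<sigma>) / partition_fun G \<rho> \<Lambda> \<beta>))"

section \<open>Observables\<close>

text \<open>Elements of \<open>G\<^sup>k\<close> are lists of length \<open>k\<close>.\<close>

definition tuples :: "('g, 'r) monoid_scheme \<Rightarrow> nat \<Rightarrow> 'g list set" where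
  "tuples G k = {gs. length gs = k \<and> set gs \<subseteq> carrier G}"

definition conjugacy_invariant :: "('g, 'r) monoid_scheme \<Rightarrow> nat \<Rightarrow> ('g list \<Rightarrow> complex) \<Rightarrow> bool" where
  "conjugacy_invariant G k f \<longleftrightarrow>
     (\<forall>gs \<in> tuples G k. \<forall>hs \<in> tuples G k.
        f (map2 (\<lambda>g h. inv\<^bsub>G\<^esub> h \<otimes>\<^bsub>G\<^esub> g \<otimes>\<^bsub>G\<^esub> h) gs hs) = f gs)"

definition sup_norm :: "('g, 'r) monoid_scheme \<Rightarrow> nat \<Rightarrow> ('g list \<Rightarrow> complex) \<Rightarrow> real" where
  "sup_norm G k f = (SUP gs \<in> tuples G k. norm (f gs))"

definition Cov :: "'w measure \<Rightarrow> ('w \<Rightarrow> complex) \<Rightarrow> ('w \<Rightarrow> complex) \<Rightarrow> complex" where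
  "Cov M X Y = (\<integral>\<omega>. X \<omega> * Y \<omega> \<partial>M) - (\<integral>\<omega>. X \<omega> \<partial>M) * (\<integral>\<omega>. Y \<omega> \<partial>M)"

end

theory Submission
  imports Defs
begin

text \<open>
  Two independent copies of the field form one lattice gauge field with gauge group \<open>G \<times> G\<close>, and the
  covariance is half the expectation of \<open>u1 u2\<close>, where \<open>ui\<close> is the difference of \<open>fi\<close> between the copies
  and hence odd under exchanging them. The plaquettes with nontrivial holonomy, together with those of
  the two rectangles, split into knots. The smallest knot sits in a box that no other knot enters.
  The faces of this box that are interior to the lattice form a simply connected complex, or
  they become one after adding a flat slice of the box, so every field can be gauged to the identity
  on them and sums over the inside and the outside of the box factorise. Knots are thus peeled off one by
  one. If no knot joins the rectangles, then the expectation factorises into those of \<open>u1\<close> and \<open>u2\<close>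
  and vanishes by oddness. The exceptions contain a knot that joins the rectangles, or one that is too large
  for a flat slice to exist, hence at least \<open>L - 1\<close> excited plaquettes. In axial gauge each of them costs a
  factor \<open>|G|\<^sup>2 exp (- \<beta> \<Delta>)\<close>, half of which gives the decay and the other half pays for the number of
  knots: a knot of \<open>n\<close> plaquettes is traced by a closed walk whose step lengths have a product
  exponential in \<open>n\<close>, so their number is exponential in \<open>n\<close>.
\<close>

section \<open>Boxes\<close>

text \<open>The obstacle is topological. Two disjoint sets of excited plaquettes need not be
  independent, because the field that is flat between them can still have monodromy around one set,
  and the other set feels it. A wall on which the field is pure gauge cuts this dependence, and a
  flat field is pure gauge on a simply connected wall. The shell of a box deep inside the lattice is
  such a wall, being a 3-sphere; the shell of a box that spans the lattice in two directions is a
  circle times a square, hence the flat slices. A box around a large knot may swallow small ones, so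
  the peeling has to begin with the smallest. The constant: half of \<beta>\<Delta> is at least 57 +
  2 log |G|, so a factor |G|^2 exp(-\<beta>\<Delta>/2) < 10^-20 per excited plaquette is left for
  counting, against at most 10^(13(n-1)) knots of n plaquettes through a given one. The plaquettes
  of a rectangle are put into a knot whether they are excited or not; each of them forfeits the
  10^-20 and leaves two possibilities, whence the base 2 * 10^20 for the rectangles.\<close>

lemma box_iff: "x \<in> {a..b} \<longleftrightarrow> (\<forall>i. a $ i \<le> x $ i \<and> x $ i \<le> b $ i)" for x a b :: site
  by (auto simp: less_eq_vec_def)

lemma edges_iff: "(x, y) \<in> edges S \<longleftrightarrow> x \<in> S \<and> y \<in> S \<and> (\<exists>i. y = x + axis i 1)"
  by (simp add: edges_def)

lemma edges_mono: "S \<subseteq> T \<Longrightarrow> edges S \<subseteq> edges T"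
  by (auto simp: edges_def)

lemma finite_edges: "finite S \<Longrightarrow> finite (edges S)"
  by (rule finite_subset[of _ "S \<times> S"]) (auto simp: edges_def)

lemma axis_pair_ne_0: "axis i (1::int) + axis j 1 \<noteq> (0 :: int^4)"
proof
  assume "axis i (1::int) + axis j 1 = (0 :: int^4)"
  then have "(axis i (1::int) + axis j 1 :: int^4) $ i = 0" by simp
  then show False by (simp add: axis_def split: if_splits)
qed

text \<open>No edge is positive in both orientations, so the test in \<open>edge_value\<close>
  decides the orientation unambiguously.\<close>

lemma reversed_not_edge: "(x + axis i 1, x) \<notin> edges S"
proof
  assume "(x + axis i 1, x) \<in> edges S"
  then obtain j where "x = x + axis i 1 + axis j 1" by (auto simp: edges_iff)
  then show False using axis_pair_ne_0[of i j] by (simp add: add.assoc)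
qed

lemma oriented_edges_mono: "S \<subseteq> T \<Longrightarrow> oriented_edges S \<subseteq> oriented_edges T"
  using edges_mono by (auto simp: oriented_edges_def)

lemma oriented_edgesE:
  assumes "e \<in> oriented_edges S"
  obtains "e \<in> edges S" | "e \<notin> edges UNIV" "(snd e, fst e) \<in> edges S"
proof (cases "e \<in> edges S")
  case False
  then have r: "(snd e, fst e) \<in> edges S" using assms by (auto simp: oriented_edges_def)
  then obtain i where "fst e = snd e + axis i 1" by (auto simp: edges_iff)
  then have "e = (snd e + axis i 1, snd e)" by (simp add: prod_eq_iff)
  then have "e \<notin> edges UNIV" using reversed_not_edge by metis
  with r show ?thesis using that by blast
qed (use that in blast)

fun plaquette_edges :: "plaquette \<Rightarrow> edge set" where
  "plaquette_edges (x, i, j) = {(x, x + axis i 1), (x + axis i 1, x + axis i 1 + axis j 1),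
     (x + axis j 1, x + axis i 1 + axis j 1), (x, x + axis j 1)}"

lemma plaquettes_iff:
  "(x, i, j) \<in> plaquettes S \<longleftrightarrow> i < j \<and> x \<in> S \<and> x + axis i 1 \<in> S \<and> x + axis j 1 \<in> S
     \<and> x + axis i 1 + axis j 1 \<in> S"
proof -
  have c: "x + axis i 1 + axis j 1 = x + axis j 1 + axis i 1" by (simp add: add_ac)
  have "\<exists>k. x + axis i 1 + axis j 1 = x + axis j 1 + axis k 1" using c by blast
  then show ?thesis
    by (auto simp: plaquettes_def oriented_edges_def edges_iff)
qed

lemma plaquettes_iff_edges:
  "p \<in> plaquettes S \<longleftrightarrow> fst (snd p) < snd (snd p) \<and> plaquette_edges p \<subseteq> edges S"
proof -
  obtain x i j where p: "p = (x, i, j)" by (cases p)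
  have c: "x + axis i 1 + axis j 1 = x + axis j 1 + axis i 1" by (simp add: add_ac)
  have "\<exists>k. x + axis i 1 + axis j 1 = x + axis j 1 + axis k 1" using c by blast
  then show ?thesis unfolding p plaquettes_iff by (auto simp: edges_iff)
qed

text \<open>Two opposite corners suffice because a box is order convex and the other two corners lie
  between them.\<close>

lemma plaquettes_box_iff:
  "(x, i, j) \<in> plaquettes {a..b} \<longleftrightarrow> i < j \<and> x \<in> {a..b} \<and> x + axis i 1 + axis j 1 \<in> {a..b}"
  unfolding plaquettes_iff box_iff by (auto simp: axis_def split: if_splits; smt (verit))

lemma plaquettes_mono: "S \<subseteq> T \<Longrightarrow> plaquettes S \<subseteq> plaquettes T"
  using edges_mono unfolding plaquettes_iff_edges subset_iff by metis

lemma finite_plaquettes: "finite S \<Longrightarrow> finite (plaquettes S)"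
  by (rule finite_subset[of _ "S \<times> UNIV"]) (auto simp: plaquettes_iff)

lemma finite_box: "finite {a..b}" for a b :: site
proof -
  have "{a..b} \<subseteq> vec_lambda ` (UNIV \<rightarrow>\<^sub>E (\<Union>i. {a $ i..b $ i}))"
  proof
    fix x assume x: "x \<in> {a..b}"
    have "x = vec_lambda (vec_nth x)" by simp
    moreover have "vec_nth x \<in> UNIV \<rightarrow>\<^sub>E (\<Union>i. {a $ i..b $ i})"
      using x unfolding box_iff PiE_iff by auto
    ultimately show "x \<in> vec_lambda ` (UNIV \<rightarrow>\<^sub>E (\<Union>i. {a $ i..b $ i}))" by blast
  qed
  moreover have "finite (UNIV \<rightarrow>\<^sub>E (\<Union>i. {a $ i..b $ i}) :: (4 \<Rightarrow> int) set)"
    by (intro finite_PiE) auto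
  ultimately show ?thesis by (meson finite_imageI finite_subset)
qed

text \<open>The last raised coordinate is lowered, the rule that also defines
  \<open>axial_gauge\<close>. Repeated, it joins every vertex to the lowest corner inside the
  box.\<close>

lemma box_descent:
  assumes "x \<in> {a..b}" "x \<noteq> a"
  obtains i where "x - axis i 1 \<in> {a..b}" "a $ i < x $ i" "\<And>j. i < j \<Longrightarrow> x $ j = a $ j"
    "(x - axis i 1, x) \<in> edges {a..b}" 
proof -
  let ?J = "{i. a $ i < x $ i}"
  have "?J \<noteq> {}"
    using assms unfolding box_iff vec_eq_iff by (metis (mono_tags, lifting) empty_iff mem_Collect_eq order_le_less)
  define i where "i = Max ?J"
  have i: "i \<in> ?J" using \<open>?J \<noteq> {}\<close> unfolding i_def by (intro Max_in) auto
  have mx: "j \<notin> ?J" if "i < j" for j using that Max_ge[of ?J j] unfolding i_def by (meson finite linorder_not_less)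
  have 1: "x - axis i 1 \<in> {a..b}"
    using assms i unfolding box_iff by (auto simp: axis_def; smt (verit))
  show ?thesis
  proof (rule that[OF 1])
    show "a $ i < x $ i" using i by simp
    show "x $ j = a $ j" if "i < j" for j
      using mx[OF that] assms(1) unfolding box_iff by (metis linorder_not_less mem_Collect_eq order_antisym_conv)
    show "(x - axis i 1, x) \<in> edges {a..b}" using 1 assms by (auto simp: edges_iff intro!: exI[of _ i])
  qed
qed

definition height :: "site \<Rightarrow> site \<Rightarrow> nat" where
  "height a x = nat (\<Sum>i\<in>UNIV. x $ i - a $ i)"

lemma height_descent:
  assumes "x \<in> {a..b}" "x - axis i 1 \<in> {a..b}"
  shows "height a (x - axis i 1) < height a x"
proof -
  have "(\<Sum>k\<in>UNIV. (x - axis i 1) $ k - a $ k) = (\<Sum>k\<in>UNIV. x $ k - a $ k) - 1"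
  proof -
    have "(\<Sum>k\<in>UNIV. (x - axis i 1) $ k - a $ k) = (\<Sum>k\<in>UNIV. (x $ k - a $ k) - (if k = i then 1 else 0))"
      by (rule sum.cong) (auto simp: axis_def)
    then show ?thesis by (simp add: sum_subtractf)
  qed
  moreover have "0 \<le> (\<Sum>k\<in>UNIV. (x - axis i 1) $ k - a $ k)"
    using assms(2) unfolding box_iff by (intro sum_nonneg) auto
  ultimately show ?thesis unfolding height_def by simp
qed

text \<open>Connectedness of a box, in the form needed for the factor between two trivialisations of
  a field.\<close>

lemma box_constant:
  assumes "\<And>x y. (x, y) \<in> edges {a..b} \<Longrightarrow> c x = c y" "x \<in> {a..b}"
  shows "c x = c a"
  using assms(2)
proof (induction "height a x" arbitrary: x rule: less_induct)
  case less
  show ?case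
  proof (cases "x = a")
    case False
    then obtain i where i: "x - axis i 1 \<in> {a..b}" "(x - axis i 1, x) \<in> edges {a..b}"
      using box_descent[OF less.prems] by blast
    then have "c (x - axis i 1) = c a" using less height_descent by blast
    with assms(1)[OF i(2)] show ?thesis by simp
  qed simp
qed

section \<open>Gauge transformations\<close>

fun chain :: "site \<Rightarrow> edge list \<Rightarrow> site \<Rightarrow> bool" where
  "chain x [] y \<longleftrightarrow> x = y"
| "chain x (e # es) y \<longleftrightarrow> fst e = x \<and> chain (snd e) es y"

lemma closed_loop_chain:
  assumes "closed_loop S es"
  shows "chain (fst (hd es)) es (fst (hd es))" "set es \<subseteq> oriented_edges S"
proof -
  have *: "chain (fst (hd es)) es (snd (last es))"
    if "es \<noteq> []" "\<forall>n. Suc n < length es \<longrightarrow> snd (es ! n) = fst (es ! Suc n)" for es :: "edge list"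
    using that
  proof (induction es rule: induct_list012)
    case (3 e e' es)
    have "\<forall>n. Suc n < length (e' # es) \<longrightarrow> snd ((e' # es) ! n) = fst ((e' # es) ! Suc n)"
      using 3(4) by (metis Suc_less_eq length_Cons nth_Cons_Suc)
    moreover have "snd e = fst e'" using 3(4)[rule_format, of 0] by simp
    ultimately show ?case using 3 by simp
  qed simp_all
  then show "chain (fst (hd es)) es (fst (hd es))" "set es \<subseteq> oriented_edges S"
    using assms *[of es] unfolding closed_loop_def by metis+
qed

lemma chain_boundary: "chain x (boundary (x, i, j)) x"
  by simp

text \<open>Restricted to the edges of \<open>S\<close> so that the result is again an extensional
  function as in \<open>configs\<close>.\<close>

definition gauge :: "('g, 'r) monoid_scheme \<Rightarrow> site set \<Rightarrow> (site \<Rightarrow> 'g) \<Rightarrow> (edge \<Rightarrow> 'g) \<Rightarrow> edge \<Rightarrow> 'g" where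
  "gauge G S h \<sigma> = (\<lambda>e \<in> edges S. h (fst e) \<otimes>\<^bsub>G\<^esub> \<sigma> e \<otimes>\<^bsub>G\<^esub> inv\<^bsub>G\<^esub> h (snd e))"

text \<open>By \<open>gauge_one_iff\<close> the transformation by \<open>h\<close> makes such a
  field the identity on \<open>W\<close>. An arbitrary set of edges is allowed because the shell of
  a box need not be the edge set of a set of vertices.\<close>

definition pure_gauge :: "('g, 'r) monoid_scheme \<Rightarrow> (site \<Rightarrow> 'g) \<Rightarrow> (edge \<Rightarrow> 'g) \<Rightarrow> edge set \<Rightarrow> bool" where
  "pure_gauge G h \<sigma> W \<longleftrightarrow> (\<forall>e\<in>W. \<sigma> e = inv\<^bsub>G\<^esub> h (fst e) \<otimes>\<^bsub>G\<^esub> h (snd e))"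

definition flat :: "('g, 'r) monoid_scheme \<Rightarrow> (edge \<Rightarrow> 'g) \<Rightarrow> site set \<Rightarrow> bool" where
  "flat G \<sigma> S \<longleftrightarrow> (\<forall>p\<in>plaquettes S. holonomy G \<sigma> (boundary p) = \<one>\<^bsub>G\<^esub>)"

text \<open>A spanning tree of the box: every vertex except the corner \<open>a\<close> is entered
  by exactly one of these edges, the one that raises its last raised coordinate.\<close>

definition axial_edges :: "site \<Rightarrow> site \<Rightarrow> edge set" where
  "axial_edges a b = {(x, x + axis i 1) | x i. (x, x + axis i 1) \<in> edges {a..b} \<and> (\<forall>j>i. x $ j = a $ j)}"

text \<open>The product of the field along the tree path from \<open>a\<close> to \<open>x\<close>;
  outside the orthant above \<open>a\<close> the value one is a dummy.\<close>

function axial_gauge :: "('g, 'r) monoid_scheme \<Rightarrow> (edge \<Rightarrow> 'g) \<Rightarrow> site \<Rightarrow> site \<Rightarrow> 'g" where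
  "axial_gauge G \<sigma> a x =
    (if a \<le> x \<and> x \<noteq> a
     then let y = x - axis (Max {i. a $ i < x $ i}) 1 in axial_gauge G \<sigma> a y \<otimes>\<^bsub>G\<^esub> \<sigma> (y, x)
     else \<one>\<^bsub>G\<^esub>)"
  by auto
termination
proof (relation "Wellfounded.measure (\<lambda>(G, \<sigma>, a, x). height a x)", simp, clarsimp)
  fix a x :: site assume ax: "a \<le> x" "x \<noteq> a"
  let ?J = "{i. a $ i < x $ i}"
  have "?J \<noteq> {}"
    using ax unfolding less_eq_vec_def vec_eq_iff by (metis (mono_tags, lifting) empty_iff mem_Collect_eq order_le_less)
  then have "Max ?J \<in> ?J" by (intro Max_in) auto
  then have "x - axis (Max ?J) 1 \<in> {a..x}"
    using ax unfolding box_iff less_eq_vec_def by (auto simp: axis_def; smt (verit))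
  then show "height a (x - axis (Max ?J) 1) < height a x" 
    using height_descent[of x a x] ax by simp
qed

declare axial_gauge.simps [simp del]

section \<open>Transport of holonomies, axial gauge and flat fields on a box\<close>

context group
begin

lemma edge_value_closed:
  assumes "e \<in> oriented_edges S" "\<And>e. e \<in> edges S \<Longrightarrow> \<sigma> e \<in> carrier G"
  shows "edge_value G \<sigma> e \<in> carrier G"
  using assms(1)
proof (cases rule: oriented_edgesE)
  case 1
  then have "e \<in> edges UNIV" using edges_mono by blast
  then show ?thesis using assms 1 by (simp add: edge_value_def)
qed (use assms in \<open>auto simp: edge_value_def\<close>)

lemma holonomy_closed:
  assumes "set es \<subseteq> oriented_edges S" "\<And>e. e \<in> edges S \<Longrightarrow> \<sigma> e \<in> carrier G"
  shows "holonomy G \<sigma> es \<in> carrier G"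
  using assms(1) unfolding holonomy_def
  by (induction es) (auto intro: edge_value_closed[OF _ assms(2)])

lemma holonomy_cong:
  assumes "set es \<subseteq> oriented_edges S" "\<And>e. e \<in> edges S \<Longrightarrow> \<sigma> e = \<tau> e"
  shows "holonomy G \<sigma> es = holonomy G \<tau> es"
proof -
  have "edge_value G \<sigma> e = edge_value G \<tau> e" if "e \<in> oriented_edges S" for e
    using that
  proof (cases rule: oriented_edgesE)
    case 1
    then show ?thesis using assms(2) edges_mono[of S UNIV] by (auto simp: edge_value_def)
  qed (use assms in \<open>auto simp: edge_value_def\<close>)
  then show ?thesis using assms(1) unfolding holonomy_def by (induction es) auto
qed

text \<open>The gauge factors at the inner vertices of the path cancel. The relation between the
  fields is assumed edge by edge, so that the constant field can take the place of
  \<open>\<sigma>\<close> in \<open>holonomy_pure_gauge\<close>.\<close>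

lemma holonomy_transport:
  assumes "set es \<subseteq> oriented_edges S" "chain x es y"
    and "\<And>e. e \<in> edges S \<Longrightarrow> \<sigma> e \<in> carrier G" "h \<in> UNIV \<rightarrow> carrier G"
    and "\<And>e. e \<in> edges S \<Longrightarrow> \<tau> e = h (fst e) \<otimes> \<sigma> e \<otimes> inv h (snd e)"
  shows "holonomy G \<tau> es = h x \<otimes> holonomy G \<sigma> es \<otimes> inv h y"
  using assms(1,2)
proof (induction es arbitrary: x)
  case Nil
  then show ?case using assms(4) by (simp add: holonomy_def Pi_iff)
next
  case (Cons e es)
  have h[simp]: "h z \<in> carrier G" for z using assms(4) by auto
  have s[simp]: "holonomy G \<sigma> es \<in> carrier G" using holonomy_closed[of es S \<sigma>] Cons.prems assms(3) by auto
  have v[simp]: "edge_value G \<sigma> e \<in> carrier G" using edge_value_closed[of e S \<sigma>] Cons.prems assms(3) by auto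
  have "edge_value G \<tau> e = h (fst e) \<otimes> edge_value G \<sigma> e \<otimes> inv h (snd e)"
  proof -
    have "e \<in> oriented_edges S" using Cons.prems by simp
    then show ?thesis
    proof (cases rule: oriented_edgesE)
      case 1
      then show ?thesis using assms(5)[of e] edges_mono[of S UNIV] by (auto simp: edge_value_def)
    next
      case 2
      then have "\<sigma> (snd e, fst e) \<in> carrier G" using assms(3) by blast
      then show ?thesis using 2 assms(5)[of "(snd e, fst e)"]
        by (simp add: edge_value_def inv_mult_group m_assoc)
    qed
  qed
  moreover have "holonomy G \<tau> es = h (snd e) \<otimes> holonomy G \<sigma> es \<otimes> inv h y" using Cons by auto
  ultimately have "holonomy G \<tau> (e # es) =
      (h (fst e) \<otimes> edge_value G \<sigma> e \<otimes> inv h (snd e)) \<otimes> (h (snd e) \<otimes> holonomy G \<sigma> es \<otimes> inv h y)"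
    by (simp add: holonomy_def)
  also have "\<dots> = h (fst e) \<otimes> (edge_value G \<sigma> e \<otimes> holonomy G \<sigma> es) \<otimes> inv h y"
    by (simp add: m_assoc inv_solve_left' flip: m_assoc[of "inv h (snd e)" "h (snd e)"])
  finally show ?case using Cons.prems by (simp add: holonomy_def)
qed

lemma holonomy_one:
  assumes "set es \<subseteq> oriented_edges S" "\<And>e. e \<in> edges S \<Longrightarrow> \<sigma> e = \<one>"
  shows "holonomy G \<sigma> es = \<one>"
proof -
  have "edge_value G \<sigma> e = \<one>" if "e \<in> oriented_edges S" for e
    using that
  proof (cases rule: oriented_edgesE)
    case 1
    then show ?thesis using assms(2) edges_mono[of S UNIV] by (auto simp: edge_value_def)
  qed (use assms in \<open>auto simp: edge_value_def\<close>)
  then show ?thesis using assms(1) unfolding holonomy_def by (induction es) auto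
qed

lemma boundary_oriented: "p \<in> plaquettes S \<Longrightarrow> set (boundary p) \<subseteq> oriented_edges S"
  by (auto simp: plaquettes_def)

lemma holonomy_boundary:
  "holonomy G \<sigma> (boundary (x, i, j)) = \<sigma> (x, x + axis i 1) \<otimes> (\<sigma> (x + axis i 1, x + axis i 1 + axis j 1)
     \<otimes> (inv \<sigma> (x + axis j 1, x + axis i 1 + axis j 1) \<otimes> (inv \<sigma> (x, x + axis j 1) \<otimes> \<one>)))"
proof -
  have c: "x + axis i 1 + axis j 1 = x + axis j 1 + axis i 1" by (simp add: add_ac)
  have n: "(x + axis i 1 + axis j 1, x + axis j 1) \<notin> edges UNIV" "(x + axis j 1, x) \<notin> edges UNIV"
    unfolding c using reversed_not_edge by blast+
  have y: "(x, x + axis i 1) \<in> edges UNIV" "(x + axis i 1, x + axis i 1 + axis j 1) \<in> edges UNIV"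
    by (auto simp: edges_iff)
  show ?thesis using n y by (simp add: holonomy_def edge_value_def)
qed

lemma holonomy_boundary_cong:
  assumes "\<And>e. e \<in> plaquette_edges p \<Longrightarrow> \<sigma> e = \<tau> e"
  shows "holonomy G \<sigma> (boundary p) = holonomy G \<tau> (boundary p)"
proof -
  obtain x i j where p: "p = (x, i, j)" by (cases p)
  show ?thesis using assms unfolding p by (simp only: holonomy_boundary plaquette_edges.simps insert_iff simp_thms)
qed

text \<open>Induction on the height of the base point. An edge in direction \<open>i\<close> off the
  tree has a base point raised in some later direction; let \<open>j\<close> be the last one. In the
  plaquette one step down along \<open>j\<close> both \<open>j\<close> edges belong to the tree and
  the opposite \<open>i\<close> edge is lower, so the holonomy determines the remaining
  edge.\<close>

lemma axial_determines:
  assumes "\<And>e. e \<in> edges {a..b} \<Longrightarrow> \<sigma> e \<in> carrier G" "\<And>e. e \<in> edges {a..b} \<Longrightarrow> \<tau> e \<in> carrier G"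
    and "\<And>e. e \<in> axial_edges a b \<Longrightarrow> \<sigma> e = \<one>" "\<And>e. e \<in> axial_edges a b \<Longrightarrow> \<tau> e = \<one>"
    and "\<And>p. p \<in> plaquettes {a..b} \<Longrightarrow> holonomy G \<sigma> (boundary p) = holonomy G \<tau> (boundary p)"
    and "e \<in> edges {a..b}"
  shows "\<sigma> e = \<tau> e"
proof -
  have "\<sigma> (x, x + axis i 1) = \<tau> (x, x + axis i 1)" if "(x, x + axis i 1) \<in> edges {a..b}" for x i
    using that
  proof (induction "height a x" arbitrary: x rule: less_induct)
    case less
    let ?J = "{j. i < j \<and> a $ j < x $ j}"
    have x: "x \<in> {a..b}" "x + axis i 1 \<in> {a..b}" using less.prems by (auto simp: edges_iff)
    show ?case
    proof (cases "?J = {}")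
      case True
      then have "\<forall>j>i. x $ j = a $ j" using x unfolding box_iff by (auto simp: order_le_less)
      then have "(x, x + axis i 1) \<in> axial_edges a b" using less.prems by (auto simp: axial_edges_def)
      then show ?thesis using assms(3,4) by simp
    next
      case False
      define j where "j = Max ?J"
      have j: "i < j" "a $ j < x $ j" using Max_in[of ?J] False unfolding j_def by auto
      have mx: "x $ k = a $ k" if "j < k" for k
      proof -
        have "k \<notin> ?J" using that Max_ge[of ?J k] unfolding j_def by (meson finite linorder_not_less)
        then show ?thesis using that j x unfolding box_iff by (auto simp: order_le_less)
      qed
      define y where "y = x - axis j 1"
      have xy: "x = y + axis j 1" by (simp add: y_def)
      have y: "y \<in> {a..b}" using x j unfolding box_iff y_def by (auto simp: axis_def; smt (verit))
      have xi: "y + axis i 1 + axis j 1 \<in> {a..b}" using x(2) by (simp add: xy add_ac)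
      have p: "(y, i, j) \<in> plaquettes {a..b}" using y xi j by (simp only: plaquettes_box_iff)
      then have yi: "y + axis i 1 \<in> {a..b}" by (simp only: plaquettes_iff)
      have mx': "y $ k = a $ k" "(y + axis i 1) $ k = a $ k" if "j < k" for k
        using mx[OF that] that j by (auto simp: y_def axis_def)
      have e: "(y, y + axis i 1) \<in> edges {a..b}" "(y, y + axis j 1) \<in> edges {a..b}"
        "(y + axis i 1, y + axis i 1 + axis j 1) \<in> edges {a..b}"
        "(y + axis j 1, y + axis i 1 + axis j 1) \<in> edges {a..b}"
        using y yi xi x unfolding edges_iff xy by (auto simp: add_ac)
      have ax: "(y, y + axis j 1) \<in> axial_edges a b" "(y + axis i 1, y + axis i 1 + axis j 1) \<in> axial_edges a b"
        using e mx' unfolding axial_edges_def by blast+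
      have eq: "\<sigma> (y, y + axis i 1) = \<tau> (y, y + axis i 1)"
        using less.hyps[of y] e(1) height_descent[of x a b j] x y by (simp add: y_def)
      let ?e = "(y + axis j 1, y + axis i 1 + axis j 1)"
      have c: "\<sigma> (y, y + axis i 1) \<in> carrier G" "\<sigma> ?e \<in> carrier G" "\<tau> ?e \<in> carrier G"
        using assms(1,2) e by blast+
      have "\<sigma> (y, y + axis i 1) \<otimes> inv \<sigma> ?e = \<tau> (y, y + axis i 1) \<otimes> inv \<tau> ?e"
        using assms(5)[OF p] ax assms(3,4) c eq unfolding holonomy_boundary by simp
      then have "inv \<sigma> ?e = inv \<tau> ?e"
        using Units_l_cancel[of "\<tau> (y, y + axis i 1)" "inv \<sigma> ?e" "inv \<tau> ?e"] c eq by simp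
      then have "\<sigma> ?e = \<tau> ?e" using c inv_inv by metis
      then show ?thesis by (simp add: xy add_ac)
    qed
  qed
  then show ?thesis using assms(6) by (cases e) (auto simp: edges_iff)
qed

lemma axial_gauge_closed:
  assumes "\<And>e. e \<in> edges {a..b} \<Longrightarrow> \<sigma> e \<in> carrier G" "x \<in> {a..b}"
  shows "axial_gauge G \<sigma> a x \<in> carrier G"
  using assms(2)
proof (induction "height a x" arbitrary: x rule: less_induct)
  case less
  show ?case
  proof (cases "x = a")
    case True
    then show ?thesis by (subst axial_gauge.simps) simp
  next
    case False
    let ?J = "{i. a $ i < x $ i}"
    have "?J \<noteq> {}"
      using less.prems False unfolding box_iff vec_eq_iff by (metis (mono_tags, lifting) empty_iff mem_Collect_eq order_le_less)
    then have M: "Max ?J \<in> ?J" by (intro Max_in) auto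
    let ?y = "x - axis (Max ?J) 1"
    have y: "?y \<in> {a..b}"
      using less.prems M unfolding box_iff by (auto simp: axis_def; smt (verit))
    have "(?y, x) \<in> edges {a..b}" using y less.prems by (auto simp: edges_iff intro!: exI[of _ "Max ?J"])
    moreover have "axial_gauge G \<sigma> a ?y \<in> carrier G" using less y height_descent by blast
    ultimately show ?thesis using assms(1) less.prems False by (subst axial_gauge.simps) (simp add: Let_def)
  qed
qed

lemma axial_gauge_edge:
  assumes "\<And>e. e \<in> edges {a..b} \<Longrightarrow> \<sigma> e \<in> carrier G" "(x, y) \<in> axial_edges a b"
  shows "axial_gauge G \<sigma> a y = axial_gauge G \<sigma> a x \<otimes> \<sigma> (x, y)"
proof -
  from assms(2) obtain i where y: "y = x + axis i 1" and e: "(x, y) \<in> edges {a..b}" and t: "\<forall>j>i. x $ j = a $ j"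
    by (auto simp: axial_edges_def)
  have x: "x \<in> {a..b}" "y \<in> {a..b}" using e by (auto simp: edges_iff)
  have "Max {k. a $ k < y $ k} = i"
  proof (rule Max_eqI)
    show "k \<le> i" if "k \<in> {k. a $ k < y $ k}" for k
      proof (rule ccontr)
      assume "\<not> k \<le> i"
      then have "x $ k = a $ k" "axis i (1::int) $ k = 0" using t by (auto simp: axis_def)
      then show False using that y by simp
    qed
    show "i \<in> {k. a $ k < y $ k}" using x y unfolding box_iff by (auto simp: axis_def)
  qed auto
  moreover have "a \<le> y" "y \<noteq> a"
  proof -
    show "a \<le> y" using x by simp
    show "y \<noteq> a" using x(1) unfolding box_iff y by (metis add_le_same_cancel1 axis_nth not_one_le_zero vector_add_component)
  qed
  ultimately show ?thesis by (subst axial_gauge.simps) (simp add: Let_def y)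
qed

text \<open>A tree has no cycles, so nothing obstructs the trivialisation of a field on it.\<close>

lemma axial_pure_gauge:
  assumes "\<And>e. e \<in> edges {a..b} \<Longrightarrow> \<sigma> e \<in> carrier G"
  shows "\<exists>h \<in> UNIV \<rightarrow> carrier G. pure_gauge G h \<sigma> (axial_edges a b)"
proof -
  let ?h = "\<lambda>x. if x \<in> {a..b} then axial_gauge G \<sigma> a x else \<one>"
  have "?h \<in> UNIV \<rightarrow> carrier G" using axial_gauge_closed[of a b \<sigma>] assms by auto
  moreover have "pure_gauge G ?h \<sigma> (axial_edges a b)"
    unfolding pure_gauge_def
  proof
    fix e assume e: "e \<in> axial_edges a b"
    then have E: "e \<in> edges {a..b}" by (auto simp: axial_edges_def)
    then have x: "fst e \<in> {a..b}" "snd e \<in> {a..b}" by (auto simp: edges_def)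
    show "\<sigma> e = inv ?h (fst e) \<otimes> ?h (snd e)"
      using x axial_gauge_edge[of a b \<sigma> "fst e" "snd e"] assms e E axial_gauge_closed[of a b \<sigma>]
      by (simp add: m_assoc[symmetric])
  qed
  ultimately show ?thesis by blast
qed

lemma gauge_one_iff:
  assumes "g \<in> carrier G" "h \<in> carrier G" "k \<in> carrier G"
  shows "h \<otimes> g \<otimes> inv k = \<one> \<longleftrightarrow> g = inv h \<otimes> k"
proof
  assume "h \<otimes> g \<otimes> inv k = \<one>"
  then have "h \<otimes> g = k" using assms by (metis inv_closed inv_inv inv_unique' m_closed inv_equality)
  then show "g = inv h \<otimes> k" using assms by (metis inv_solve_left')
qed (use assms in \<open>simp add: m_assoc[symmetric]\<close>)

text \<open>In axial gauge a flat field has the same tree edges and plaquette holonomies as the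
  constant field, hence equals it by \<open>axial_determines\<close>.\<close>

lemma flat_box_pure_gauge:
  assumes s: "\<And>e. e \<in> edges {a..b} \<Longrightarrow> \<sigma> e \<in> carrier G" and "flat G \<sigma> {a..b}"
  shows "\<exists>h \<in> UNIV \<rightarrow> carrier G. pure_gauge G h \<sigma> (edges {a..b})"
proof -
  obtain h where h: "h \<in> UNIV \<rightarrow> carrier G" "pure_gauge G h \<sigma> (axial_edges a b)"
    using axial_pure_gauge s by blast
  have hc[simp]: "h x \<in> carrier G" for x using h by auto
  define \<tau> where "\<tau> = gauge G {a..b} h \<sigma>"
  have t: "\<tau> e = h (fst e) \<otimes> \<sigma> e \<otimes> inv h (snd e)" if "e \<in> edges {a..b}" for e
    using that by (simp add: \<tau>_def gauge_def)
  have "\<tau> e = \<one>" if "e \<in> edges {a..b}" for e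
  proof (rule axial_determines[where \<tau> = "\<lambda>_. \<one>" and a = a and b = b])
    show "\<tau> e \<in> carrier G" if "e \<in> edges {a..b}" for e using t[OF that] s[OF that] by simp
    show "\<tau> e = \<one>" if e: "e \<in> axial_edges a b" for e
    proof -
      have E: "e \<in> edges {a..b}" using e by (auto simp: axial_edges_def)
      then show ?thesis using h(2) e t[OF E] s[OF E] gauge_one_iff by (simp add: pure_gauge_def)
    qed
    show "holonomy G \<tau> (boundary p) = holonomy G (\<lambda>_. \<one>) (boundary p)" if p: "p \<in> plaquettes {a..b}" for p
    proof -
      obtain x i j where pp: "p = (x, i, j)" by (cases p)
      have "holonomy G \<tau> (boundary p) = h x \<otimes> holonomy G \<sigma> (boundary p) \<otimes> inv h x"
        using holonomy_transport[OF boundary_oriented[OF p] _ s h(1) t] chain_boundary unfolding pp by blast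
      also have "\<dots> = \<one>" using assms(2) p by (simp add: flat_def)
      also have "\<dots> = holonomy G (\<lambda>_. \<one>) (boundary p)"
        using holonomy_one[OF boundary_oriented[OF p]] by simp
      finally show ?thesis .
    qed
  qed (use that in auto)
  then have "pure_gauge G h \<sigma> (edges {a..b})"
    using t s gauge_one_iff by (auto simp: pure_gauge_def)
  with h show ?thesis by blast
qed

lemma holonomy_pure_gauge:
  assumes "set es \<subseteq> oriented_edges S" "chain x es y" "h \<in> UNIV \<rightarrow> carrier G" "pure_gauge G h \<sigma> (edges S)"
  shows "holonomy G \<sigma> es = inv h x \<otimes> h y"
proof -
  have hc[simp]: "h x \<in> carrier G" for x using assms by auto
  have "holonomy G \<sigma> es = inv h x \<otimes> holonomy G (\<lambda>_. \<one>) es \<otimes> inv (inv h y)"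
    by (rule holonomy_transport[OF assms(1,2), of "\<lambda>_. \<one>" "\<lambda>x. inv h x"])
      (use assms in \<open>auto simp: pure_gauge_def\<close>)
  then show ?thesis using holonomy_one[OF assms(1), of "\<lambda>_. \<one>"] by simp
qed

end

section \<open>Flat fields on the shell of a box\<close>

text \<open>Empty and degenerate boxes are included, so that faces and intersections are boxes
  again.\<close>

definition is_box :: "site set \<Rightarrow> bool" where
  "is_box S \<longleftrightarrow> (\<exists>a b. S = {a..b})"

lemma is_box_Int: "is_box S \<Longrightarrow> is_box T \<Longrightarrow> is_box (S \<inter> T)"
proof -
  have "{a..b} \<inter> {c..d} = {(\<chi> k. max (a $ k) (c $ k))..(\<chi> k. min (b $ k) (d $ k))}" for a b c d :: site
    by (rule Set.set_eqI, unfold Int_iff box_iff) auto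
  then show "is_box S \<Longrightarrow> is_box T \<Longrightarrow> is_box (S \<inter> T)" unfolding is_box_def by metis
qed

lemma is_box_constant:
  assumes "is_box S" "\<And>x y. (x, y) \<in> edges S \<Longrightarrow> c x = c y" "x \<in> S" "y \<in> S"
  shows "c x = c y"
  using assms box_constant unfolding is_box_def by metis

definition face :: "site \<Rightarrow> site \<Rightarrow> 4 \<Rightarrow> int \<Rightarrow> site set" where
  "face u v i c = {x \<in> {u..v}. x $ i = c}"

lemma mem_face_iff: "x \<in> face u v i c \<longleftrightarrow> (\<forall>k. u $ k \<le> x $ k \<and> x $ k \<le> v $ k) \<and> x $ i = c"
  unfolding face_def mem_Collect_eq box_iff ..

lemma is_box_face: "is_box (face u v i c)"
proof -
  have "is_box {(\<chi> k. if k = i then c else u $ k)..(\<chi> k. if k = i then c else v $ k)}"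
    unfolding is_box_def by blast
  moreover have "face u v i c = {(\<chi> k. if k = i then c else u $ k)..(\<chi> k. if k = i then c else v $ k)} \<inter> {u..v}"
    by (rule Set.set_eqI, unfold Int_iff box_iff mem_face_iff) (auto split: if_splits)
  ultimately show ?thesis using is_box_Int[of _ "{u..v}"] unfolding is_box_def by metis
qed

definition move_to :: "4 \<Rightarrow> int \<Rightarrow> site \<Rightarrow> site" where
  "move_to i c x = (\<chi> k. if k = i then c else x $ k)"

lemma move_to_face:
  "x \<in> {u..v} \<Longrightarrow> u $ i \<le> c \<Longrightarrow> c \<le> v $ i \<Longrightarrow> move_to i c x \<in> face u v i c"
  "x \<in> face u v j d \<Longrightarrow> j \<noteq> i \<Longrightarrow> u $ i \<le> c \<Longrightarrow> c \<le> v $ i \<Longrightarrow> move_to i c x \<in> face u v j d"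
  unfolding mem_face_iff box_iff by (auto simp: move_to_def)

context group
begin

text \<open>On the overlap with \<open>F\<close> the two potentials differ by a left factor
  \<open>h k^-1\<close> that is constant along edges, hence constant on each box
  \<open>F' \<inter> F\<close>. By \<open>linked\<close> it is the same constant on all of these
  boxes, so it can be absorbed into \<open>k\<close>. This is the place where the van Kampen theorem
  asks for a connected intersection.\<close>

lemma pure_gauge_glue:
  assumes boxes: "\<And>F'. F' \<in> \<F> \<Longrightarrow> is_box F'" "is_box F"
    and h: "h \<in> UNIV \<rightarrow> carrier G" "\<And>F'. F' \<in> \<F> \<Longrightarrow> pure_gauge G h \<sigma> (edges F')"
    and k: "k \<in> UNIV \<rightarrow> carrier G" "pure_gauge G k \<sigma> (edges F)"
    and linked: "\<And>F1 F2. F1 \<in> \<F> \<Longrightarrow> F2 \<in> \<F> \<Longrightarrow> F1 \<inter> F \<noteq> {} \<Longrightarrow> F2 \<inter> F \<noteq> {} \<Longrightarrow>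
      F1 \<inter> F2 \<inter> F \<noteq> {} \<or> (\<exists>F3\<in>\<F>. F1 \<inter> F3 \<inter> F \<noteq> {} \<and> F3 \<inter> F2 \<inter> F \<noteq> {})"
  shows "\<exists>h' \<in> UNIV \<rightarrow> carrier G. \<forall>F'\<in>insert F \<F>. pure_gauge G h' \<sigma> (edges F')"
proof -
  have hc[simp]: "h x \<in> carrier G" "k x \<in> carrier G" for x using h k by auto
  define c where "c x = h x \<otimes> inv k x" for x
  have cc[simp]: "c x \<in> carrier G" for x by (simp add: c_def)
  have loc: "c x = c y" if "F1 \<in> \<F>" "x \<in> F1 \<inter> F" "y \<in> F1 \<inter> F" for F1 x y
  proof (rule is_box_constant[of "F1 \<inter> F" c])
    fix x y assume "(x, y) \<in> edges (F1 \<inter> F)"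
    then have "(x, y) \<in> edges F1" "(x, y) \<in> edges F" using edges_mono by blast+
    then have "inv h x \<otimes> h y = inv k x \<otimes> k y"
      using h(2)[OF that(1)] k(2) by (auto simp: pure_gauge_def)
    then have "h y = h x \<otimes> (inv k x \<otimes> k y)" by (metis hc inv_closed inv_solve_left m_closed)
    then show "c x = c y" by (simp add: c_def m_assoc)
  qed (use that boxes is_box_Int in auto)
  have glob: "c x = c y" if "F1 \<in> \<F>" "x \<in> F1 \<inter> F" "F2 \<in> \<F>" "y \<in> F2 \<inter> F" for F1 F2 x y
  proof -
    have "F1 \<inter> F2 \<inter> F \<noteq> {} \<or> (\<exists>F3\<in>\<F>. F1 \<inter> F3 \<inter> F \<noteq> {} \<and> F3 \<inter> F2 \<inter> F \<noteq> {})"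
      using linked that by blast
    then show ?thesis
    proof
      assume "F1 \<inter> F2 \<inter> F \<noteq> {}"
      then obtain z where "z \<in> F1 \<inter> F" "z \<in> F2 \<inter> F" by blast
      then show ?thesis using loc[of F1 x z] loc[of F2 z y] that by simp
    next
      assume "\<exists>F3\<in>\<F>. F1 \<inter> F3 \<inter> F \<noteq> {} \<and> F3 \<inter> F2 \<inter> F \<noteq> {}"
      then obtain F3 z w where F3: "F3 \<in> \<F>" and z: "z \<in> F1 \<inter> F" "z \<in> F3 \<inter> F" "w \<in> F3 \<inter> F" "w \<in> F2 \<inter> F" by blast
      have "c x = c z" using loc[OF that(1,2) z(1)] .
      also have "\<dots> = c w" using loc[OF F3 z(2,3)] .
      also have "\<dots> = c y" using loc[OF that(3) z(4) that(4)] .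
      finally show ?thesis .
    qed
  qed
  \<comment> \<open>If \<open>F\<close> meets no member of the family, the factor is arbitrary and
    one is taken.\<close>
  obtain c0 where c0: "c0 \<in> carrier G" "\<And>x F'. F' \<in> \<F> \<Longrightarrow> x \<in> F' \<inter> F \<Longrightarrow> c x = c0"
  proof (cases "\<exists>x F'. F' \<in> \<F> \<and> x \<in> F' \<inter> F")
    case True
    then obtain x F' where "F' \<in> \<F>" "x \<in> F' \<inter> F" by blast
    then show ?thesis using that[of "c x"] glob by (metis cc)
  next
    case False
    then show ?thesis using that[of \<one>] by auto
  qed
  define h' where "h' x = (if x \<in> F then c0 \<otimes> k x else h x)" for x
  have "h' x = h x" if "F' \<in> \<F>" "x \<in> F'" for x F'
  proof (cases "x \<in> F")
    case True
    then have "c0 = h x \<otimes> inv k x" using c0(2)[of F' x] that by (simp add: c_def)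
    then show ?thesis using True by (simp add: h'_def m_assoc)
  qed (simp add: h'_def)
  then have "pure_gauge G h' \<sigma> (edges F')" if "F' \<in> \<F>" for F'
    using h(2)[OF that] that by (auto simp: pure_gauge_def edges_def)
  moreover have "pure_gauge G h' \<sigma> (edges F)"
    unfolding pure_gauge_def
  proof
    fix e assume e: "e \<in> edges F"
    then have "h' (fst e) = c0 \<otimes> k (fst e)" "h' (snd e) = c0 \<otimes> k (snd e)"
      by (auto simp: h'_def edges_def)
    then have "inv h' (fst e) \<otimes> h' (snd e) = inv k (fst e) \<otimes> ((inv c0 \<otimes> c0) \<otimes> k (snd e))"
      using c0(1) hc by (simp only: inv_mult_group m_assoc inv_closed m_closed)
    then show "\<sigma> e = inv h' (fst e) \<otimes> h' (snd e)"
      using k(2) e c0(1) by (simp add: pure_gauge_def)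
  qed
  moreover have "h' \<in> UNIV \<rightarrow> carrier G" using c0(1) by (auto simp: h'_def)
  ultimately show ?thesis by blast
qed

lemma flat_is_box_pure_gauge:
  assumes "is_box S" "\<And>e. e \<in> edges S \<Longrightarrow> \<sigma> e \<in> carrier G" "flat G \<sigma> S"
  shows "\<exists>h \<in> UNIV \<rightarrow> carrier G. pure_gauge G h \<sigma> (edges S)"
  using assms flat_box_pure_gauge unfolding is_box_def by blast

text \<open>All the other faces meet the base slice, and so do their pairwise intersections.\<close>

lemma pure_gauge_star:
  assumes "u \<le> v" and s: "\<And>e. e \<in> edges {u..v} \<Longrightarrow> \<sigma> e \<in> carrier G"
    and base: "u $ i \<le> c" "c \<le> v $ i" "flat G \<sigma> (face u v i c)"
    and J: "finite J" "\<And>j d. (j, d) \<in> J \<Longrightarrow> j \<noteq> i \<and> u $ j \<le> d \<and> d \<le> v $ j \<and> flat G \<sigma> (face u v j d)"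
  shows "\<exists>h \<in> UNIV \<rightarrow> carrier G. \<forall>F\<in>insert (face u v i c) ((\<lambda>(j, d). face u v j d) ` J). pure_gauge G h \<sigma> (edges F)"
  using J
proof (induction J rule: finite_induct)
  case empty
  have "\<And>e. e \<in> edges (face u v i c) \<Longrightarrow> \<sigma> e \<in> carrier G"
    using s edges_mono[of "face u v i c" "{u..v}"] unfolding face_def by blast
  then show ?case using flat_is_box_pure_gauge[OF is_box_face _ base(3)] by simp
next
  case (insert jd J)
  obtain j d where jd: "jd = (j, d)" by (cases jd)
  have j: "j \<noteq> i" "u $ j \<le> d" "d \<le> v $ j" "flat G \<sigma> (face u v j d)" using insert.prems jd by auto
  let ?\<F> = "insert (face u v i c) ((\<lambda>(j, d). face u v j d) ` J)"
  let ?F = "face u v j d"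
  obtain h where h: "h \<in> UNIV \<rightarrow> carrier G" "\<And>F. F \<in> ?\<F> \<Longrightarrow> pure_gauge G h \<sigma> (edges F)"
    using insert.IH insert.prems by blast
  have "\<And>e. e \<in> edges ?F \<Longrightarrow> \<sigma> e \<in> carrier G"
    using s edges_mono[of ?F "{u..v}"] unfolding face_def by blast
  then obtain k where k: "k \<in> UNIV \<rightarrow> carrier G" "pure_gauge G k \<sigma> (edges ?F)"
    using flat_is_box_pure_gauge[OF is_box_face _ j(4)] by blast
  have meet: "F1 \<inter> face u v i c \<inter> ?F \<noteq> {}" if F1: "F1 \<in> ?\<F>" "F1 \<inter> ?F \<noteq> {}" for F1
  proof -
    obtain x where x: "x \<in> F1" "x \<in> ?F" using F1(2) by (metis Int_iff ex_in_conv)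
    \<comment> \<open>Moving along direction \<open>i\<close> preserves every face orthogonal to
      another direction.\<close>
    then have "move_to i c x \<in> face u v i c" "move_to i c x \<in> ?F"
      using move_to_face base j by (auto simp: face_def)
    moreover have "move_to i c x \<in> F1"
      using F1(1)
    proof
      assume "F1 \<in> (\<lambda>(j, d). face u v j d) ` J"
      then obtain j' d' where "(j', d') \<in> J" "F1 = face u v j' d'" by auto
      then show ?thesis using insert.prems x base move_to_face(2) by blast
    qed (use calculation in simp)
    ultimately show ?thesis by blast
  qed
  have "\<exists>h' \<in> UNIV \<rightarrow> carrier G. \<forall>F'\<in>insert ?F ?\<F>. pure_gauge G h' \<sigma> (edges F')"
  proof (rule pure_gauge_glue[OF _ is_box_face h k])
    show "is_box F'" if "F' \<in> ?\<F>" for F' using that is_box_face by auto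
    show "F1 \<inter> F2 \<inter> ?F \<noteq> {} \<or> (\<exists>F3\<in>?\<F>. F1 \<inter> F3 \<inter> ?F \<noteq> {} \<and> F3 \<inter> F2 \<inter> ?F \<noteq> {})"
      if "F1 \<in> ?\<F>" "F2 \<in> ?\<F>" "F1 \<inter> ?F \<noteq> {}" "F2 \<inter> ?F \<noteq> {}" for F1 F2
    proof -
      have "F1 \<inter> face u v i c \<inter> ?F \<noteq> {}" "face u v i c \<inter> F2 \<inter> ?F \<noteq> {}"
        using meet[OF that(1,3)] meet[OF that(2,4)] by (auto simp: Int_commute)
      then show ?thesis by blast
    qed
  qed
  then show ?case unfolding jd by (simp add: insert_commute)
qed

end

text \<open>Only these faces separate plaquettes inside from plaquettes outside; a side on the
  boundary of the lattice has nothing beyond it. A face is given by its direction and coordinate, so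
  the two sides of a degenerate direction coincide.\<close>

definition inner_faces :: "site \<Rightarrow> site \<Rightarrow> site \<Rightarrow> site \<Rightarrow> (4 \<times> int) set" where
  "inner_faces a b u v = {(i, c). c = u $ i \<and> a $ i < u $ i \<or> c = v $ i \<and> v $ i < b $ i}"

text \<open>Edges that join two faces without lying in one are left out; they occur in a box of
  width one and belong to its interior.\<close>

definition shell :: "site \<Rightarrow> site \<Rightarrow> site \<Rightarrow> site \<Rightarrow> edge set" where
  "shell a b u v = (\<Union>(i, c)\<in>inner_faces a b u v. edges (face u v i c))"

lemma shell_subset: "shell a b u v \<subseteq> edges {u..v}"
proof -
  have "edges (face u v i c) \<subseteq> edges {u..v}" for i c by (rule edges_mono) (auto simp: face_def)
  then show ?thesis unfolding shell_def by blast
qed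

lemma finite_inner_faces: "finite (inner_faces a b u v)"
proof (rule finite_subset)
  show "inner_faces a b u v \<subseteq> (\<lambda>i. (i, u $ i)) ` UNIV \<union> (\<lambda>i. (i, v $ i)) ` UNIV"
    by (auto simp: inner_faces_def)
qed simp

text \<open>Supplies the third face through which two parallel faces are linked.\<close>

lemma exists_other_direction: "\<exists>l::4. l \<noteq> i \<and> l \<noteq> j"
proof -
  have "card {i, j} < card (UNIV :: 4 set)" by (rule le_less_trans[OF card_insert_le_m1[of 2]]) auto
  then have "{i, j} \<noteq> UNIV" by auto
  then show ?thesis by auto
qed

context group
begin

text \<open>A direction without inner faces contributes its flat slice as the base of the star. If
  every direction has an inner face, one face is the base for all faces of the other directions, and
  the face opposite to it, if inner, is glued on last.\<close>

lemma shell_pure_gauge: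
  assumes "u \<le> v" and s: "\<And>e. e \<in> edges {u..v} \<Longrightarrow> \<sigma> e \<in> carrier G"
    and flat: "\<And>i c. (i, c) \<in> inner_faces a b u v \<Longrightarrow> flat G \<sigma> (face u v i c)"
    and cut: "\<And>i. (\<forall>c. (i, c) \<notin> inner_faces a b u v) \<Longrightarrow> \<exists>c. u $ i \<le> c \<and> c \<le> v $ i \<and> flat G \<sigma> (face u v i c)"
  shows "\<exists>h \<in> UNIV \<rightarrow> carrier G. pure_gauge G h \<sigma> (shell a b u v)"
proof -
  let ?I = "inner_faces a b u v"
  let ?fs = "\<lambda>J. (\<lambda>(j, d). face u v j d) ` J"
  have uv: "u $ i \<le> v $ i" for i using assms(1) by (simp add: less_eq_vec_def)
  have I: "u $ i \<le> c \<and> c \<le> v $ i" if "(i, c) \<in> ?I" for i c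
    using that uv by (auto simp: inner_faces_def)
  have pure: "pure_gauge G h \<sigma> (shell a b u v)"
    if "\<And>j d. (j, d) \<in> ?I \<Longrightarrow> pure_gauge G h \<sigma> (edges (face u v j d))" for h
    using that unfolding pure_gauge_def shell_def by fast
  have face_subset: "x \<in> {u..v}" if "x \<in> face u v j d" for x j d
    using that by (simp add: face_def)
  show ?thesis
  proof (cases "\<exists>i. \<forall>c. (i, c) \<notin> ?I")
    case True
    then obtain i where i: "\<forall>c. (i, c) \<notin> ?I" by blast
    then obtain c where c: "u $ i \<le> c" "c \<le> v $ i" "flat G \<sigma> (face u v i c)" using cut by blast
    have "j \<noteq> i \<and> u $ j \<le> d \<and> d \<le> v $ j \<and> flat G \<sigma> (face u v j d)" if "(j, d) \<in> ?I" for j d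
      using that i I flat by blast
    from pure_gauge_star[OF assms(1) s c finite_inner_faces this]
    obtain h where "h \<in> UNIV \<rightarrow> carrier G" and
      h: "\<forall>F\<in>insert (face u v i c) (?fs ?I). pure_gauge G h \<sigma> (edges F)" by blast
    moreover have "pure_gauge G h \<sigma> (edges (face u v j d))" if "(j, d) \<in> ?I" for j d
      using h that by (metis (no_types, lifting) case_prod_conv image_eqI insertI2)
    ultimately show ?thesis using pure by blast
  next
    case False
    then have ex: "\<exists>c. (i, c) \<in> ?I" for i by blast
    \<comment> \<open>Every direction would do here.\<close>
    define i :: 4 where "i = 0"
    obtain c where c: "(i, c) \<in> ?I" using False by blast
    let ?J = "{(j, d) \<in> ?I. j \<noteq> i}"
    let ?\<F> = "insert (face u v i c) (?fs ?J)"
    have fJ: "finite ?J" by (rule finite_subset[OF _ finite_inner_faces[of a b u v]]) auto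
    have PJ: "j \<noteq> i \<and> u $ j \<le> d \<and> d \<le> v $ j \<and> flat G \<sigma> (face u v j d)" if "(j, d) \<in> ?J" for j d
      using that I[of j d] flat[of j d] by simp
    obtain h where h: "h \<in> UNIV \<rightarrow> carrier G" "\<And>F. F \<in> ?\<F> \<Longrightarrow> pure_gauge G h \<sigma> (edges F)"
      using pure_gauge_star[OF assms(1) s _ _ flat[OF c] fJ PJ] I[OF c] by meson
    show ?thesis
    proof (cases "\<exists>c'. c' \<noteq> c \<and> (i, c') \<in> ?I")
      case False
      have "pure_gauge G h \<sigma> (edges (face u v j d))" if "(j, d) \<in> ?I" for j d
      proof (rule h(2))
        show "face u v j d \<in> ?\<F>" using that False by (cases "j = i") auto
      qed
      then show ?thesis using h(1) pure by blast
    next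
      case True
      then obtain c' where c': "c' \<noteq> c" "(i, c') \<in> ?I" by blast
      let ?F = "face u v i c'"
      have e: "\<And>e. e \<in> edges ?F \<Longrightarrow> \<sigma> e \<in> carrier G"
        using s edges_mono[of ?F "{u..v}"] unfolding face_def by blast
      obtain k where k: "k \<in> UNIV \<rightarrow> carrier G" "pure_gauge G k \<sigma> (edges ?F)"
        using flat_is_box_pure_gauge[OF is_box_face e flat[OF c'(2)]] by blast
      \<comment> \<open>A point with the three prescribed coordinates lies in all three
        faces.\<close>
      have three: "face u v j d \<inter> face u v l g \<inter> ?F \<noteq> {}"
        if "(j, d) \<in> ?J" "(l, g) \<in> ?J" "j \<noteq> l" for j d l g
      proof -
        have b: "u $ j \<le> d" "d \<le> v $ j" "u $ l \<le> g" "g \<le> v $ l" "u $ i \<le> c'" "c' \<le> v $ i"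
          using that I[of j d] I[of l g] I[OF c'(2)] by auto
        let ?x = "move_to j d (move_to l g (move_to i c' u))"
        have x0: "move_to i c' u \<in> ?F" using move_to_face(1)[of u u v i c'] b assms(1) by simp
        have x1: "move_to l g (move_to i c' u) \<in> face u v l g"
          using move_to_face(1)[OF face_subset[OF x0]] b by blast
        have x2: "move_to l g (move_to i c' u) \<in> ?F"
          using move_to_face(2)[OF x0, of l g] b that by auto
        have "?x \<in> face u v j d" using move_to_face(1)[OF face_subset[OF x1]] b by blast
        moreover have "?x \<in> face u v l g" "?x \<in> ?F"
          using move_to_face(2)[OF x1, of j d] move_to_face(2)[OF x2, of j d] b that by auto
        ultimately have "?x \<in> face u v j d" "?x \<in> face u v l g" "?x \<in> ?F" by blast+
        then show ?thesis by blast
      qed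
      have "\<exists>h' \<in> UNIV \<rightarrow> carrier G. \<forall>F'\<in>insert ?F ?\<F>. pure_gauge G h' \<sigma> (edges F')"
      proof (rule pure_gauge_glue[OF _ is_box_face h k])
        show "is_box F'" if "F' \<in> ?\<F>" for F' using that is_box_face by auto
        show "F1 \<inter> F2 \<inter> ?F \<noteq> {} \<or> (\<exists>F3\<in>?\<F>. F1 \<inter> F3 \<inter> ?F \<noteq> {} \<and> F3 \<inter> F2 \<inter> ?F \<noteq> {})"
          if F: "F1 \<in> ?\<F>" "F2 \<in> ?\<F>" "F1 \<inter> ?F \<noteq> {}" "F2 \<inter> ?F \<noteq> {}" for F1 F2
        proof -
          have dis: "face u v i c \<inter> ?F = {}"
            unfolding face_def using c'(1) by (intro equals0I) (simp only: Int_iff mem_Collect_eq, metis)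
          have param: "\<exists>j d. (j, d) \<in> ?J \<and> F1 = face u v j d" if "F1 \<in> ?\<F>" "F1 \<inter> ?F \<noteq> {}" for F1
          proof -
            have ne: "F1 \<noteq> face u v i c" using that(2) dis by metis
            from that(1) have "F1 \<in> ?fs ?J"
            proof (rule insertE)
              assume "F1 = face u v i c"
              with ne show ?thesis by contradiction
            qed
            then obtain q where q: "q \<in> ?J" "F1 = (case q of (j, d) \<Rightarrow> face u v j d)" by (rule imageE)
            show ?thesis
            proof (intro exI conjI)
              show "(fst q, snd q) \<in> ?J" using q(1) by simp
              show "F1 = face u v (fst q) (snd q)" using q(2) by (simp add: case_prod_beta)
            qed
          qed
          obtain j d where j: "(j, d) \<in> ?J" "F1 = face u v j d" using param[OF F(1,3)] by (elim exE conjE)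
          obtain l g where l: "(l, g) \<in> ?J" "F2 = face u v l g" using param[OF F(2,4)] by (elim exE conjE)
          show ?thesis
          proof (cases "j = l")
            case False
            then show ?thesis using three[OF j(1) l(1)] j(2) l(2) by simp
          next
            case True
            \<comment> \<open>Parallel faces, or one face taken twice, are linked through a face of
              a third direction, which exists because no direction lacks inner faces.\<close>
            obtain m where m: "m \<noteq> i" "m \<noteq> j" using exists_other_direction by blast
            obtain n where "(m, n) \<in> ?I" using ex m by blast
            then have n: "(m, n) \<in> ?J" using m by simp
            have m1: "F1 \<inter> face u v m n \<inter> ?F \<noteq> {}" using three[OF j(1) n] m j(2) by simp
            have m2: "face u v m n \<inter> F2 \<inter> ?F \<noteq> {}" using three[OF n l(1)] m l(2) True by simp
            have m3: "face u v m n \<in> ?\<F>" using n by (intro insertI2 image_eqI[of _ _ "(m, n)"]) simp_all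
            show ?thesis by (intro disjI2 bexI[OF _ m3] conjI m1 m2)
          qed
        qed
      qed
      then obtain h' where h': "h' \<in> UNIV \<rightarrow> carrier G" "\<And>F'. F' \<in> insert ?F ?\<F> \<Longrightarrow> pure_gauge G h' \<sigma> (edges F')"
        by blast
      have two: "d = c \<or> d = c'" if "(i, d) \<in> ?I" for d
        using that c c' by (auto simp: inner_faces_def)
      have "pure_gauge G h' \<sigma> (edges (face u v j d))" if "(j, d) \<in> ?I" for j d
      proof (rule h'(2))
        show "face u v j d \<in> insert ?F ?\<F>" using that two by (cases "j = i") auto
      qed
      then show ?thesis using h'(1) pure by blast
    qed
  qed
qed

end

text \<open>A plaquette leaving the box through an edge forces that edge into an inner face.\<close>

lemma plaquette_inside:
  assumes p: "p \<in> plaquettes {a..b}" and e: "e \<in> plaquette_edges p" "e \<in> edges {u..v}" "e \<notin> shell a b u v"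
  shows "p \<in> plaquettes {u..v}"
proof -
  obtain x i j where pp: "p = (x, i, j)" by (cases p)
  have ij: "i < j" and P: "x \<in> {a..b}" "x + axis i 1 \<in> {a..b}" "x + axis j 1 \<in> {a..b}" "x + axis i 1 + axis j 1 \<in> {a..b}"
    using p unfolding pp plaquettes_iff by auto
  \<comment> \<open>If a step in direction \<open>l\<close> from the edge left the box, the edge
    would lie in an inner face orthogonal to \<open>l\<close>, hence in the shell.\<close>
  have up: "z \<in> {u..v}" "z + axis k 1 \<in> {u..v}"
    if "(y, y + axis k 1) \<in> edges {u..v}" "(y, y + axis k 1) \<notin> shell a b u v" "l \<noteq> k" "z \<in> {a..b}"
      "z = y + axis l 1 \<or> z = y - axis l 1" for y z k l
  proof -
    have y: "y \<in> {u..v}" "y + axis k 1 \<in> {u..v}" using that by (auto simp: edges_iff)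
    have yl: "(y + axis k 1) $ l = y $ l" using that by (simp add: axis_def)
    have "(y, y + axis k 1) \<in> edges (face u v l (y $ l))"
      using that(1) y yl unfolding edges_iff face_def by auto
    then have "(l, y $ l) \<notin> inner_faces a b u v" using that(2) unfolding shell_def by blast
    then have n: "\<not> (y $ l = u $ l \<and> a $ l < u $ l)" "\<not> (y $ l = v $ l \<and> v $ l < b $ l)"
      unfolding inner_faces_def by auto
    have zl: "a $ l \<le> z $ l" "z $ l \<le> b $ l" using that(4) unfolding box_iff by auto
    have l: "u $ l \<le> y $ l" "y $ l \<le> v $ l" using y(1) unfolding box_iff by auto
    have o: "z $ m = y $ m" if "m \<noteq> l" for m using \<open>z = _ \<or> z = _\<close> that by (auto simp: axis_def)
    have "z $ l = y $ l + 1 \<or> z $ l = y $ l - 1" using \<open>z = _ \<or> z = _\<close> by auto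
    then have L: "u $ l \<le> z $ l \<and> z $ l \<le> v $ l" using n zl l by auto
    show "z \<in> {u..v}" unfolding box_iff
    proof
      fix m show "u $ m \<le> z $ m \<and> z $ m \<le> v $ m"
        using L o[of m] y(1) unfolding box_iff by (cases "m = l") auto
    qed
    show "z + axis k 1 \<in> {u..v}" unfolding box_iff
    proof
      fix m show "u $ m \<le> (z + axis k 1) $ m \<and> (z + axis k 1) $ m \<le> v $ m"
      proof (cases "m = l")
        case True
        then show ?thesis using L that(3) by (auto simp: axis_def)
      next
        case False
        then have "(z + axis k 1) $ m = (y + axis k 1) $ m" using o by simp
        then show ?thesis using y(2) unfolding box_iff by metis
      qed
    qed
  qed
  have c: "x + axis i 1 + axis j 1 = x + axis j 1 + axis i 1" by (simp add: add_ac)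
  have "x \<in> {u..v} \<and> x + axis i 1 + axis j 1 \<in> {u..v}"
  proof -
    consider "e = (x, x + axis i 1)" | "e = (x + axis i 1, x + axis i 1 + axis j 1)"
      | "e = (x + axis j 1, x + axis j 1 + axis i 1)" | "e = (x, x + axis j 1)"
      using e(1) unfolding pp by (auto simp: c)
    then show ?thesis
    proof cases
      case 1
      then show ?thesis using up[of x i j "x + axis j 1"] e ij P by (auto simp: edges_iff add_ac)
    next
      case 2
      then show ?thesis using up[of "x + axis i 1" j i x] e ij P by (auto simp: edges_iff add_ac)
    next
      case 3
      then show ?thesis using up[of "x + axis j 1" i j x] e ij P by (auto simp: edges_iff add_ac)
    next
      case 4
      then show ?thesis using up[of x j i "x + axis i 1"] e ij P by (auto simp: edges_iff add_ac)
    qed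
  qed
  then show ?thesis unfolding pp plaquettes_box_iff using ij by blast
qed

section \<open>Partition functions restricted by the support\<close>

text \<open>The weight of a plaquette is abstract because the locale is instantiated with the
  squared group, whose weight is a product over the two copies. \<open>w_one\<close> makes unexcited
  plaquettes free, and \<open>\<delta>\<close> bounds the weight of an excited one.\<close>

locale gauge_theory = group G for G (structure) +
  fixes a b :: site and w :: "'a \<Rightarrow> real" and \<delta> :: real
  assumes finite_carrier: "finite (carrier G)"
    and ab: "a \<le> b"
    and w_one: "w \<one> = 1"
    and w_nonneg: "g \<in> carrier G \<Longrightarrow> 0 \<le> w g"
    and w_conj: "g \<in> carrier G \<Longrightarrow> h \<in> carrier G \<Longrightarrow> w (h \<otimes> g \<otimes> inv h) = w g"
    and w_le: "g \<in> carrier G \<Longrightarrow> g \<noteq> \<one> \<Longrightarrow> w g \<le> \<delta>"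
    and \<delta>_nonneg: "0 \<le> \<delta>"
begin

abbreviation \<Lambda> :: "site set" where "\<Lambda> \<equiv> {a..b}"

abbreviation C :: "(edge \<Rightarrow> 'a) set" where "C \<equiv> configs G \<Lambda>"

abbreviation hol :: "(edge \<Rightarrow> 'a) \<Rightarrow> plaquette \<Rightarrow> 'a" where "hol \<sigma> p \<equiv> holonomy G \<sigma> (boundary p)"

definition supp :: "(edge \<Rightarrow> 'a) \<Rightarrow> plaquette set" where
  "supp \<sigma> = {p \<in> plaquettes \<Lambda>. hol \<sigma> p \<noteq> \<one>}"

definition weight :: "(edge \<Rightarrow> 'a) \<Rightarrow> real" where
  "weight \<sigma> = (\<Prod>p\<in>plaquettes \<Lambda>. w (hol \<sigma> p))"

definition gauge_inv :: "((edge \<Rightarrow> 'a) \<Rightarrow> 'c) \<Rightarrow> bool" where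
  "gauge_inv F \<longleftrightarrow> (\<forall>\<sigma>\<in>C. \<forall>h\<in>UNIV \<rightarrow> carrier G. F (gauge G \<Lambda> h \<sigma>) = F \<sigma>)"

definition depends_on :: "((edge \<Rightarrow> 'a) \<Rightarrow> 'c) \<Rightarrow> edge set \<Rightarrow> bool" where
  "depends_on F D \<longleftrightarrow> (\<forall>\<sigma>\<in>C. \<forall>\<tau>\<in>C. (\<forall>e\<in>D. \<sigma> e = \<tau> e) \<longrightarrow> F \<sigma> = F \<tau>)"

text \<open>The value one off the lattice makes this set finite, so that gauge transformations can
  be counted.\<close>

definition gauges :: "(site \<Rightarrow> 'a) set" where
  "gauges = {h. \<forall>x. (x \<in> \<Lambda> \<longrightarrow> h x \<in> carrier G) \<and> (x \<notin> \<Lambda> \<longrightarrow> h x = \<one>)}"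

lemma gaugesD: "h \<in> gauges \<Longrightarrow> h x \<in> carrier G"
  unfolding gauges_def by (cases "x \<in> \<Lambda>") auto

lemma gauges_Pi: "h \<in> gauges \<Longrightarrow> h \<in> UNIV \<rightarrow> carrier G"
  using gaugesD by blast

lemma finite_gauges: "finite gauges"
  unfolding gauges_def by (rule finite_set_of_finite_funs[OF finite_box finite_carrier])

lemma finite_C: "finite C"
  unfolding configs_def by (intro finite_PiE finite_edges finite_box finite_carrier)

lemma CD: "\<sigma> \<in> C \<Longrightarrow> e \<in> edges \<Lambda> \<Longrightarrow> \<sigma> e \<in> carrier G"
  by (auto simp: configs_def)

lemma C_eqI: "\<sigma> \<in> C \<Longrightarrow> \<tau> \<in> C \<Longrightarrow> (\<And>e. e \<in> edges \<Lambda> \<Longrightarrow> \<sigma> e = \<tau> e) \<Longrightarrow> \<sigma> = \<tau>"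
  unfolding configs_def by (rule PiE_ext)

lemma gauge_in_C: "\<sigma> \<in> C \<Longrightarrow> h \<in> UNIV \<rightarrow> carrier G \<Longrightarrow> gauge G \<Lambda> h \<sigma> \<in> C"
  unfolding configs_def gauge_def by (auto simp: Pi_iff)

lemma gauge_edge: "e \<in> edges \<Lambda> \<Longrightarrow> gauge G \<Lambda> h \<sigma> e = h (fst e) \<otimes> \<sigma> e \<otimes> inv h (snd e)"
  by (simp add: gauge_def)

lemma gauge_inverse:
  assumes "\<sigma> \<in> C" "h \<in> UNIV \<rightarrow> carrier G"
  shows "gauge G \<Lambda> (\<lambda>x. inv h x) (gauge G \<Lambda> h \<sigma>) = \<sigma>" "gauge G \<Lambda> h (gauge G \<Lambda> (\<lambda>x. inv h x) \<sigma>) = \<sigma>"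
proof -
  have hc[simp]: "h x \<in> carrier G" for x using assms by auto
  have i: "(\<lambda>x. inv h x) \<in> UNIV \<rightarrow> carrier G" by simp
  have e: "inv x \<otimes> (x \<otimes> s \<otimes> inv y) \<otimes> y = s" "x \<otimes> (inv x \<otimes> s \<otimes> y) \<otimes> inv y = s"
    if "x \<in> carrier G" "y \<in> carrier G" "s \<in> carrier G" for x y s
  proof -
    have "inv x \<otimes> (x \<otimes> s \<otimes> inv y) \<otimes> y = (inv x \<otimes> x) \<otimes> s \<otimes> (inv y \<otimes> y)"
      "x \<otimes> (inv x \<otimes> s \<otimes> y) \<otimes> inv y = (x \<otimes> inv x) \<otimes> s \<otimes> (y \<otimes> inv y)"
      using that by (simp_all only: m_assoc m_closed inv_closed)
    then show "inv x \<otimes> (x \<otimes> s \<otimes> inv y) \<otimes> y = s" "x \<otimes> (inv x \<otimes> s \<otimes> y) \<otimes> inv y = s"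
      using that by simp_all
  qed
  show "gauge G \<Lambda> (\<lambda>x. inv h x) (gauge G \<Lambda> h \<sigma>) = \<sigma>"
    by (rule C_eqI) (use assms i in \<open>simp_all add: gauge_in_C gauge_edge e CD\<close>)
  show "gauge G \<Lambda> h (gauge G \<Lambda> (\<lambda>x. inv h x) \<sigma>) = \<sigma>"
    by (rule C_eqI) (use assms i in \<open>simp_all add: gauge_in_C gauge_edge e CD\<close>)
qed

lemma bij_gauge: "h \<in> UNIV \<rightarrow> carrier G \<Longrightarrow> bij_betw (gauge G \<Lambda> h) C C"
  by (rule bij_betw_byWitness[of _ "gauge G \<Lambda> (\<lambda>x. inv h x)"]) (auto simp: gauge_inverse gauge_in_C Pi_iff)

lemma hol_closed: "\<sigma> \<in> C \<Longrightarrow> p \<in> plaquettes \<Lambda> \<Longrightarrow> hol \<sigma> p \<in> carrier G"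
  by (rule holonomy_closed[OF boundary_oriented]) (auto intro: CD)

lemma hol_gauge:
  assumes "\<sigma> \<in> C" "h \<in> UNIV \<rightarrow> carrier G" "p \<in> plaquettes \<Lambda>"
  shows "hol (gauge G \<Lambda> h \<sigma>) p = h (fst p) \<otimes> hol \<sigma> p \<otimes> inv h (fst p)"
proof -
  have "chain (fst p) (boundary p) (fst p)" by (cases p) simp
  then show ?thesis
    by (rule holonomy_transport[OF boundary_oriented[OF assms(3)]]) (use assms in \<open>simp_all add: CD gauge_edge\<close>)
qed

lemma conj_eq_one_iff: "g \<in> carrier G \<Longrightarrow> h \<in> carrier G \<Longrightarrow> h \<otimes> g \<otimes> inv h = \<one> \<longleftrightarrow> g = \<one>"
  using gauge_one_iff[of g h h] by simp

lemma supp_gauge: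
  assumes "\<sigma> \<in> C" "h \<in> UNIV \<rightarrow> carrier G"
  shows "supp (gauge G \<Lambda> h \<sigma>) = supp \<sigma>"
proof -
  have "h x \<in> carrier G" for x using assms by auto
  then show ?thesis unfolding supp_def using hol_gauge[OF assms] hol_closed[OF assms(1)] conj_eq_one_iff by auto
qed

lemma w_hol_gauge:
  assumes "\<sigma> \<in> C" "h \<in> UNIV \<rightarrow> carrier G" "p \<in> plaquettes \<Lambda>"
  shows "w (hol (gauge G \<Lambda> h \<sigma>) p) = w (hol \<sigma> p)"
proof -
  have "h x \<in> carrier G" for x using assms by auto
  then show ?thesis using hol_gauge[OF assms] hol_closed[OF assms(1,3)] w_conj by simp
qed

lemma weight_gauge: "\<sigma> \<in> C \<Longrightarrow> h \<in> UNIV \<rightarrow> carrier G \<Longrightarrow> weight (gauge G \<Lambda> h \<sigma>) = weight \<sigma>"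
  unfolding weight_def by (rule prod.cong) (auto simp: w_hol_gauge)

lemma weight_nonneg: "\<sigma> \<in> C \<Longrightarrow> 0 \<le> weight \<sigma>"
  unfolding weight_def by (intro prod_nonneg) (auto intro: w_nonneg hol_closed)

section \<open>Gauge fixing on a set of edges\<close>

definition gaugeable :: "edge set \<Rightarrow> (edge \<Rightarrow> 'a) set" where
  "gaugeable W = {\<sigma> \<in> C. \<exists>h\<in>UNIV \<rightarrow> carrier G. pure_gauge G h \<sigma> W}"

definition fixed :: "edge set \<Rightarrow> (edge \<Rightarrow> 'a) set" where
  "fixed W = {\<sigma> \<in> C. \<forall>e\<in>W. \<sigma> e = \<one>}"

text \<open>The transformations that are constant on the connected components of \<open>W\<close>.
  They form a group and preserve the identity field on \<open>W\<close>.\<close>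

definition stab :: "edge set \<Rightarrow> (site \<Rightarrow> 'a) set" where
  "stab W = {k \<in> gauges. \<forall>e\<in>W. k (fst e) = k (snd e)}"

lemma card_stab_pos: "0 < card (stab W)"
proof -
  have "(\<lambda>_. \<one>) \<in> stab W" by (simp add: stab_def gauges_def)
  moreover have "finite (stab W)" using finite_gauges by (simp add: stab_def)
  ultimately show ?thesis by (metis card_gt_0_iff empty_iff)
qed

lemma gauge_fixed_iff:
  assumes "\<sigma> \<in> C" "h \<in> UNIV \<rightarrow> carrier G" "W \<subseteq> edges \<Lambda>"
  shows "gauge G \<Lambda> h \<sigma> \<in> fixed W \<longleftrightarrow> pure_gauge G h \<sigma> W"
proof -
  have hc: "h x \<in> carrier G" for x using assms by auto
  have "gauge G \<Lambda> h \<sigma> e = \<one> \<longleftrightarrow> \<sigma> e = inv h (fst e) \<otimes> h (snd e)" if "e \<in> W" for e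
  proof -
    have "e \<in> edges \<Lambda>" using that assms(3) by blast
    then show ?thesis unfolding gauge_edge[OF \<open>e \<in> edges \<Lambda>\<close>] by (rule gauge_one_iff[OF CD[OF assms(1)] hc hc])
  qed
  then show ?thesis using gauge_in_C[OF assms(1,2)] by (auto simp: fixed_def pure_gauge_def)
qed

text \<open>The trivialisations of a field on \<open>W\<close> are a torsor under left
  multiplication by \<open>stab W\<close>, so their number does not depend on the field.\<close>

lemma card_trivialisations:
  assumes "\<sigma> \<in> gaugeable W" "W \<subseteq> edges \<Lambda>"
  shows "card {h \<in> gauges. pure_gauge G h \<sigma> W} = card (stab W)"
proof -
  obtain k0 where k0: "k0 \<in> UNIV \<rightarrow> carrier G" "pure_gauge G k0 \<sigma> W" using assms by (auto simp: gaugeable_def)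
  define k where "k x = (if x \<in> \<Lambda> then k0 x else \<one>)" for x
  have W: "fst e \<in> \<Lambda>" "snd e \<in> \<Lambda>" if "e \<in> W" for e using that assms(2) by (auto simp: edges_def)
  have kc[simp]: "k x \<in> carrier G" for x using k0 by (auto simp: k_def)
  have k: "k \<in> gauges" "pure_gauge G k \<sigma> W"
    using k0 W by (auto simp: gauges_def k_def pure_gauge_def)
  have "bij_betw (\<lambda>c x. c x \<otimes> k x) (stab W) {h \<in> gauges. pure_gauge G h \<sigma> W}"
  proof (rule bij_betw_byWitness[of _ "\<lambda>h x. h x \<otimes> inv k x"])
    have sc: "c x \<in> carrier G" if "c \<in> stab W" for c x using that gaugesD by (simp add: stab_def)
    show "\<forall>c\<in>stab W. (\<lambda>x. c x \<otimes> k x \<otimes> inv k x) = c" using sc by (auto simp: m_assoc)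
    show "\<forall>h\<in>{h \<in> gauges. pure_gauge G h \<sigma> W}. (\<lambda>x. h x \<otimes> inv k x \<otimes> k x) = h"
      using gaugesD by (auto simp: m_assoc)
    show "(\<lambda>c x. c x \<otimes> k x) ` stab W \<subseteq> {h \<in> gauges. pure_gauge G h \<sigma> W}"
    proof (intro image_subsetI)
      fix c assume c: "c \<in> stab W"
      have "(\<lambda>x. c x \<otimes> k x) \<in> gauges" using c k sc[OF c] by (auto simp: gauges_def stab_def)
      moreover have "pure_gauge G (\<lambda>x. c x \<otimes> k x) \<sigma> W"
        unfolding pure_gauge_def
      proof
        fix e assume e: "e \<in> W"
        have "inv (c (fst e) \<otimes> k (fst e)) \<otimes> (c (snd e) \<otimes> k (snd e)) = inv k (fst e) \<otimes> ((inv c (snd e) \<otimes> c (snd e)) \<otimes> k (snd e))"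
          using c e sc[OF c] by (simp only: stab_def mem_Collect_eq inv_mult_group m_assoc inv_closed m_closed kc)
        also have "\<dots> = \<sigma> e" using e sc[OF c] k(2) by (simp add: pure_gauge_def)
        finally show "\<sigma> e = inv (c (fst e) \<otimes> k (fst e)) \<otimes> (c (snd e) \<otimes> k (snd e))" by simp
      qed
      ultimately show "(\<lambda>x. c x \<otimes> k x) \<in> {h \<in> gauges. pure_gauge G h \<sigma> W}" by simp
    qed
    show "(\<lambda>h x. h x \<otimes> inv k x) ` {h \<in> gauges. pure_gauge G h \<sigma> W} \<subseteq> stab W"
    proof (intro image_subsetI)
      fix h assume "h \<in> {h \<in> gauges. pure_gauge G h \<sigma> W}"
      then have h: "h \<in> gauges" "pure_gauge G h \<sigma> W" by auto
      have hc[simp]: "h x \<in> carrier G" for x using h gaugesD by blast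
      have "h (fst e) \<otimes> inv k (fst e) = h (snd e) \<otimes> inv k (snd e)" if "e \<in> W" for e
      proof -
        have "inv h (fst e) \<otimes> h (snd e) = inv k (fst e) \<otimes> k (snd e)"
          using h(2) k(2) that by (auto simp: pure_gauge_def)
        then have "h (snd e) = h (fst e) \<otimes> (inv k (fst e) \<otimes> k (snd e))"
          by (metis hc kc inv_closed inv_solve_left m_closed)
        then show ?thesis by (simp add: m_assoc)
      qed
      then show "(\<lambda>x. h x \<otimes> inv k x) \<in> stab W" using h k by (auto simp: stab_def gauges_def)
    qed
  qed
  then show ?thesis by (rule bij_betw_same_card[symmetric])
qed

text \<open>Both sides sum \<open>F\<close> over the pairs of a gauge transformation and the gauge fixed result of applying it.\<close>

lemma sum_gaugeable:
  fixes F :: "(edge \<Rightarrow> 'a) \<Rightarrow> 'c::field_char_0"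
  assumes F: "gauge_inv F" and W: "W \<subseteq> edges \<Lambda>"
  shows "of_nat (card (stab W)) * sum F (gaugeable W) = of_nat (card gauges) * sum F (fixed W)"
proof -
  have fixed_sum: "(\<Sum>\<sigma>\<in>C. if pure_gauge G h \<sigma> W then F \<sigma> else 0) = sum F (fixed W)" if h: "h \<in> gauges" for h
  proof -
    have "sum F (fixed W) = (\<Sum>\<sigma>\<in>C. if \<sigma> \<in> fixed W then F \<sigma> else 0)"
      unfolding sum.inter_restrict[symmetric, OF finite_C] by (rule sum.cong) (auto simp: fixed_def)
    also have "\<dots> = (\<Sum>\<sigma>\<in>C. if gauge G \<Lambda> h \<sigma> \<in> fixed W then F (gauge G \<Lambda> h \<sigma>) else 0)"
      by (rule sum.reindex_bij_betw[OF bij_gauge[OF gauges_Pi[OF h]], symmetric])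
    also have "\<dots> = (\<Sum>\<sigma>\<in>C. if pure_gauge G h \<sigma> W then F \<sigma> else 0)"
    proof (rule sum.cong)
      fix \<sigma> assume \<sigma>: "\<sigma> \<in> C"
      have "F (gauge G \<Lambda> h \<sigma>) = F \<sigma>" using F \<sigma> gauges_Pi[OF h] unfolding gauge_inv_def by blast
      then show "(if gauge G \<Lambda> h \<sigma> \<in> fixed W then F (gauge G \<Lambda> h \<sigma>) else 0) = (if pure_gauge G h \<sigma> W then F \<sigma> else 0)"
        unfolding gauge_fixed_iff[OF \<sigma> gauges_Pi[OF h] W] by (rule if_cong[OF refl _ refl])
    qed simp
    finally show ?thesis by simp
  qed
  have "of_nat (card gauges) * sum F (fixed W) = (\<Sum>h\<in>gauges. \<Sum>\<sigma>\<in>C. if pure_gauge G h \<sigma> W then F \<sigma> else 0)"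
    using fixed_sum by simp
  also have "\<dots> = (\<Sum>\<sigma>\<in>C. \<Sum>h\<in>gauges. if pure_gauge G h \<sigma> W then F \<sigma> else 0)" by (rule sum.swap)
  also have "\<dots> = (\<Sum>\<sigma>\<in>C. of_nat (card {h \<in> gauges. pure_gauge G h \<sigma> W}) * F \<sigma>)"
  proof (rule sum.cong)
    fix \<sigma>
    show "(\<Sum>h\<in>gauges. if pure_gauge G h \<sigma> W then F \<sigma> else 0) = of_nat (card {h \<in> gauges. pure_gauge G h \<sigma> W}) * F \<sigma>"
      by (subst sum.inter_filter[symmetric, OF finite_gauges]) simp
  qed simp
  also have "\<dots> = (\<Sum>\<sigma>\<in>C. if \<sigma> \<in> gaugeable W then of_nat (card (stab W)) * F \<sigma> else 0)"
  proof (rule sum.cong)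
    fix \<sigma> assume \<sigma>: "\<sigma> \<in> C"
    show "of_nat (card {h \<in> gauges. pure_gauge G h \<sigma> W}) * F \<sigma> = (if \<sigma> \<in> gaugeable W then of_nat (card (stab W)) * F \<sigma> else 0)"
    proof (cases "\<sigma> \<in> gaugeable W")
      case True
      then show ?thesis using card_trivialisations[OF _ W] by simp
    next
      case False
      then have e: "{h \<in> gauges. pure_gauge G h \<sigma> W} = {}" using \<sigma> gauges_Pi by (auto simp: gaugeable_def)
      show ?thesis unfolding e using False by simp
    qed
  qed simp
  also have "\<dots> = (\<Sum>\<sigma>\<in>gaugeable W. of_nat (card (stab W)) * F \<sigma>)"
    unfolding sum.inter_restrict[symmetric, OF finite_C] by (rule sum.cong) (auto simp: gaugeable_def)
  finally show ?thesis by (simp add: sum_distrib_left)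
qed

section \<open>Factorisation across the shell of a box\<close>

lemma gauge_inv_mult: "gauge_inv F \<Longrightarrow> gauge_inv F' \<Longrightarrow> gauge_inv (\<lambda>\<sigma>. F \<sigma> * F' \<sigma>)"
  for F F' :: "(edge \<Rightarrow> 'a) \<Rightarrow> 'c::times"
  unfolding gauge_inv_def by simp

lemma depends_on_mult: "depends_on F D \<Longrightarrow> depends_on F' D \<Longrightarrow> depends_on (\<lambda>\<sigma>. F \<sigma> * F' \<sigma>) D"
  for F F' :: "(edge \<Rightarrow> 'a) \<Rightarrow> 'c::times"
  unfolding depends_on_def by metis

lemma depends_onD: "depends_on F D \<Longrightarrow> \<sigma> \<in> C \<Longrightarrow> \<tau> \<in> C \<Longrightarrow> (\<And>e. e \<in> D \<Longrightarrow> \<sigma> e = \<tau> e) \<Longrightarrow> F \<sigma> = F \<tau>"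
  unfolding depends_on_def by blast

lemma gauge_inv_const: "gauge_inv (\<lambda>_. c)" by (simp add: gauge_inv_def)

lemma depends_on_const: "depends_on (\<lambda>_. c) D" by (simp add: depends_on_def)

text \<open>The shell belongs both here and to \<open>edges {u..v}\<close>. This is harmless once
  the field is the identity on it.\<close>

definition outer_edges :: "site \<Rightarrow> site \<Rightarrow> edge set" where
  "outer_edges u v = edges \<Lambda> - (edges {u..v} - shell a b u v)"

definition splice :: "site \<Rightarrow> site \<Rightarrow> (edge \<Rightarrow> 'a) \<Rightarrow> (edge \<Rightarrow> 'a) \<Rightarrow> edge \<Rightarrow> 'a" where
  "splice u v \<sigma> \<tau> = (\<lambda>e. if e \<in> edges {u..v} then \<sigma> e else \<tau> e)"

lemma box_subset: "a \<le> u \<Longrightarrow> v \<le> b \<Longrightarrow> {u..v} \<subseteq> \<Lambda>"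
  by (meson atLeastatMost_subset_iff)

lemma shell_edges: "a \<le> u \<Longrightarrow> v \<le> b \<Longrightarrow> shell a b u v \<subseteq> edges \<Lambda>"
  using shell_subset edges_mono[OF box_subset] by blast

text \<open>Two configurations that are the identity on the shell can exchange their interiors. This
  is an involution on pairs, and it turns \<open>A B'\<close> times \<open>A' B\<close> into
  \<open>A B\<close> times \<open>A' B'\<close>.\<close>

lemma sum_fixed_exchange:
  fixes A A' B B' :: "(edge \<Rightarrow> 'a) \<Rightarrow> 'c::field_char_0"
  assumes uv: "a \<le> u" "v \<le> b"
    and dep: "depends_on A (edges {u..v})" "depends_on A' (edges {u..v})"
      "depends_on B (outer_edges u v)" "depends_on B' (outer_edges u v)"
  defines "X \<equiv> fixed (shell a b u v)"
  shows "(\<Sum>\<sigma>\<in>X. A \<sigma> * B \<sigma>) * (\<Sum>\<sigma>\<in>X. A' \<sigma> * B' \<sigma>) = (\<Sum>\<sigma>\<in>X. A \<sigma> * B' \<sigma>) * (\<Sum>\<sigma>\<in>X. A' \<sigma> * B \<sigma>)"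
proof -
  have sub: "edges {u..v} \<subseteq> edges \<Lambda>" using edges_mono box_subset uv by blast
  have XC: "\<sigma> \<in> C" if "\<sigma> \<in> X" for \<sigma> using that by (simp add: X_def fixed_def)
  have sX: "splice u v \<sigma> \<tau> \<in> X" if "\<sigma> \<in> X" "\<tau> \<in> X" for \<sigma> \<tau>
  proof -
    have "splice u v \<sigma> \<tau> \<in> C"
      using XC[OF that(1)] XC[OF that(2)] sub unfolding configs_def splice_def
      by (intro PiE_I) (auto simp: PiE_iff extensional_def)
    then show ?thesis using that by (auto simp: X_def fixed_def splice_def)
  qed
  have sin: "F (splice u v \<sigma> \<tau>) = F \<sigma>" if "\<sigma> \<in> X" "\<tau> \<in> X" "depends_on F (edges {u..v})" for \<sigma> \<tau> and F :: "(edge \<Rightarrow> 'a) \<Rightarrow> 'c"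
    by (rule depends_onD[OF that(3) XC[OF sX[OF that(1,2)]] XC[OF that(1)]]) (simp add: splice_def)
  have sout: "F (splice u v \<sigma> \<tau>) = F \<tau>" if "\<sigma> \<in> X" "\<tau> \<in> X" "depends_on F (outer_edges u v)" for \<sigma> \<tau> and F :: "(edge \<Rightarrow> 'a) \<Rightarrow> 'c"
  proof (rule depends_onD[OF that(3) XC[OF sX[OF that(1,2)]] XC[OF that(2)]])
    fix e assume e: "e \<in> outer_edges u v"
    show "splice u v \<sigma> \<tau> e = \<tau> e"
    proof (cases "e \<in> edges {u..v}")
      case True
      then have "e \<in> shell a b u v" using e by (simp add: outer_edges_def)
      then have "\<sigma> e = \<one>" "\<tau> e = \<one>" using that by (simp_all add: X_def fixed_def)
      then show ?thesis by (simp add: splice_def)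
    qed (simp add: splice_def)
  qed
  have ss: "splice u v (splice u v \<sigma> \<tau>) (splice u v \<tau> \<sigma>) = \<sigma>" for \<sigma> \<tau>
    by (auto simp: splice_def)
  let ?m = "\<lambda>(\<sigma>, \<tau>). (splice u v \<sigma> \<tau>, splice u v \<tau> \<sigma>)"
  have "(\<Sum>\<sigma>\<in>X. A \<sigma> * B \<sigma>) * (\<Sum>\<sigma>\<in>X. A' \<sigma> * B' \<sigma>) = (\<Sum>(\<sigma>, \<tau>)\<in>X \<times> X. (A \<sigma> * B \<sigma>) * (A' \<tau> * B' \<tau>))"
    by (simp add: sum_product sum.cartesian_product)
  also have "\<dots> = (\<Sum>(\<sigma>, \<tau>)\<in>X \<times> X. (A \<sigma> * B' \<sigma>) * (A' \<tau> * B \<tau>))"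
  proof (rule sum.reindex_bij_witness[of _ ?m ?m])
    fix z assume "z \<in> X \<times> X"
    then obtain \<sigma> \<tau> where z: "z = (\<sigma>, \<tau>)" "\<sigma> \<in> X" "\<tau> \<in> X" by auto
    show "?m (?m z) = z" "?m (?m z) = z" using ss z by auto
    show "?m z \<in> X \<times> X" "?m z \<in> X \<times> X" using sX z by auto
    show "(case ?m z of (\<sigma>, \<tau>) \<Rightarrow> (A \<sigma> * B' \<sigma>) * (A' \<tau> * B \<tau>)) = (case z of (\<sigma>, \<tau>) \<Rightarrow> (A \<sigma> * B \<sigma>) * (A' \<tau> * B' \<tau>))"
      using z sin[of \<sigma> \<tau> A] sin[of \<tau> \<sigma> A'] sout[of \<tau> \<sigma> B] sout[of \<sigma> \<tau> B'] dep by simp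
  qed
  also have "\<dots> = (\<Sum>\<sigma>\<in>X. A \<sigma> * B' \<sigma>) * (\<Sum>\<sigma>\<in>X. A' \<sigma> * B \<sigma>)"
    by (simp add: sum_product sum.cartesian_product)
  finally show ?thesis .
qed

text \<open>Restricting to gauge fixed configurations multiplies all four sums by the same ratio,
  which cancels. It is enough that \<open>A\<close> and \<open>A'\<close> force gaugeability, since
  every product contains one of them.\<close>

lemma sum_exchange:
  fixes A A' B B' :: "(edge \<Rightarrow> 'a) \<Rightarrow> 'c::field_char_0"
  assumes uv: "a \<le> u" "v \<le> b"
    and dep: "depends_on A (edges {u..v})" "depends_on A' (edges {u..v})"
      "depends_on B (outer_edges u v)" "depends_on B' (outer_edges u v)"
    and inv: "gauge_inv A" "gauge_inv A'" "gauge_inv B" "gauge_inv B'"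
    and triv: "\<And>\<sigma>. \<sigma> \<in> C \<Longrightarrow> A \<sigma> \<noteq> 0 \<Longrightarrow> \<sigma> \<in> gaugeable (shell a b u v)"
      "\<And>\<sigma>. \<sigma> \<in> C \<Longrightarrow> A' \<sigma> \<noteq> 0 \<Longrightarrow> \<sigma> \<in> gaugeable (shell a b u v)"
  shows "(\<Sum>\<sigma>\<in>C. A \<sigma> * B \<sigma>) * (\<Sum>\<sigma>\<in>C. A' \<sigma> * B' \<sigma>) = (\<Sum>\<sigma>\<in>C. A \<sigma> * B' \<sigma>) * (\<Sum>\<sigma>\<in>C. A' \<sigma> * B \<sigma>)"
proof -
  let ?W = "shell a b u v"
  let ?n = "of_nat (card (stab ?W)) :: 'c" and ?g = "of_nat (card gauges) :: 'c"
  have n: "?n \<noteq> 0" using card_stab_pos[of ?W] by simp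
  have red: "?n * (\<Sum>\<sigma>\<in>C. P \<sigma> * Q \<sigma>) = ?g * (\<Sum>\<sigma>\<in>fixed ?W. P \<sigma> * Q \<sigma>)"
    if "gauge_inv P" "gauge_inv Q" "\<And>\<sigma>. \<sigma> \<in> C \<Longrightarrow> P \<sigma> \<noteq> 0 \<Longrightarrow> \<sigma> \<in> gaugeable ?W" for P Q :: "(edge \<Rightarrow> 'a) \<Rightarrow> 'c"
  proof -
    have "(\<Sum>\<sigma>\<in>gaugeable ?W. P \<sigma> * Q \<sigma>) = (\<Sum>\<sigma>\<in>C. P \<sigma> * Q \<sigma>)"
    proof (rule sum.mono_neutral_left[OF finite_C])
      show "gaugeable ?W \<subseteq> C" by (auto simp: gaugeable_def)
      show "\<forall>\<sigma>\<in>C - gaugeable ?W. P \<sigma> * Q \<sigma> = 0" using that(3) by fastforce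
    qed
    then show ?thesis using sum_gaugeable[OF gauge_inv_mult[OF that(1,2)] shell_edges[OF uv]] by simp
  qed
  have cancel: "s1 * s2 = s3 * s4"
    if "?n * s1 = ?g * t1" "?n * s2 = ?g * t2" "?n * s3 = ?g * t3" "?n * s4 = ?g * t4" "t1 * t2 = t3 * t4"
    for s1 s2 s3 s4 t1 t2 t3 t4 :: 'c
  proof -
    have "(?n * ?n) * (s1 * s2) = (?n * s1) * (?n * s2)" by (simp only: ac_simps)
    also have "\<dots> = (?g * ?g) * (t1 * t2)" unfolding that(1,2) by (simp only: ac_simps)
    also have "\<dots> = (?g * t3) * (?g * t4)" unfolding that(5) by (simp only: ac_simps)
    also have "\<dots> = (?n * ?n) * (s3 * s4)" unfolding that(3,4)[symmetric] by (simp only: ac_simps)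
    finally show ?thesis using n by (metis mult_cancel_left mult_eq_0_iff)
  qed
  show ?thesis
    by (rule cancel[OF red red red red sum_fixed_exchange[OF uv dep]]) (use inv triv in blast)+
qed

text \<open>An unnormalised expectation over the configurations with support \<open>P\<close>. The
  values lie in any real field, as both complex observables and real partition functions
  occur.\<close>

definition wsum :: "((edge \<Rightarrow> 'a) \<Rightarrow> 'c::real_field) \<Rightarrow> plaquette set \<Rightarrow> 'c" where
  "wsum F P = (\<Sum>\<sigma>\<in>C. of_bool (supp \<sigma> = P) * (of_real (weight \<sigma>) * F \<sigma>))"

abbreviation pf :: "plaquette set \<Rightarrow> real" where "pf \<equiv> wsum (\<lambda>_. 1)"

lemma supp_subset: "supp \<sigma> \<subseteq> plaquettes \<Lambda>" by (auto simp: supp_def)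

lemma finite_plaq: "finite (plaquettes \<Lambda>)" by (rule finite_plaquettes[OF finite_box])

lemma hol_cong_plaq:
  assumes "\<And>e. e \<in> plaquette_edges p \<Longrightarrow> \<sigma> e = \<tau> e"
  shows "hol \<sigma> p = hol \<tau> p"
  using assms by (rule holonomy_boundary_cong)

lemma plaquette_outer:
  assumes "p \<in> plaquettes \<Lambda>" "p \<notin> plaquettes {u..v}"
  shows "plaquette_edges p \<subseteq> outer_edges u v"
  using assms plaquette_inside[OF assms(1)] plaquettes_iff_edges[of p \<Lambda>] by (auto simp: outer_edges_def)

lemma plaquette_inner: "p \<in> plaquettes {u..v} \<Longrightarrow> plaquette_edges p \<subseteq> edges {u..v}"
  by (simp add: plaquettes_iff_edges)

text \<open>Weight and support split into parts inside and outside the box, so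
  \<open>sum_exchange\<close> applies with the vacuum as second pair. \<open>good\<close> covers
  both the interior support prescribed by \<open>P\<close> and the empty one.\<close>

lemma wsum_split:
  fixes F1 F2 :: "(edge \<Rightarrow> 'a) \<Rightarrow> 'c::real_field"
  assumes uv: "a \<le> u" "v \<le> b"
    and good: "\<And>\<sigma>. \<sigma> \<in> C \<Longrightarrow> supp \<sigma> \<inter> plaquettes {u..v} \<subseteq> P \<Longrightarrow> \<sigma> \<in> gaugeable (shell a b u v)"
    and F1: "gauge_inv F1" "depends_on F1 (edges {u..v})"
    and F2: "gauge_inv F2" "depends_on F2 (outer_edges u v)"
  shows "wsum (\<lambda>\<sigma>. F1 \<sigma> * F2 \<sigma>) P * wsum (\<lambda>_. 1) {}
    = wsum F1 (P \<inter> plaquettes {u..v}) * wsum F2 (P - plaquettes {u..v})"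
proof -
  let ?V = "plaquettes {u..v}"
  have VL: "?V \<subseteq> plaquettes \<Lambda>" using plaquettes_mono box_subset[OF uv] by blast
  define wi where "wi \<sigma> = (\<Prod>p\<in>?V. w (hol \<sigma> p))" for \<sigma>
  define wo where "wo \<sigma> = (\<Prod>p\<in>plaquettes \<Lambda> - ?V. w (hol \<sigma> p))" for \<sigma>
  define A where "A Q F \<sigma> = of_bool (supp \<sigma> \<inter> ?V = Q) * (of_real (wi \<sigma>) * F \<sigma>)" for Q and F :: "(edge \<Rightarrow> 'a) \<Rightarrow> 'c" and \<sigma>
  define B where "B Q F \<sigma> = of_bool (supp \<sigma> - ?V = Q) * (of_real (wo \<sigma>) * F \<sigma>)" for Q and F :: "(edge \<Rightarrow> 'a) \<Rightarrow> 'c" and \<sigma>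
  have weight: "weight \<sigma> = wi \<sigma> * wo \<sigma>" for \<sigma>
    unfolding weight_def wi_def wo_def using prod.subset_diff[OF VL finite_plaq] by (simp add: mult.commute)
  have gi: "gauge_inv (A Q F)" "gauge_inv (B Q F)" if F: "gauge_inv F" for Q F
  proof -
    have "wi (gauge G \<Lambda> h \<sigma>) = wi \<sigma>" "wo (gauge G \<Lambda> h \<sigma>) = wo \<sigma>" if "\<sigma> \<in> C" "h \<in> UNIV \<rightarrow> carrier G" for \<sigma> h
      unfolding wi_def wo_def using w_hol_gauge[OF that] VL by (auto intro!: prod.cong)
    then show "gauge_inv (A Q F)" "gauge_inv (B Q F)"
      using F supp_gauge unfolding gauge_inv_def A_def B_def by simp_all
  qed
  have si: "supp \<sigma> \<inter> ?V = {p \<in> ?V. hol \<sigma> p \<noteq> \<one>}" "supp \<sigma> - ?V = {p \<in> plaquettes \<Lambda> - ?V. hol \<sigma> p \<noteq> \<one>}" for \<sigma>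
    using VL by (auto simp: supp_def)
  have dA: "depends_on (A Q F) (edges {u..v})" if F: "depends_on F (edges {u..v})" for Q F
    unfolding depends_on_def
  proof (intro ballI impI)
    fix \<sigma> \<tau> assume st: "\<sigma> \<in> C" "\<tau> \<in> C" "\<forall>e\<in>edges {u..v}. \<sigma> e = \<tau> e"
    have h: "hol \<sigma> p = hol \<tau> p" if "p \<in> ?V" for p
      by (rule hol_cong_plaq) (use st plaquette_inner[OF that] in blast)
    then have "supp \<sigma> \<inter> ?V = supp \<tau> \<inter> ?V" "wi \<sigma> = wi \<tau>" unfolding si wi_def by auto
    moreover have "F \<sigma> = F \<tau>" using depends_onD[OF F st(1,2)] st(3) by blast
    ultimately show "A Q F \<sigma> = A Q F \<tau>" by (simp add: A_def)
  qed
  have dB: "depends_on (B Q F) (outer_edges u v)" if F: "depends_on F (outer_edges u v)" for Q F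
    unfolding depends_on_def
  proof (intro ballI impI)
    fix \<sigma> \<tau> assume st: "\<sigma> \<in> C" "\<tau> \<in> C" "\<forall>e\<in>outer_edges u v. \<sigma> e = \<tau> e"
    have h: "hol \<sigma> p = hol \<tau> p" if "p \<in> plaquettes \<Lambda> - ?V" for p
      by (rule hol_cong_plaq) (use st plaquette_outer[of p u v] that in blast)
    then have "supp \<sigma> - ?V = supp \<tau> - ?V" "wo \<sigma> = wo \<tau>" unfolding si wo_def by auto
    moreover have "F \<sigma> = F \<tau>" using depends_onD[OF F st(1,2)] st(3) by blast
    ultimately show "B Q F \<sigma> = B Q F \<tau>" by (simp add: B_def)
  qed
  have AB: "(\<Sum>\<sigma>\<in>C. A Q F \<sigma> * B R F' \<sigma>) = wsum (\<lambda>\<sigma>. F \<sigma> * F' \<sigma>) (Q \<union> R)"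
    if "Q \<subseteq> ?V" "R \<inter> ?V = {}" for Q R F F'
    unfolding wsum_def
  proof (rule sum.cong)
    fix \<sigma>
    have "supp \<sigma> = Q \<union> R \<longleftrightarrow> supp \<sigma> \<inter> ?V = Q \<and> supp \<sigma> - ?V = R" using that by blast
    then show "A Q F \<sigma> * B R F' \<sigma> = of_bool (supp \<sigma> = Q \<union> R) * (of_real (weight \<sigma>) * (F \<sigma> * F' \<sigma>))"
      by (simp add: A_def B_def weight)
  qed simp
  let ?Q = "P \<inter> ?V" and ?R = "P - ?V"
  have "(\<Sum>\<sigma>\<in>C. A ?Q F1 \<sigma> * B ?R F2 \<sigma>) * (\<Sum>\<sigma>\<in>C. A {} (\<lambda>_. 1) \<sigma> * B {} (\<lambda>_. 1) \<sigma>)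
      = (\<Sum>\<sigma>\<in>C. A ?Q F1 \<sigma> * B {} (\<lambda>_. 1) \<sigma>) * (\<Sum>\<sigma>\<in>C. A {} (\<lambda>_. 1) \<sigma> * B ?R F2 \<sigma>)"
  proof (rule sum_exchange[OF uv])
    show "\<sigma> \<in> gaugeable (shell a b u v)" if "\<sigma> \<in> C" "A ?Q F1 \<sigma> \<noteq> 0" for \<sigma>
    proof (rule good[OF that(1)])
      show "supp \<sigma> \<inter> ?V \<subseteq> P" using that(2) by (cases "supp \<sigma> \<inter> ?V = ?Q") (auto simp: A_def)
    qed
    show "\<sigma> \<in> gaugeable (shell a b u v)" if "\<sigma> \<in> C" "A {} (\<lambda>_. 1) \<sigma> \<noteq> 0" for \<sigma>
    proof (rule good[OF that(1)])
      show "supp \<sigma> \<inter> ?V \<subseteq> P" using that(2) by (cases "supp \<sigma> \<inter> ?V = {}") (auto simp: A_def)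
    qed
  qed (intro dA dB gi F1 F2 gauge_inv_const depends_on_const)+
  moreover have "?Q \<union> ?R = P" by blast
  ultimately show ?thesis using AB[of ?Q ?R F1 F2] AB[of "{}" "{}" "\<lambda>_. 1" "\<lambda>_. 1"] AB[of ?Q "{}" F1 "\<lambda>_. 1"]
      AB[of "{}" ?R "\<lambda>_. 1" F2] by (simp add: Int_Diff Diff_Int_distrib2)
qed

text \<open>In axial gauge a configuration is determined by its plaquette holonomies.\<close>

lemma wsum_le:
  assumes P: "P \<subseteq> plaquettes \<Lambda>"
  shows "pf P \<le> (real (card (carrier G)) * \<delta>) ^ card P * pf {}"
proof -
  let ?W = "axial_edges a b"
  let ?n = "real (card (stab ?W))" and ?g = "real (card gauges)"
  have W: "?W \<subseteq> edges \<Lambda>" by (auto simp: axial_edges_def)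
  have n: "?n > 0" using card_stab_pos by simp
  \<comment> \<open>On a tree every configuration can be gauge fixed, so the sum over all of them is
    reached.\<close>
  have all: "gaugeable ?W = C"
    using axial_pure_gauge[of a b] CD by (auto simp: gaugeable_def)
  define F where "F Q \<sigma> = of_bool (supp \<sigma> = Q) * weight \<sigma>" for Q \<sigma>
  have gi: "gauge_inv (F Q)" for Q
    unfolding gauge_inv_def F_def using supp_gauge weight_gauge by simp
  have red: "?n * pf Q = ?g * sum (F Q) (fixed ?W)" for Q
    using sum_gaugeable[OF gi W, of Q] unfolding all by (simp add: wsum_def F_def)
  have fixC: "\<sigma> \<in> C" if "\<sigma> \<in> fixed ?W" for \<sigma> using that by (simp add: fixed_def)
  have fin: "finite (fixed ?W)" using finite_C by (rule finite_subset[rotated]) (auto simp: fixed_def)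
  have finP: "finite P" using P finite_plaq finite_subset by blast
  let ?S = "{\<sigma> \<in> fixed ?W. supp \<sigma> = P}"
  have "sum (F P) (fixed ?W) = (\<Sum>\<sigma>\<in>?S. weight \<sigma>)"
    unfolding F_def by (subst sum.inter_filter[OF fin]) (auto intro!: sum.cong)
  also have "\<dots> \<le> (\<Sum>\<sigma>\<in>?S. \<delta> ^ card P)"
  proof (rule sum_mono)
    fix \<sigma> assume s: "\<sigma> \<in> ?S"
    then have sC: "\<sigma> \<in> C" using fixC by simp
    have "weight \<sigma> = (\<Prod>p\<in>P. w (hol \<sigma> p))"
      unfolding weight_def
    proof (rule prod.mono_neutral_right[OF finite_plaq P])
      show "\<forall>p\<in>plaquettes \<Lambda> - P. w (hol \<sigma> p) = 1" using s w_one by (auto simp: supp_def)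
    qed
    also have "\<dots> \<le> (\<Prod>p\<in>P. \<delta>)"
    proof (rule prod_mono)
      fix p assume "p \<in> P"
      then have "p \<in> plaquettes \<Lambda>" "hol \<sigma> p \<noteq> \<one>" using s by (auto simp: supp_def)
      then show "0 \<le> w (hol \<sigma> p) \<and> w (hol \<sigma> p) \<le> \<delta>" using w_nonneg w_le hol_closed[OF sC] by blast
    qed
    finally show "weight \<sigma> \<le> \<delta> ^ card P" by simp
  qed
  also have "\<dots> = real (card ?S) * \<delta> ^ card P" by simp
  also have "\<dots> \<le> real (card (carrier G)) ^ card P * \<delta> ^ card P"
  proof (rule mult_right_mono)
    \<comment> \<open>Off \<open>P\<close> the holonomies are one, so those on \<open>P\<close>
      determine the configuration.\<close>
    have "card ?S \<le> card (P \<rightarrow>\<^sub>E carrier G)"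
    proof (rule card_inj_on_le)
      show "inj_on (\<lambda>\<sigma>. \<lambda>p\<in>P. hol \<sigma> p) ?S"
      proof (rule inj_onI)
        fix \<sigma> \<tau> assume s: "\<sigma> \<in> ?S" and t: "\<tau> \<in> ?S" and eq: "(\<lambda>p\<in>P. hol \<sigma> p) = (\<lambda>p\<in>P. hol \<tau> p)"
        have C: "\<sigma> \<in> C" "\<tau> \<in> C" using s t fixC by auto
        show "\<sigma> = \<tau>"
        proof (rule C_eqI[OF C], rule axial_determines[where a = a and b = b])
          show "\<sigma> e = \<one>" "\<tau> e = \<one>" if "e \<in> ?W" for e using that s t by (auto simp: fixed_def)
          show "hol \<sigma> p = hol \<tau> p" if "p \<in> plaquettes \<Lambda>" for p
          proof (cases "p \<in> P")
            case True
            then show ?thesis using fun_cong[OF eq, of p] by simp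
          next
            case False
            then have "p \<notin> supp \<sigma>" "p \<notin> supp \<tau>" using s t by simp_all
            then show ?thesis using that by (simp add: supp_def)
          qed
        qed (simp_all add: C CD)
      qed
      show "(\<lambda>\<sigma>. \<lambda>p\<in>P. hol \<sigma> p) ` ?S \<subseteq> P \<rightarrow>\<^sub>E carrier G" using hol_closed fixC P by (auto simp: PiE_iff)
      show "finite (P \<rightarrow>\<^sub>E carrier G)" using finP finite_carrier by (rule finite_PiE)
    qed
    also have "\<dots> = card (carrier G) ^ card P" using finP by (simp add: card_PiE)
    finally show "real (card ?S) \<le> real (card (carrier G)) ^ card P"
      unfolding of_nat_power[symmetric] by (rule of_nat_mono)
  qed (use \<delta>_nonneg in simp)
  finally have 1: "sum (F P) (fixed ?W) \<le> (real (card (carrier G)) * \<delta>) ^ card P"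
    by (simp add: power_mult_distrib)
  \<comment> \<open>The identity configuration alone contributes one.\<close>
  have 2: "1 \<le> sum (F {}) (fixed ?W)"
  proof -
    let ?o = "\<lambda>e\<in>edges \<Lambda>. \<one>"
    have o: "?o \<in> fixed ?W" using W by (auto simp: fixed_def configs_def)
    have h: "hol ?o p = \<one>" if "p \<in> plaquettes \<Lambda>" for p
      by (rule holonomy_one[OF boundary_oriented[OF that]]) simp
    have "F {} ?o = 1" unfolding F_def supp_def weight_def using h w_one by simp
    moreover have "F {} ?o \<le> sum (F {}) (fixed ?W)"
      by (rule member_le_sum[OF o _ fin]) (use fixC weight_nonneg in \<open>simp add: F_def\<close>)
    ultimately show ?thesis by simp
  qed
  have "?n * pf P \<le> ?g * ((real (card (carrier G)) * \<delta>) ^ card P * sum (F {}) (fixed ?W))"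
    unfolding red
  proof (rule mult_left_mono)
    have "sum (F P) (fixed ?W) \<le> (real (card (carrier G)) * \<delta>) ^ card P * 1" using 1 by simp
    also have "\<dots> \<le> (real (card (carrier G)) * \<delta>) ^ card P * sum (F {}) (fixed ?W)"
      by (rule mult_left_mono[OF 2]) (use \<delta>_nonneg in simp)
    finally show "sum (F P) (fixed ?W) \<le> (real (card (carrier G)) * \<delta>) ^ card P * sum (F {}) (fixed ?W)" .
  qed simp
  also have "\<dots> = ?n * ((real (card (carrier G)) * \<delta>) ^ card P * pf {})"
    using red[of "{}"] by simp
  finally show ?thesis using n by simp
qed

end

section \<open>Knots\<close>

text \<open>
  Twice the centre of a plaquette, which is an integer point. A plaquette is near \<open>C\<close> if its centre
  has distance at most 1 from the bounding box of the centres of \<open>C\<close>.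
\<close>

fun cen :: "plaquette \<Rightarrow> site" where
  "cen (x, i, j) = (\<chi> k. 2 * x $ k + of_bool (k = i \<or> k = j))"

definition near :: "plaquette set \<Rightarrow> plaquette \<Rightarrow> bool" where
  "near C p \<longleftrightarrow> (\<forall>k. (\<exists>q\<in>C. cen q $ k \<le> cen p $ k + 2) \<and> (\<exists>q\<in>C. cen p $ k \<le> cen q $ k + 2))"

text \<open>
  Only the smaller of two clusters reaches out from its bounding box. The position of the larger one is
  then known up to a power of the size of the smaller one, and the product of these sizes over
  all mergers grows only exponentially. If the larger one could reach out, then the number of clusters
  would grow like a factorial.
\<close>

inductive knot :: "plaquette set \<Rightarrow> bool" where
  singleton: "knot {p}"
| merge: "knot C \<Longrightarrow> knot C' \<Longrightarrow> C \<inter> C' = {} \<Longrightarrow> card C \<le> card C' \<Longrightarrow> p \<in> C' \<Longrightarrow> near C p \<Longrightarrow> knot (C \<union> C')"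

lemma knot_finite: "knot C \<Longrightarrow> finite C"
  by (induction rule: knot.induct) auto

lemma knot_nonempty: "knot C \<Longrightarrow> C \<noteq> {}"
  by (induction rule: knot.induct) auto

lemma knot_card_pos: "knot C \<Longrightarrow> 1 \<le> card C"
  using knot_finite knot_nonempty by (metis One_nat_def Suc_leI card_gt_0_iff)

text \<open>A merger brings a plaquette \<open>p\<close> within 2, in doubled units, of the hull of
  the other cluster in every coordinate. If the clusters lie on different sides of \<open>c\<close>,
  then \<open>p\<close> and that hull bound the gap; otherwise one cluster already has points on
  both sides.\<close>

lemma knot_gap:
  assumes "knot C" "q \<in> C" "q' \<in> C" "cen q $ k \<le> c" "c < cen q' $ k"
  shows "\<exists>r\<in>C. c < cen r $ k \<and> cen r $ k \<le> c + 2"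
  using assms
proof (induction arbitrary: q q' rule: knot.induct)
  case (merge C C' p)
  have n: "\<exists>r\<in>C. cen r $ k \<le> cen p $ k + 2" "\<exists>r\<in>C. cen p $ k \<le> cen r $ k + 2"
    using merge.hyps by (auto simp: near_def)
  let ?low = "\<lambda>D. \<exists>r\<in>D. cen r $ k \<le> c" and ?high = "\<lambda>D. \<exists>r\<in>D. c < cen r $ k"
  have low: "?low C \<or> ?low C'" and high: "?high C \<or> ?high C'" using merge.prems by auto
  consider "?low C" "?high C" | "?low C'" "?high C'" | "\<not> ?high C" "\<not> ?low C'" | "\<not> ?low C" "\<not> ?high C'"
    using low high by argo
  then show ?case
  proof cases
    case 1
    then show ?thesis using merge.IH(1) by blast
  next
    case 2
    then show ?thesis using merge.IH(2) by blast
  next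
    case 3
    obtain r where "r \<in> C" "cen p $ k \<le> cen r $ k + 2" using n(2) by blast
    moreover have "cen r $ k \<le> c" "c < cen p $ k" using 3 \<open>r \<in> C\<close> merge.hyps(5) by force+
    ultimately show ?thesis using merge.hyps(5) by (intro bexI[of _ p]) auto
  next
    case 4
    obtain r where "r \<in> C" "cen r $ k \<le> cen p $ k + 2" using n(1) by blast
    moreover have "c < cen r $ k" "cen p $ k \<le> c" using 4 \<open>r \<in> C\<close> merge.hyps(5) by force+
    ultimately show ?thesis by (intro bexI[of _ r]) auto
  qed
qed auto

text \<open>Diameters add up under a merger, plus 2 for the gap between the hulls.\<close>

lemma knot_diam: "knot C \<Longrightarrow> q \<in> C \<Longrightarrow> q' \<in> C \<Longrightarrow> cen q' $ k - cen q $ k \<le> 2 * (int (card C) - 1)"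
proof (induction arbitrary: q q' rule: knot.induct)
  case (merge C C' p)
  have n: "\<exists>r\<in>C. cen r $ k \<le> cen p $ k + 2" "\<exists>r\<in>C. cen p $ k \<le> cen r $ k + 2"
    using merge.hyps by (auto simp: near_def)
  have card: "card (C \<union> C') = card C + card C'"
    using merge.hyps by (simp add: card_Un_disjoint knot_finite)
  have p: "1 \<le> card C" "1 \<le> card C'" using knot_card_pos merge.hyps by auto
  consider "q \<in> C" "q' \<in> C" | "q \<in> C'" "q' \<in> C'" | "q \<in> C" "q' \<in> C'" | "q \<in> C'" "q' \<in> C"
    using merge.prems by blast
  then show ?case
  proof cases
    case 1
    then show ?thesis using merge.IH(1)[of q q'] p unfolding card by simp
  next
    case 2
    then show ?thesis using merge.IH(2)[of q q'] p unfolding card by simp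
  next
    case 3
    obtain r where r: "r \<in> C" "cen p $ k \<le> cen r $ k + 2" using n by blast
    then show ?thesis using 3 merge.IH(1)[of q r] merge.IH(2)[of p q'] merge.hyps(5) p unfolding card by simp
  next
    case 4
    obtain r where r: "r \<in> C" "cen r $ k \<le> cen p $ k + 2" using n by blast
    then show ?thesis using 4 merge.IH(1)[of r q'] merge.IH(2)[of q p] merge.hyps(5) p unfolding card by simp
  qed
qed simp

section \<open>Counting knots by weighted closed walks\<close>

text \<open>A summable weight that is at least \<open>m\<^sup>-\<^sup>8\<close> at distance \<open>m\<close>.\<close>

definition \<kappa> :: "plaquette \<Rightarrow> plaquette \<Rightarrow> real" where
  "\<kappa> p q = (\<Prod>k\<in>UNIV. 1 / (max 1 \<bar>real_of_int (fst p $ k - fst q $ k)\<bar>)\<^sup>2)"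

lemma \<kappa>_nonneg: "0 \<le> \<kappa> p q"
  unfolding \<kappa>_def by (intro prod_nonneg) auto

lemma \<kappa>_commute: "\<kappa> p q = \<kappa> q p"
  unfolding \<kappa>_def by (intro prod.cong) (auto simp: abs_minus_commute)

lemma \<kappa>_ge:
  assumes "1 \<le> m" "\<And>k. \<bar>cen p $ k - cen q $ k\<bar> \<le> 2 * int m"
  shows "1 / real m ^ 8 \<le> \<kappa> p q"
proof -
  \<comment> \<open>A coordinate of the centre exceeds twice that of the base point by 0 or 1, so
    twice the difference of the base points is at most \<open>2 m + 1\<close>, and parity removes
    the 1.\<close>
  have "\<bar>fst p $ k - fst q $ k\<bar> \<le> int m" for k
    using assms(2)[of k] by (cases p; cases q) (auto simp: of_bool_def split: if_splits)
  then have "\<bar>real_of_int (fst p $ k - fst q $ k)\<bar> \<le> real m" for k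
    by (metis of_int_abs of_int_le_iff of_int_of_nat_eq)
  then have "max 1 \<bar>real_of_int (fst p $ k - fst q $ k)\<bar> \<le> real m" for k using assms(1) by simp
  then have "(\<Prod>k\<in>(UNIV::4 set). 1 / (real m)\<^sup>2) \<le> \<kappa> p q"
    unfolding \<kappa>_def by (intro prod_mono conjI frac_le power_mono) (auto simp: max_def)
  then show ?thesis by (simp add: power_divide flip: power_mult)
qed

fun walk_weight :: "plaquette list \<Rightarrow> real" where
  "walk_weight (p # q # ps) = \<kappa> p q * walk_weight (q # ps)"
| "walk_weight _ = 1"

lemma walk_weight_nonneg: "0 \<le> walk_weight ps"
  by (induction ps rule: walk_weight.induct) (auto simp: \<kappa>_nonneg)

lemma walk_weight_join: "walk_weight (ps @ y # qs) = walk_weight (ps @ [y]) * walk_weight (y # qs)"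
  by (induction ps rule: walk_weight.induct) auto

lemma walk_weight_snoc: "ps \<noteq> [] \<Longrightarrow> walk_weight (ps @ [y]) = walk_weight ps * \<kappa> (last ps) y"
  by (induction ps rule: walk_weight.induct) auto

text \<open>The detour from \<open>y\<close> around \<open>I\<close> uses the step between
  \<open>y\<close> and \<open>x\<close> twice, once in each direction.\<close>

lemma walk_weight_insert:
  assumes "I \<noteq> []" "hd I = x" "last I = x"
  shows "walk_weight (ps @ y # I @ y # qs) = walk_weight (ps @ y # qs) * walk_weight I * (\<kappa> x y)\<^sup>2"
proof -
  have "walk_weight (ps @ y # I @ y # qs) = walk_weight (ps @ [y]) * walk_weight ((y # I) @ y # qs)"
    using walk_weight_join[of ps y "I @ y # qs"] by simp
  also have "walk_weight ((y # I) @ y # qs) = walk_weight (y # I @ [y]) * walk_weight (y # qs)"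
    using walk_weight_join[of "y # I" y qs] by simp
  also have "walk_weight (y # I @ [y]) = \<kappa> y x * walk_weight (I @ [y])"
    using assms by (cases I) auto
  also have "walk_weight (I @ [y]) = walk_weight I * \<kappa> x y" using walk_weight_snoc[of I y] assms by simp
  finally show ?thesis using walk_weight_join[of ps y qs] \<kappa>_commute[of y x] by (simp add: power2_eq_square)
qed

text \<open>The length is that of a depth first tour of a tree on \<open>C\<close>. The bound for
  the weight reproduces itself: for \<open>s(c) = c^2 / 4^(c - 1)\<close> one has
  \<open>s(c + d) \<le> s(c) s(d) / min(c, d)^2\<close>, and the eighth power fits the factor
  \<open>min(c, d)^-16\<close> of a detour.\<close>

definition closed_walk :: "plaquette set \<Rightarrow> plaquette \<Rightarrow> plaquette list \<Rightarrow> bool" where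
  "closed_walk C p ws \<longleftrightarrow> ws \<noteq> [] \<and> hd ws = p \<and> last ws = p \<and> set ws = C \<and> length ws = 2 * card C - 1
     \<and> ((real (card C))\<^sup>2 / 4 ^ (card C - 1)) ^ 8 \<le> walk_weight ws"

lemma closed_walk_merge:
  assumes C: "closed_walk C p ws" "y \<in> C" and D: "closed_walk D x I"
    and dis: "C \<inter> D = {}" and fin: "finite C" "finite D"
    and m: "m = min (card C) (card D)" and d: "\<And>k. \<bar>cen x $ k - cen y $ k\<bar> \<le> 2 * int m"
  shows "\<exists>ws'. closed_walk (C \<union> D) p ws'"
proof -
  obtain A B where ws: "ws = A @ y # B" using C by (metis closed_walk_def split_list)
  let ?w = "A @ y # I @ y # B"
  have I: "I \<noteq> []" "hd I = x" "last I = x" "set I = D" using D by (auto simp: closed_walk_def)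
  have "D \<noteq> {}" "C \<noteq> {}" using I C by (auto simp: closed_walk_def)
  then have pos: "1 \<le> card C" "1 \<le> card D" using fin by (metis One_nat_def Suc_leI card_gt_0_iff)+
  have card: "card (C \<union> D) = card C + card D" using dis fin by (simp add: card_Un_disjoint)
  let ?c = "real (card C)" and ?d = "real (card D)" and ?m = "real m"
  have mpos: "1 \<le> m" using pos m by simp
  have "((?c\<^sup>2 / 4 ^ (card C - 1)) * (?d\<^sup>2 / 4 ^ (card D - 1)) * (1 / ?m\<^sup>2)) ^ 8
      = (?c\<^sup>2 / 4 ^ (card C - 1)) ^ 8 * (?d\<^sup>2 / 4 ^ (card D - 1)) ^ 8 * (1 / ?m ^ 8)\<^sup>2"
    by (simp add: power_mult_distrib power_divide flip: power_mult)
  also have "\<dots> \<le> walk_weight ws * walk_weight I * (\<kappa> x y)\<^sup>2"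
    using C D \<kappa>_ge[OF mpos d] by (intro mult_mono power_mono) (auto simp: closed_walk_def walk_weight_nonneg)
  also have "\<dots> = walk_weight ?w" using walk_weight_insert[OF I(1-3)] ws by simp
  finally have 1: "((?c\<^sup>2 / 4 ^ (card C - 1)) * (?d\<^sup>2 / 4 ^ (card D - 1)) * (1 / ?m\<^sup>2)) ^ 8 \<le> walk_weight ?w" .
  have 2: "((real (card (C \<union> D)))\<^sup>2 / 4 ^ (card (C \<union> D) - 1))
      \<le> (?c\<^sup>2 / 4 ^ (card C - 1)) * (?d\<^sup>2 / 4 ^ (card D - 1)) * (1 / ?m\<^sup>2)"
  proof -
    have p4: "(4::real) ^ (card (C \<union> D) - 1) = 4 * 4 ^ (card C - 1) * 4 ^ (card D - 1)"
    proof -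
      have "card (C \<union> D) - 1 = Suc ((card C - 1) + (card D - 1))" using pos card by simp
      then show ?thesis by (simp add: power_add)
    qed
    \<comment> \<open>After taking roots this is \<open>(c + d) min(c, d) \<le> 2 c d\<close>, which
      holds because the square of the smaller size is at most \<open>c d\<close>.\<close>
    have key: "(?c + ?d)\<^sup>2 * ?m\<^sup>2 \<le> 4 * (?c\<^sup>2 * ?d\<^sup>2)"
    proof -
      have "(?c + ?d) * ?m \<le> 2 * (?c * ?d)"
      proof (cases "card C \<le> card D")
        case True
        then have "?m = ?c" "?c \<le> ?d" using m by auto
        then show ?thesis using mult_right_mono[of ?c ?d ?c] by (simp add: algebra_simps)
      next
        case False
        then have "?m = ?d" "?d \<le> ?c" using m by auto
        then show ?thesis using mult_right_mono[of ?d ?c ?d] by (simp add: algebra_simps)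
      qed
      then have "((?c + ?d) * ?m)\<^sup>2 \<le> (2 * (?c * ?d))\<^sup>2" by (intro power_mono) auto
      then show ?thesis by (simp add: power_mult_distrib)
    qed
    then show ?thesis unfolding p4 unfolding card using mpos by (simp add: field_simps)
  qed
  have "closed_walk (C \<union> D) p ?w"
    unfolding closed_walk_def
  proof (intro conjI)
    show "hd ?w = p" using C ws by (cases A) (auto simp: closed_walk_def)
    show "last ?w = p" using C ws by (auto simp: closed_walk_def split: if_splits)
    show "set ?w = C \<union> D" using C I ws by (auto simp: closed_walk_def)
    show "length ?w = 2 * card (C \<union> D) - 1" using C D ws pos card by (auto simp: closed_walk_def)
    show "((real (card (C \<union> D)))\<^sup>2 / 4 ^ (card (C \<union> D) - 1)) ^ 8 \<le> walk_weight ?w"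
      by (rule order_trans[OF power_mono[OF 2] 1]) simp
  qed simp
  then show ?thesis by blast
qed

text \<open>The two tours are joined through \<open>q\<close>, the plaquette of the larger cluster
  that is near the smaller one. Every plaquette of the smaller cluster is close to \<open>q\<close>
  on the scale of the smaller size, so the other end of the joining step is free, and the start
  \<open>p\<close> may be arbitrary.\<close>

lemma knot_closed_walk: "knot C \<Longrightarrow> p \<in> C \<Longrightarrow> \<exists>ws. closed_walk C p ws"
proof (induction arbitrary: p rule: knot.induct)
  case (singleton q)
  then show ?case by (intro exI[of _ "[q]"]) (simp add: closed_walk_def)
next
  case (merge C C' q)
  have fin: "finite C" "finite C'" using merge.hyps knot_finite by auto
  have pos: "1 \<le> card C" using knot_card_pos merge.hyps by auto
  \<comment> \<open>The diameter \<open>2 (card C - 1)\<close> of the smaller cluster plus the gap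
    2.\<close>
  have d: "\<bar>cen x $ k - cen q $ k\<bar> \<le> 2 * int (card C)" if "x \<in> C" for x k
  proof -
    obtain r r' where "r \<in> C" "cen r $ k \<le> cen q $ k + 2" "r' \<in> C" "cen q $ k \<le> cen r' $ k + 2"
      using merge.hyps(6) unfolding near_def by blast
    then show ?thesis using knot_diam[OF merge.hyps(1) _ that, of r k] knot_diam[OF merge.hyps(1) that, of r' k] pos by simp
  qed
  from merge.prems show ?case
  proof
    assume p: "p \<in> C"
    then obtain ws where ws: "closed_walk C p ws" using merge.IH(1) by blast
    obtain I where I: "closed_walk C' q I" using merge.IH(2) merge.hyps(5) by blast
    show ?thesis
      by (rule closed_walk_merge[OF ws p I merge.hyps(3) fin, of "card C"])
        (use merge.hyps d[OF p] in \<open>auto simp: abs_minus_commute\<close>)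
  next
    assume p: "p \<in> C'"
    then obtain ws where ws: "closed_walk C' p ws" using merge.IH(2) by blast
    obtain x where x: "x \<in> C" using knot_nonempty merge.hyps by blast
    then obtain I where I: "closed_walk C x I" using merge.IH(1) by blast
    have "\<exists>ws'. closed_walk (C' \<union> C) p ws'"
      by (rule closed_walk_merge[OF ws merge.hyps(5) I _ fin(2,1), of "card C"])
        (use merge.hyps d[OF x] in auto)
    then show ?thesis by (simp add: Un_commute)
  qed
qed

text \<open>Telescoping with \<open>2 / n^2 \<le> 2 / (n - 1) - 2 / n\<close>; the exact value for
  the whole line is \<open>1 + pi^2 / 3\<close>.\<close>

lemma sum_inverse_squares:
  fixes l h x :: int
  shows "(\<Sum>c\<in>{l..h}. 1 / (max 1 \<bar>real_of_int (x - c)\<bar>)\<^sup>2) \<le> 5"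
proof -
  let ?f = "\<lambda>c::int. 1 / (max 1 \<bar>real_of_int (x - c)\<bar>)\<^sup>2"
  have S: "sum ?f {x - int (Suc R)..x + int (Suc R)} \<le> 5 - 2 / real (Suc R)" for R
  proof (induction R)
    case 0
    have "{x - int (Suc 0)..x + int (Suc 0)} = {x - 1, x, x + 1}" by auto
    then show ?case by simp
  next
    case (Suc R)
    let ?n = "int (Suc R) + 1"
    have "{x - int (Suc (Suc R))..x + int (Suc (Suc R))}
        = insert (x - ?n) (insert (x + ?n) {x - int (Suc R)..x + int (Suc R)})" by auto
    moreover have "x - ?n \<notin> insert (x + ?n) {x - int (Suc R)..x + int (Suc R)}"
      "x + ?n \<notin> {x - int (Suc R)..x + int (Suc R)}" by auto
    ultimately have "sum ?f {x - int (Suc (Suc R))..x + int (Suc (Suc R))}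
        = 2 / (real R + 2)\<^sup>2 + sum ?f {x - int (Suc R)..x + int (Suc R)}"
      by (simp add: max_def power2_commute, simp add: add.commute)
    also have "\<dots> \<le> 2 / (real R + 2)\<^sup>2 + (5 - 2 / (real R + 1))" using Suc by (simp add: add.commute)
    also have "\<dots> \<le> 5 - 2 / (real R + 2)"
    proof -
      have "2 / (real R + 2)\<^sup>2 \<le> 2 / ((real R + 1) * (real R + 2))"
        by (rule divide_left_mono) (auto simp: power2_eq_square intro: mult_right_mono)
      also have "\<dots> = 2 / (real R + 1) - 2 / (real R + 2)" by (simp add: field_simps)
      finally show ?thesis by simp
    qed
    finally show ?case by (simp add: add.commute)
  qed
  let ?R = "nat (max \<bar>x - l\<bar> \<bar>h - x\<bar>)"
  have "sum ?f {l..h} \<le> sum ?f {x - int (Suc ?R)..x + int (Suc ?R)}"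
    by (rule sum_mono2) auto
  also have "\<dots> \<le> 5" using S[of ?R] by (smt (verit) divide_nonneg_nonneg of_nat_0_le_iff)
  finally show ?thesis .
qed

text \<open>There are 16 pairs of directions and a factor 5 for each of the four coordinates:
  \<open>16 * 5^4 = 10^4\<close>.\<close>

lemma sum_\<kappa>: "(\<Sum>q\<in>plaquettes {a..b}. \<kappa> p q) \<le> 10 ^ 4"
proof -
  let ?g = "\<lambda>y::site. \<Prod>k\<in>UNIV. 1 / (max 1 \<bar>real_of_int (fst p $ k - y $ k)\<bar>)\<^sup>2"
  have box: "sum ?g {a..b} \<le> 625"
  proof -
    have "sum ?g {a..b} = (\<Sum>y\<in>(\<Pi>\<^sub>E k\<in>UNIV. {a $ k..b $ k}). \<Prod>k\<in>UNIV. 1 / (max 1 \<bar>real_of_int (fst p $ k - y k)\<bar>)\<^sup>2)"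
      by (rule sum.reindex_bij_witness[of _ vec_lambda vec_nth])
        (auto simp: PiE_iff less_eq_vec_def)
    also have "\<dots> = (\<Prod>k\<in>UNIV. \<Sum>c\<in>{a $ k..b $ k}. 1 / (max 1 \<bar>real_of_int (fst p $ k - c)\<bar>)\<^sup>2)"
      by (rule prod_sum_PiE[symmetric]) auto
    also have "\<dots> \<le> (\<Prod>k\<in>(UNIV::4 set). 5)"
      by (intro prod_mono conjI sum_nonneg sum_inverse_squares) auto
    finally show ?thesis by simp
  qed
  have "(\<Sum>q\<in>plaquettes {a..b}. \<kappa> p q) \<le> (\<Sum>q\<in>{a..b} \<times> (UNIV :: (4 \<times> 4) set). \<kappa> p q)"
    by (rule sum_mono2) (auto simp: finite_box plaquettes_iff \<kappa>_nonneg)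
  also have "\<dots> = (\<Sum>(y, ij)\<in>{a..b} \<times> (UNIV :: (4 \<times> 4) set). ?g y)"
    by (rule sum.cong) (auto simp: \<kappa>_def)
  also have "\<dots> = (\<Sum>y\<in>{a..b}. \<Sum>ij\<in>(UNIV :: (4 \<times> 4) set). ?g y)"
    by (rule sum.cartesian_product[symmetric])
  also have "\<dots> = 16 * sum ?g {a..b}" by (simp add: sum_distrib_left card_prod)
  finally show ?thesis using box by simp
qed

lemma sum_walk_weight:
  "(\<Sum>ws\<in>{ws. set ws \<subseteq> plaquettes {a..b} \<and> length ws = m}. walk_weight (p # ws)) \<le> (10 ^ 4) ^ m"
proof (induction m arbitrary: p)
  case 0
  have "{ws. set ws \<subseteq> plaquettes {a..b} \<and> length ws = 0} = {[]}" by auto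
  then show ?case by simp
next
  case (Suc m)
  let ?L = "{ws. set ws \<subseteq> plaquettes {a..b} \<and> length ws = m}"
  have "(\<Sum>ws\<in>{ws. set ws \<subseteq> plaquettes {a..b} \<and> length ws = Suc m}. walk_weight (p # ws))
      = (\<Sum>(ws, q)\<in>?L \<times> plaquettes {a..b}. walk_weight (p # q # ws))"
    unfolding lists_length_Suc_eq by (subst sum.reindex) (auto simp: inj_on_def case_prod_beta)
  also have "\<dots> = (\<Sum>ws\<in>?L. \<Sum>q\<in>plaquettes {a..b}. \<kappa> p q * walk_weight (q # ws))"
    by (simp add: sum.cartesian_product)
  also have "\<dots> = (\<Sum>q\<in>plaquettes {a..b}. \<kappa> p q * (\<Sum>ws\<in>?L. walk_weight (q # ws)))"
    by (subst sum.swap) (simp add: sum_distrib_left)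
  also have "\<dots> \<le> (\<Sum>q\<in>plaquettes {a..b}. \<kappa> p q * (10 ^ 4) ^ m)"
    by (intro sum_mono mult_left_mono Suc \<kappa>_nonneg)
  also have "\<dots> = (\<Sum>q\<in>plaquettes {a..b}. \<kappa> p q) * (10 ^ 4) ^ m" by (simp add: sum_distrib_right)
  also have "\<dots> \<le> 10 ^ 4 * (10 ^ 4) ^ m" by (rule mult_right_mono[OF sum_\<kappa>]) simp
  finally show ?case by simp
qed

definition knots_at :: "site \<Rightarrow> site \<Rightarrow> plaquette \<Rightarrow> plaquette set set" where
  "knots_at a b p = {C. knot C \<and> C \<subseteq> plaquettes {a..b} \<and> p \<in> C}"

lemma finite_knots_at: "finite (knots_at a b p)"
  by (rule finite_subset[of _ "Pow (plaquettes {a..b})"]) (auto simp: knots_at_def finite_plaquettes finite_box)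

text \<open>A knot is recovered from its tour as a set. Each tour has weight at least
  \<open>4^(-8 m)\<close>, and all walks of \<open>2 m\<close> steps together weigh at most
  \<open>10^(8 m)\<close>; finally \<open>4^8 * 10^8 \<le> 10^13\<close>.\<close>

lemma card_knots_at: "real (card {C \<in> knots_at a b p. card C = Suc m}) \<le> (10 ^ 13) ^ m"
proof -
  let ?K = "{C \<in> knots_at a b p. card C = Suc m}"
  let ?L = "{ws. set ws \<subseteq> plaquettes {a..b} \<and> length ws = 2 * m}"
  have finL: "finite ?L" by (rule finite_lists_length_eq) (rule finite_plaquettes[OF finite_box])
  define W where "W C = (SOME ws. closed_walk C p ws)" for C
  have W: "closed_walk C p (W C)" if "C \<in> ?K" for C
  proof -
    have "\<exists>ws. closed_walk C p ws" using that by (intro knot_closed_walk) (simp_all add: knots_at_def)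
    then show ?thesis unfolding W_def by (rule someI_ex)
  qed
  have eq: "W C = p # tl (W C)" if "C \<in> ?K" for C
    using W[OF that] unfolding closed_walk_def by (metis list.collapse)
  have inj: "inj_on (\<lambda>C. tl (W C)) ?K"
  proof (rule inj_onI)
    fix C D assume CD: "C \<in> ?K" "D \<in> ?K" "tl (W C) = tl (W D)"
    have "W C = p # tl (W C)" by (rule eq[OF CD(1)])
    also have "\<dots> = p # tl (W D)" by (simp only: CD(3))
    also have "\<dots> = W D" by (rule eq[OF CD(2), symmetric])
    finally have "W C = W D" .
    then show "C = D" using W[OF CD(1)] W[OF CD(2)] by (simp add: closed_walk_def)
  qed
  have im: "(\<lambda>C. tl (W C)) ` ?K \<subseteq> ?L"
  proof
    fix l assume "l \<in> (\<lambda>C. tl (W C)) ` ?K"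
    then obtain C where C: "C \<in> ?K" "l = tl (W C)" by blast
    have w: "W C \<noteq> []" "set (W C) = C" "length (W C) = 2 * card C - 1"
      using W[OF C(1)] by (simp_all add: closed_walk_def)
    then have "set l \<subseteq> C" using C(2) by (metis list.set_sel(2) subsetI)
    moreover have "C \<subseteq> plaquettes {a..b}" "card C = Suc m" using C(1) by (simp_all add: knots_at_def)
    ultimately show "l \<in> ?L" using w(3) C(2) by auto
  qed
  have ge: "1 \<le> (4 ^ m) ^ 8 * walk_weight (p # tl (W C))" if "C \<in> ?K" for C
  proof -
    have "(1 / 4 ^ m) ^ 8 \<le> ((real (Suc m))\<^sup>2 / 4 ^ m) ^ 8" by (intro power_mono divide_right_mono) auto
    also have "\<dots> \<le> walk_weight (W C)" using W[OF that] that by (simp add: closed_walk_def)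
    finally have "(1 / 4 ^ m) ^ 8 \<le> walk_weight (p # tl (W C))"
      by (subst eq[OF that, symmetric])
    then have "(4 ^ m) ^ 8 * (1 / 4 ^ m) ^ 8 \<le> (4 ^ m) ^ 8 * walk_weight (p # tl (W C))"
      by (intro mult_left_mono) auto
    then show ?thesis by (simp add: power_divide)
  qed
  have "real (card ?K) = (\<Sum>C\<in>?K. 1)" by simp
  also have "\<dots> \<le> (\<Sum>C\<in>?K. (4 ^ m) ^ 8 * walk_weight (p # tl (W C)))" by (rule sum_mono) (rule ge)
  also have "\<dots> = (\<Sum>l\<in>(\<lambda>C. tl (W C)) ` ?K. (4 ^ m) ^ 8 * walk_weight (p # l))"
    by (simp add: sum.reindex[OF inj])
  also have "\<dots> \<le> (\<Sum>l\<in>?L. (4 ^ m) ^ 8 * walk_weight (p # l))"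
    by (rule sum_mono2[OF finL im]) (simp add: walk_weight_nonneg)
  also have "\<dots> = (4 ^ m) ^ 8 * (\<Sum>l\<in>?L. walk_weight (p # l))" by (simp add: sum_distrib_left)
  also have "\<dots> \<le> (4 ^ m) ^ 8 * (10 ^ 4) ^ (2 * m)" by (intro mult_left_mono sum_walk_weight) auto
  also have "\<dots> = ((4::real) ^ 8 * (10 ^ 4)\<^sup>2) ^ m"
  proof -
    have "((4::real) ^ m) ^ 8 = (4 ^ 8) ^ m" by (simp only: power_mult[symmetric] mult.commute)
    moreover have "((10::real) ^ 4) ^ (2 * m) = ((10 ^ 4)\<^sup>2) ^ m" by (rule power_mult)
    ultimately show ?thesis by (simp only: power_mult_distrib)
  qed
  also have "\<dots> \<le> (10 ^ 13) ^ m" by (rule power_mono) simp_all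
  finally show ?thesis .
qed

lemma sum_geometric_le:
  fixes x :: real
  assumes "0 \<le> x" "x \<le> 1 / 2"
  shows "(\<Sum>m\<in>{n..N}. x ^ m) \<le> 2 * x ^ n"
proof (cases "n \<le> N")
  case True
  let ?S = "\<Sum>m\<in>{n..N}. x ^ m"
  have "1 / 2 * ?S \<le> (1 - x) * ?S" using assms by (intro mult_right_mono sum_nonneg) auto
  also have "\<dots> = x ^ n - x ^ Suc N" by (rule sum_gp_multiplied[OF True])
  also have "\<dots> \<le> x ^ n" using assms by simp
  finally show ?thesis by simp
qed (use assms in simp)

text \<open>\<open>10^-20\<close> is what the assumption on \<beta> leaves per plaquette after the
  decay is taken out, and \<open>10^13 * 10^-20 = 10^-7\<close> is the ratio of the geometric
  series.\<close>

lemma sum_knots_at: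
  "(\<Sum>C\<in>{C \<in> knots_at a b p. Suc n \<le> card C}. (1 / 10 ^ 20 :: real) ^ card C) \<le> 2 / 10 ^ 20 * (1 / 10 ^ 7) ^ n"
proof -
  let ?K = "{C \<in> knots_at a b p. Suc n \<le> card C}"
  let ?N = "card (plaquettes {a..b})"
  have fin: "finite ?K" using finite_knots_at by simp
  have fp: "finite (plaquettes {a..b})" by (rule finite_plaquettes[OF finite_box])
  have im: "card ` ?K \<subseteq> Suc ` {n..?N}"
  proof
    fix c assume "c \<in> card ` ?K"
    then obtain C where C: "C \<in> ?K" "c = card C" by blast
    have "card C \<le> ?N" using C by (auto simp: knots_at_def intro: card_mono[OF fp])
    then show "c \<in> Suc ` {n..?N}" using C by (intro image_eqI[of _ _ "c - 1"]) auto
  qed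
  have "(\<Sum>C\<in>?K. (1 / 10 ^ 20 :: real) ^ card C) = (\<Sum>c\<in>Suc ` {n..?N}. \<Sum>C\<in>{C \<in> ?K. card C = c}. (1 / 10 ^ 20) ^ card C)"
    by (rule sum.group[OF fin _ im, symmetric]) simp
  also have "\<dots> = (\<Sum>m\<in>{n..?N}. \<Sum>C\<in>{C \<in> ?K. card C = Suc m}. (1 / 10 ^ 20) ^ card C)"
    by (subst sum.reindex, simp, simp only: o_def)
  also have "\<dots> \<le> (\<Sum>m\<in>{n..?N}. 1 / 10 ^ 20 * (1 / 10 ^ 7) ^ m)"
  proof (rule sum_mono)
    fix m assume m: "m \<in> {n..?N}"
    have "{C \<in> ?K. card C = Suc m} = {C \<in> knots_at a b p. card C = Suc m}" using m by auto
    then have "(\<Sum>C\<in>{C \<in> ?K. card C = Suc m}. (1 / 10 ^ 20 :: real) ^ card C)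
        = real (card {C \<in> knots_at a b p. card C = Suc m}) * (1 / 10 ^ 20) ^ Suc m" by simp
    also have "\<dots> \<le> (10 ^ 13) ^ m * (1 / 10 ^ 20) ^ Suc m"
      by (rule mult_right_mono[OF card_knots_at]) simp
    also have "\<dots> = 1 / 10 ^ 20 * (10 ^ 13 * (1 / 10 ^ 20)) ^ m"
      unfolding power_mult_distrib power_Suc by simp
    finally show "(\<Sum>C\<in>{C \<in> ?K. card C = Suc m}. (1 / 10 ^ 20 :: real) ^ card C) \<le> 1 / 10 ^ 20 * (1 / 10 ^ 7) ^ m"
      by simp
  qed
  also have "\<dots> = 1 / 10 ^ 20 * (\<Sum>m\<in>{n..?N}. (1 / 10 ^ 7) ^ m)" by (simp only: sum_distrib_left)
  also have "\<dots> \<le> 1 / 10 ^ 20 * (2 * (1 / 10 ^ 7) ^ n)"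
  proof (rule mult_left_mono)
    show "(\<Sum>m\<in>{n..?N}. (1 / 10 ^ 7 :: real) ^ m) \<le> 2 * (1 / 10 ^ 7) ^ n"
      by (rule sum_geometric_le) simp_all
  qed simp
  finally show ?thesis by simp
qed

section \<open>Decomposition into knots that cannot be merged, and their boxes\<close>

definition knot_cover :: "plaquette set \<Rightarrow> plaquette set set \<Rightarrow> bool" where
  "knot_cover Q \<P> \<longleftrightarrow> finite \<P> \<and> \<Union>\<P> = Q \<and> pairwise disjnt \<P> \<and> (\<forall>C\<in>\<P>. knot C)"

text \<open>No merger is possible any more. For knots of equal size this excludes nearness in both
  directions.\<close>

definition knot_decomposition :: "plaquette set \<Rightarrow> plaquette set set \<Rightarrow> bool" where
  "knot_decomposition Q \<P> \<longleftrightarrow> knot_cover Q \<P> \<and>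
     (\<forall>C\<in>\<P>. \<forall>C'\<in>\<P>. C \<noteq> C' \<longrightarrow> card C \<le> card C' \<longrightarrow> (\<forall>p\<in>C'. \<not> near C p))"

text \<open>In a cover with the fewest knots no two of them can be merged.\<close>

lemma knot_decomposition_exists:
  assumes "finite Q"
  shows "\<exists>\<P>. knot_decomposition Q \<P>"
proof -
  have "knot_cover Q ((\<lambda>p. {p}) ` Q)"
    using assms by (auto simp: knot_cover_def pairwise_def intro: knot.singleton)
  then obtain \<P> where cov: "knot_cover Q \<P>" and least: "\<And>\<P>'. knot_cover Q \<P>' \<Longrightarrow> card \<P> \<le> card \<P>'"
    using ex_has_least_nat[of "knot_cover Q" _ card] by blast
  have fin: "finite \<P>" and un: "\<Union>\<P> = Q" and dis: "pairwise disjnt \<P>" and kn: "\<And>C. C \<in> \<P> \<Longrightarrow> knot C"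
    using cov by (auto simp: knot_cover_def)
  have "\<not> near C p" if C: "C \<in> \<P>" "C' \<in> \<P>" "C \<noteq> C'" "card C \<le> card C'" "p \<in> C'" for C C' p
  proof
    assume n: "near C p"
    let ?R = "\<P> - {C, C'}"
    have "C \<inter> C' = {}" using dis C by (auto simp: pairwise_def disjnt_def)
    then have k: "knot (C \<union> C')" using knot.merge[OF kn[OF C(1)] kn[OF C(2)] _ C(4,5) n] by blast
    have d: "disjnt D (C \<union> C')" if "D \<in> ?R" for D
      using that dis C(1,2) unfolding pairwise_def disjnt_def by blast
    have "knot_cover Q (insert (C \<union> C') ?R)"
      unfolding knot_cover_def
    proof (intro conjI ballI)
      show "\<Union>(insert (C \<union> C') ?R) = Q" using un C by blast
      show "pairwise disjnt (insert (C \<union> C') ?R)"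
        unfolding pairwise_insert
      proof (intro conjI allI impI)
        show "pairwise disjnt ?R" by (rule pairwise_subset[OF dis]) blast
      qed (use d in \<open>auto simp: disjnt_sym\<close>)
      show "knot D" if "D \<in> insert (C \<union> C') ?R" for D using that k kn by blast
    qed (use fin in simp)
    then have "card \<P> \<le> card (insert (C \<union> C') ?R)" by (rule least)
    also have "\<dots> \<le> Suc (card ?R)" using fin by (simp add: card_insert_if)
    also have "\<dots> = Suc (card \<P> - 2)" using C fin by (simp add: card_Diff_subset)
    finally have "card \<P> \<le> Suc (card \<P> - 2)" .
    moreover have "2 \<le> card \<P>"
      using card_mono[of \<P> "{C, C'}"] fin C by simp
    ultimately show False by simp
  qed
  then show ?thesis using cov unfolding knot_decomposition_def by blast
qed

lemma knot_decompositionD: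
  assumes "knot_decomposition Q \<P>"
  shows "finite \<P>" "\<Union>\<P> = Q" "\<And>C. C \<in> \<P> \<Longrightarrow> knot C"
    "\<And>C C'. C \<in> \<P> \<Longrightarrow> C' \<in> \<P> \<Longrightarrow> C \<noteq> C' \<Longrightarrow> C \<inter> C' = {}"
    "\<And>C C' p. C \<in> \<P> \<Longrightarrow> C' \<in> \<P> \<Longrightarrow> C \<noteq> C' \<Longrightarrow> card C \<le> card C' \<Longrightarrow> p \<in> C' \<Longrightarrow> \<not> near C p"
  using assms by (auto simp: knot_decomposition_def knot_cover_def pairwise_def disjnt_def)

lemma near_self: "p \<in> C \<Longrightarrow> (\<And>k. \<bar>cen p $ k - cen q $ k\<bar> \<le> 2) \<Longrightarrow> near C q"
  unfolding near_def by (intro allI conjI bexI[of _ p]) (smt (verit))+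

text \<open>Nearness of two single plaquettes is symmetric, so it does not matter which of the knots
  is the smaller.\<close>

lemma same_knot:
  assumes "knot_decomposition Q \<P>" "C \<in> \<P>" "C' \<in> \<P>" "p \<in> C" "q \<in> C'" "\<And>k. \<bar>cen p $ k - cen q $ k\<bar> \<le> 2"
  shows "C = C'"
proof (rule ccontr)
  assume ne: "C \<noteq> C'"
  have "near C q" by (rule near_self[OF assms(4,6)])
  moreover have "near C' p" by (rule near_self[OF assms(5)]) (use assms(6) in \<open>simp add: abs_minus_commute\<close>)
  ultimately show False
    using knot_decompositionD(5)[OF assms(1)] assms(2-5) ne by (metis nle_le)
qed

text \<open>A plaquette can be shifted step by step to the lowest corner of the box, and the
  plaquettes at the corner have centres at distance at most one from each other. No such step leaves
  a knot.\<close>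

lemma box_in_knot:
  assumes dec: "knot_decomposition Q \<P>" and sub: "plaquettes {x..y} \<subseteq> Q" and ne: "plaquettes {x..y} \<noteq> {}"
  shows "\<exists>C\<in>\<P>. plaquettes {x..y} \<subseteq> C"
proof -
  have part: "\<exists>C\<in>\<P>. p \<in> C" if "p \<in> plaquettes {x..y}" for p
    using that sub knot_decompositionD(2)[OF dec] by blast
  have corner: "(x, i, j) \<in> plaquettes {x..y} \<and> (\<forall>C\<in>\<P>. (z, i, j) \<in> C \<longrightarrow> (x, i, j) \<in> C)"
    if "(z, i, j) \<in> plaquettes {x..y}" for z i j
    using that
  proof (induction "height x z" arbitrary: z rule: less_induct)
    case less
    show ?case
    proof (cases "z = x")
      case False
      have z: "z \<in> {x..y}" "z + axis i 1 + axis j 1 \<in> {x..y}" "i < j"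
        using less.prems unfolding plaquettes_box_iff by auto
      obtain k where k: "z - axis k 1 \<in> {x..y}" using box_descent[OF z(1) False] by blast
      let ?z = "z - axis k 1"
      have "x $ m \<le> (?z + axis i 1 + axis j 1) $ m \<and> (?z + axis i 1 + axis j 1) $ m \<le> y $ m" for m
      proof -
        have "x $ m \<le> ?z $ m" "(z + axis i 1 + axis j 1) $ m \<le> y $ m" using k z(2) unfolding box_iff by blast+
        moreover have "0 \<le> axis i (1::int) $ m" "0 \<le> axis j (1::int) $ m" "0 \<le> axis k (1::int) $ m"
          by (auto simp: axis_def)
        ultimately show ?thesis by simp
      qed
      then have "?z + axis i 1 + axis j 1 \<in> {x..y}" unfolding box_iff by blast
      then have p: "(?z, i, j) \<in> plaquettes {x..y}" unfolding plaquettes_box_iff using k z by blast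
      have IH: "(x, i, j) \<in> plaquettes {x..y} \<and> (\<forall>C\<in>\<P>. (?z, i, j) \<in> C \<longrightarrow> (x, i, j) \<in> C)"
        by (rule less.hyps[OF height_descent[OF z(1) k] p])
      moreover have "(?z, i, j) \<in> C" if C: "C \<in> \<P>" "(z, i, j) \<in> C" for C
      proof -
        obtain C' where C': "C' \<in> \<P>" "(?z, i, j) \<in> C'" using part[OF p] by blast
        have "C = C'" by (rule same_knot[OF dec C(1) C'(1) C(2) C'(2)]) (auto simp: axis_def)
        then show ?thesis using C' by simp
      qed
      ultimately show ?thesis by blast
    qed (use less.prems in simp)
  qed
  obtain p0 where p0: "p0 \<in> plaquettes {x..y}" using ne by blast
  obtain z0 i0 j0 where z0: "p0 = (z0, i0, j0)" by (cases p0)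
  have c0: "(x, i0, j0) \<in> plaquettes {x..y}" using corner[of z0 i0 j0] p0 z0 by simp
  then obtain C where C: "C \<in> \<P>" "(x, i0, j0) \<in> C" using part by blast
  have "p \<in> C" if p: "p \<in> plaquettes {x..y}" for p
  proof -
    obtain z i j where z: "p = (z, i, j)" by (cases p)
    obtain C' where C': "C' \<in> \<P>" "p \<in> C'" using part p by blast
    then have x: "(x, i, j) \<in> C'" using corner[of z i j] p z by blast
    have "C = C'" by (rule same_knot[OF dec C(1) C'(1) C(2) x]) (auto simp: of_bool_def)
    then show ?thesis using C' by simp
  qed
  then show ?thesis using C by blast
qed

text \<open>A plaquette shows that the box extends in two directions, at least one of which is not
  that of the edge. Observables that depend on edges are thereby confined to a knot, which consists
  of plaquettes.\<close>

lemma edge_in_plaquette: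
  assumes "plaquettes {x..y} \<noteq> {}" "e \<in> edges {x..y}"
  shows "\<exists>p\<in>plaquettes {x..y}. e \<in> plaquette_edges p"
proof -
  obtain z0 i j where p0: "(z0, i, j) \<in> plaquettes {x..y}" using assms(1) by (metis ex_in_conv surj_pair)
  obtain z k where e: "e = (z, z + axis k 1)" using assms(2) by (cases e) (auto simp: edges_iff)
  have z: "z \<in> {x..y}" "z + axis k 1 \<in> {x..y}" using assms(2) by (auto simp: e edges_iff)
  have "i \<noteq> j" using p0 unfolding plaquettes_box_iff by auto
  then obtain l where l: "l \<noteq> k" "l = i \<or> l = j" by metis
  have zl: "z0 \<in> {x..y}" "z0 + axis l 1 \<in> {x..y}" using p0 l(2) unfolding plaquettes_iff by auto
  have lt: "x $ l < y $ l"
  proof -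
    have "x $ l \<le> z0 $ l" "(z0 + axis l 1) $ l \<le> y $ l" using zl unfolding box_iff by blast+
    then show ?thesis by simp
  qed
  have sq: "\<exists>p\<in>plaquettes {x..y}. {(v, v + axis k 1), (v + axis l 1, v + axis l 1 + axis k 1)} \<subseteq> plaquette_edges p"
    if v: "v \<in> {x..y}" "v + axis l 1 + axis k 1 \<in> {x..y}" for v
  proof (cases "k < l")
    case True
    have c: "v + axis k 1 + axis l 1 = v + axis l 1 + axis k 1" by (simp add: add_ac)
    have "(v, k, l) \<in> plaquettes {x..y}" unfolding plaquettes_box_iff c using v True by blast
    then show ?thesis by (rule bexI[rotated]) (simp add: add_ac)
  next
    case False
    then have "(v, l, k) \<in> plaquettes {x..y}" unfolding plaquettes_box_iff using v l(1) by (meson not_less_iff_gr_or_eq)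
    then show ?thesis by (rule bexI[rotated]) (simp add: add_ac)
  qed
  show ?thesis
  proof (cases "z $ l < y $ l")
    case True
    have "x $ m \<le> (z + axis l 1 + axis k 1) $ m \<and> (z + axis l 1 + axis k 1) $ m \<le> y $ m" for m
    proof (cases "m = l")
      case True
      have "x $ l \<le> z $ l" using z(1) unfolding box_iff by blast
      then show ?thesis using \<open>z $ l < y $ l\<close> True l(1) by (simp add: axis_def)
    next
      case False
      then have "(z + axis l 1 + axis k 1) $ m = (z + axis k 1) $ m" by (simp add: axis_def)
      then show ?thesis using z(2) unfolding box_iff by metis
    qed
    then have "z + axis l 1 + axis k 1 \<in> {x..y}" unfolding box_iff by blast
    then show ?thesis using sq[OF z(1)] e by blast
  next
    case False
    let ?v = "z - axis l 1"
    have "x $ m \<le> ?v $ m \<and> ?v $ m \<le> y $ m" for m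
    proof (cases "m = l")
      case True
      have "z $ l \<le> y $ l" using z(1) unfolding box_iff by blast
      then show ?thesis using False True lt by simp
    next
      case False
      then have "?v $ m = z $ m" by (simp add: axis_def)
      then show ?thesis using z(1) unfolding box_iff by metis
    qed
    then have "?v \<in> {x..y}" unfolding box_iff by blast
    then show ?thesis using sq[of ?v] e z(2) by auto
  qed
qed

text \<open>
  The box consists of the vertices within distance 1 of the hull of the centres. Centres are doubled, so
  that \<open>(l - 1) div 2\<close> is the ceiling of \<open>(l - 2) / 2\<close>.
\<close>

lemma cen_bounds:
  assumes "(x, i, j) \<in> plaquettes {u..v}"
  shows "2 * u $ k \<le> cen (x, i, j) $ k" "cen (x, i, j) $ k \<le> 2 * v $ k"
proof -
  have x: "x \<in> {u..v}" "x + axis i 1 \<in> {u..v}" "x + axis j 1 \<in> {u..v}"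
    using assms unfolding plaquettes_iff by auto
  have "u $ k \<le> x $ k" "x $ k \<le> v $ k" "(x + axis i 1) $ k \<le> v $ k" "(x + axis j 1) $ k \<le> v $ k"
    using x unfolding box_iff by blast+
  then show "2 * u $ k \<le> cen (x, i, j) $ k" "cen (x, i, j) $ k \<le> 2 * v $ k"
    by (auto simp: axis_def of_bool_def split: if_splits)
qed

lemma cen_face: "p \<in> plaquettes (face u v i c) \<Longrightarrow> cen p $ i = 2 * c"
proof -
  assume p: "p \<in> plaquettes (face u v i c)"
  obtain x k l where x: "p = (x, k, l)" by (cases p)
  have "x $ i = c" "(x + axis k 1) $ i = c" "(x + axis l 1) $ i = c"
    using p unfolding x plaquettes_iff by (simp_all add: face_def)
  then show ?thesis unfolding x by (auto simp: axis_def split: if_splits)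
qed

text \<open>The rounding balances two demands: the box may reach at most distance 1 beyond the hull,
  so that all its plaquettes are near \<open>C\<close>, but a side not clipped by the lattice must
  lie strictly beyond the hull, so that no plaquette of \<open>C\<close> lies in it.\<close>

lemma knot_box:
  assumes "finite C" "C \<noteq> {}" and sub: "C \<subseteq> plaquettes {a..b}"
  shows "\<exists>u v. a \<le> u \<and> u \<le> v \<and> v \<le> b \<and> C \<subseteq> plaquettes {u..v} \<and> (\<forall>p\<in>plaquettes {u..v}. near C p)
    \<and> (\<forall>i c p. (i, c) \<in> inner_faces a b u v \<longrightarrow> p \<in> plaquettes (face u v i c) \<longrightarrow> p \<notin> C)"
proof -
  define lo where "lo k = Min ((\<lambda>q. cen q $ k) ` C)" for k
  define hi where "hi k = Max ((\<lambda>q. cen q $ k) ` C)" for k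
  have lo: "lo k \<le> cen q $ k" "cen q $ k \<le> hi k" if "q \<in> C" for q k
    using that assms unfolding lo_def hi_def by auto
  have lo_in: "\<exists>q\<in>C. cen q $ k = lo k" "\<exists>q\<in>C. cen q $ k = hi k" for k
  proof -
    have "lo k \<in> (\<lambda>q. cen q $ k) ` C" "hi k \<in> (\<lambda>q. cen q $ k) ` C"
      unfolding lo_def hi_def using assms by (intro Min_in Max_in; simp)+
    then show "\<exists>q\<in>C. cen q $ k = lo k" "\<exists>q\<in>C. cen q $ k = hi k"
      unfolding image_iff by metis+
  qed
  \<comment> \<open>In doubled units an unclipped side lies 1 or 2 beyond the hull, depending on
    parity.\<close>
  define u where "u = (\<chi> k. max (a $ k) ((lo k - 1) div 2))"
  define v where "v = (\<chi> k. min (b $ k) ((hi k + 2) div 2))"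
  have inV: "p \<in> plaquettes {u..v}" if "p \<in> C" for p
  proof -
    obtain x i j where p: "p = (x, i, j)" by (cases p)
    have ij: "i < j" "x \<in> {a..b}" "x + axis i 1 + axis j 1 \<in> {a..b}"
      using subsetD[OF sub that] unfolding p plaquettes_box_iff by blast+
    have "u $ k \<le> x $ k \<and> x $ k \<le> v $ k \<and> u $ k \<le> (x + axis i 1 + axis j 1) $ k \<and> (x + axis i 1 + axis j 1) $ k \<le> v $ k" for k
    proof -
      have c: "cen p $ k = 2 * x $ k + of_bool (k = i \<or> k = j)" by (simp add: p)
      have s: "(x + axis i 1 + axis j 1) $ k = x $ k + of_bool (k = i \<or> k = j)"
        using ij(1) by (auto simp: axis_def)
      have ab: "a $ k \<le> x $ k" "x $ k + of_bool (k = i \<or> k = j) \<le> b $ k"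
        using ij(2,3) unfolding box_iff s[symmetric] by blast+
      have "lo k \<le> cen p $ k" "cen p $ k \<le> hi k" using lo that by auto
      then have "(lo k - 1) div 2 \<le> x $ k" "x $ k + of_bool (k = i \<or> k = j) \<le> (hi k + 2) div 2"
        unfolding c by (auto simp: of_bool_def split: if_splits)
      then show ?thesis unfolding s using ab by (auto simp: u_def v_def of_bool_def split: if_splits)
    qed
    then have "x \<in> {u..v}" "x + axis i 1 + axis j 1 \<in> {u..v}" unfolding box_iff by blast+
    then show ?thesis unfolding p plaquettes_box_iff using ij by blast
  qed
  have near: "near C p" if p: "p \<in> plaquettes {u..v}" for p
    unfolding near_def
  proof (intro allI)
    fix k
    obtain x i j where x: "p = (x, i, j)" by (cases p)
    have "2 * u $ k \<le> cen p $ k" "cen p $ k \<le> 2 * v $ k" using cen_bounds p x by auto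
    moreover have "lo k - 2 \<le> 2 * ((lo k - 1) div 2)" by presburger
    moreover have "2 * ((hi k + 2) div 2) \<le> hi k + 2" by presburger
    moreover have "(lo k - 1) div 2 \<le> u $ k" "v $ k \<le> (hi k + 2) div 2" by (simp_all add: u_def v_def)
    ultimately have "lo k \<le> cen p $ k + 2" "cen p $ k \<le> hi k + 2" by linarith+
    then show "(\<exists>q\<in>C. cen q $ k \<le> cen p $ k + 2) \<and> (\<exists>q\<in>C. cen p $ k \<le> cen q $ k + 2)"
      using lo_in by metis
  qed
  have avoid: "p \<notin> C" if f: "(i, c) \<in> inner_faces a b u v" and p: "p \<in> plaquettes (face u v i c)" for i c p
  proof
    assume "p \<in> C"
    then have l: "lo i \<le> 2 * c" "2 * c \<le> hi i" using lo cen_face[OF p] by metis+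
    have "c = u $ i \<and> a $ i < u $ i \<or> c = v $ i \<and> v $ i < b $ i" using f by (simp add: inner_faces_def)
    then have "c = (lo i - 1) div 2 \<or> c = (hi i + 2) div 2" by (auto simp: u_def v_def max_def min_def split: if_splits)
    then show False using l by presburger
  qed
  obtain q where "q \<in> C" using assms by blast
  then have "q \<in> plaquettes {u..v}" by (rule inV)
  then have "u \<le> v" by (cases q) (auto simp: plaquettes_iff)
  moreover have "a \<le> u" "v \<le> b" by (simp_all add: u_def v_def less_eq_vec_def)
  ultimately show ?thesis using inV near avoid by blast
qed

text \<open>By \<open>knot_gap\<close> each window of length 2 contains a centre of the knot. Only
  \<open>D - 1\<close> windows are used, because the next one would end at \<open>2 s + 2 D\<close>,
  where centres of \<open>X\<close> may lie; this is the origin of \<open>L - 1\<close> in the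
  exponent.\<close>

lemma knot_crossing:
  assumes C: "knot C" and q: "q \<in> C" "cen q $ k \<le> 2 * s" and q': "q' \<in> C" "2 * s + 2 * int D \<le> cen q' $ k"
    and X: "\<And>r. r \<in> X \<Longrightarrow> cen r $ k \<le> 2 * s \<or> 2 * s + 2 * int D \<le> cen r $ k"
  shows "D - 1 \<le> card (C - X)"
proof -
  have "\<exists>r\<in>C. 2 * s + 2 * int t < cen r $ k \<and> cen r $ k \<le> 2 * s + 2 * int t + 2" if "t < D - 1" for t
    by (rule knot_gap[OF C q(1) q'(1)]) (use q q' that in auto)
  then obtain r where r: "\<And>t. t < D - 1 \<Longrightarrow> r t \<in> C \<and> 2 * s + 2 * int t < cen (r t) $ k \<and> cen (r t) $ k \<le> 2 * s + 2 * int t + 2"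
    by metis
  have "card {..<D - 1} \<le> card (C - X)"
  proof (rule card_inj_on_le)
    show "inj_on r {..<D - 1}"
    proof (rule inj_onI)
      fix t t' assume t: "t \<in> {..<D - 1}" "t' \<in> {..<D - 1}" "r t = r t'"
      then show "t = t'" using r[of t] r[of t'] by force
    qed
    show "r ` {..<D - 1} \<subseteq> C - X"
    proof
      fix p assume "p \<in> r ` {..<D - 1}"
      then obtain t where t: "t < D - 1" "p = r t" by auto
      have "\<not> (cen p $ k \<le> 2 * s \<or> 2 * s + 2 * int D \<le> cen p $ k)" using r[OF t(1)] t by auto
      then show "p \<in> C - X" using X r[OF t(1)] t(2) by blast
    qed
    show "finite (C - X)" using knot_finite[OF C] by simp
  qed
  then show ?thesis by simp
qed

section \<open>Summation over large knots and families of them\<close>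

definition large_knots :: "site \<Rightarrow> site \<Rightarrow> nat \<Rightarrow> plaquette set set" where
  "large_knots a b N = {C. knot C \<and> C \<subseteq> plaquettes {a..b} \<and> Suc N \<le> card C}"

lemma finite_large_knots: "finite (large_knots a b N)"
  by (rule finite_subset[of _ "Pow (plaquettes {a..b})"]) (auto simp: large_knots_def finite_plaquettes finite_box)

lemma card_box_le:
  fixes a b :: site
  assumes "\<And>i. b $ i - a $ i = int N"
  shows "card {a..b} \<le> (N + 1) ^ 4"
proof -
  have "card {a..b} = card ((UNIV :: 4 set) \<rightarrow>\<^sub>E {..N})"
  proof (rule bij_betw_same_card[of "\<lambda>x i. nat (x $ i - a $ i)"])
    show "bij_betw (\<lambda>x i. nat (x $ i - a $ i)) {a..b} (UNIV \<rightarrow>\<^sub>E {..N})"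
    proof (rule bij_betw_byWitness[of _ "\<lambda>f. \<chi> i. a $ i + int (f i)"])
      have b: "b $ i = a $ i + int N" for i using assms[of i] by simp
      show "\<forall>x\<in>{a..b}. (\<chi> i. a $ i + int (nat (x $ i - a $ i))) = x"
        unfolding Ball_def box_iff by (simp add: vec_eq_iff)
      show "(\<lambda>x i. nat (x $ i - a $ i)) ` {a..b} \<subseteq> UNIV \<rightarrow>\<^sub>E {..N}"
        unfolding image_subset_iff Ball_def box_iff b by (auto simp: PiE_iff nat_le_iff algebra_simps)
      show "(\<lambda>f. \<chi> i. a $ i + int (f i)) ` (UNIV \<rightarrow>\<^sub>E {..N}) \<subseteq> {a..b}"
        unfolding image_subset_iff Ball_def box_iff b by (auto simp: PiE_iff)
    qed auto
  qed
  also have "\<dots> = (N + 1) ^ 4" by (simp add: card_PiE)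
  finally show ?thesis by simp
qed

text \<open>The volume is harmless: there are at most \<open>16 (N + 1)^4 \<le> 16 * 16^N\<close>
  plaquettes to start from, and the knots with more than \<open>N\<close> plaquettes supply
  \<open>10^(-7 N)\<close>.\<close>

lemma sum_large_knots:
  assumes "\<And>i. b $ i - a $ i = int N"
  shows "(\<Sum>C\<in>large_knots a b N. (1 / 10 ^ 20 :: real) ^ card C) \<le> 1 / 2"
proof -
  let ?e = "1 / 10 ^ 20 :: real" and ?\<Pi> = "plaquettes {a..b}"
  have fin: "finite ?\<Pi>" by (rule finite_plaquettes[OF finite_box])
  have "card ?\<Pi> \<le> card ({a..b} \<times> (UNIV :: (4 \<times> 4) set))"
    by (rule card_mono) (auto simp: finite_box plaquettes_iff)
  also have "\<dots> \<le> 16 * (N + 1) ^ 4" using card_box_le[of b a N] assms by (simp add: card_cartesian_product card_prod)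
  also have "\<dots> \<le> 16 * (2 ^ N) ^ 4"
    by (intro mult_le_mono power_mono) (simp_all add: Suc_le_eq)
  finally have "real (card ?\<Pi>) \<le> real (16 * (2 ^ N) ^ 4)" by (rule of_nat_mono)
  then have cp: "real (card ?\<Pi>) \<le> 16 * 16 ^ N"
  proof -
    have "(2 ^ N) ^ 4 = (16::nat) ^ N"
      unfolding power_mult[symmetric] mult.commute[of N] unfolding power_mult by simp
    then show ?thesis using \<open>real (card ?\<Pi>) \<le> _\<close> by simp
  qed
  let ?S = "SIGMA p:?\<Pi>. {C \<in> knots_at a b p. Suc N \<le> card C}"
  have finS: "finite ?S" using fin finite_knots_at by simp
  have "(\<Sum>C\<in>large_knots a b N. ?e ^ card C) \<le> (\<Sum>C\<in>snd ` ?S. ?e ^ card C)"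
  proof (rule sum_mono2)
    show "finite (snd ` ?S)" using finS by (rule finite_imageI)
    show "large_knots a b N \<subseteq> snd ` ?S"
    proof
      fix C assume C: "C \<in> large_knots a b N"
      then have "C \<noteq> {}" using knot_nonempty by (simp add: large_knots_def)
      then obtain p where p: "p \<in> C" by blast
      then have "(p, C) \<in> ?S" using C by (auto simp: large_knots_def knots_at_def)
      then show "C \<in> snd ` ?S" by force
    qed
  qed simp
  also have "\<dots> \<le> (\<Sum>z\<in>?S. ?e ^ card (snd z))"
    using sum_image_le[OF finS, of "\<lambda>C. ?e ^ card C" snd] by (simp add: o_def)
  also have "\<dots> = (\<Sum>p\<in>?\<Pi>. \<Sum>C\<in>{C \<in> knots_at a b p. Suc N \<le> card C}. ?e ^ card C)"
    using fin finite_knots_at by (subst sum.Sigma) (simp_all add: case_prod_beta)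
  also have "\<dots> \<le> (\<Sum>p\<in>?\<Pi>. 2 / 10 ^ 20 * (1 / 10 ^ 7) ^ N)" by (intro sum_mono sum_knots_at)
  also have "\<dots> = real (card ?\<Pi>) * (2 / 10 ^ 20 * (1 / 10 ^ 7) ^ N)" by simp
  also have "\<dots> \<le> (16 * 16 ^ N) * (2 / 10 ^ 20 * (1 / 10 ^ 7) ^ N)" by (rule mult_right_mono[OF cp]) simp
  also have "\<dots> = 32 / 10 ^ 20 * (16 * (1 / 10 ^ 7)) ^ N" unfolding power_mult_distrib by simp
  also have "\<dots> \<le> 32 / 10 ^ 20 * 1" by (intro mult_left_mono power_le_one) auto
  finally show ?thesis by simp
qed

text \<open>The families are among all subsets of the large knots, and the sum over subsets is a
  product of terms \<open>1 + t \<le> exp t\<close>. Without the empty family at most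
  \<open>exp (1/2) - 1\<close> remains.\<close>

lemma sum_knot_families:
  assumes "\<And>i. b $ i - a $ i = int N"
  shows "(\<Sum>U\<in>{\<Union>\<S> |\<S>. \<S> \<subseteq> large_knots a b N \<and> \<S> \<noteq> {} \<and> pairwise disjnt \<S>}. (1 / 10 ^ 20 :: real) ^ card U) \<le> 1"
proof -
  let ?e = "1 / 10 ^ 20 :: real" and ?K = "large_knots a b N"
  let ?F = "{\<S>. \<S> \<subseteq> ?K \<and> \<S> \<noteq> {} \<and> pairwise disjnt \<S>}"
  have finK: "finite ?K" by (rule finite_large_knots)
  have finF: "finite ?F" by (rule finite_subset[of _ "Pow ?K"]) (use finK in auto)
  have "{\<Union>\<S> |\<S>. \<S> \<subseteq> ?K \<and> \<S> \<noteq> {} \<and> pairwise disjnt \<S>} = \<Union> ` ?F" by auto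
  then have "(\<Sum>U\<in>{\<Union>\<S> |\<S>. \<S> \<subseteq> ?K \<and> \<S> \<noteq> {} \<and> pairwise disjnt \<S>}. ?e ^ card U) \<le> (\<Sum>\<S>\<in>?F. ?e ^ card (\<Union>\<S>))"
    using sum_image_le[OF finF, of "\<lambda>U. ?e ^ card U" Union] by (simp add: o_def)
  also have "\<dots> = (\<Sum>\<S>\<in>?F. \<Prod>C\<in>\<S>. ?e ^ card C)"
  proof (rule sum.cong)
    fix \<S> assume S: "\<S> \<in> ?F"
    have "card (\<Union>\<S>) = sum card \<S>"
      by (rule card_Union_disjoint) (use S knot_finite in \<open>auto simp: large_knots_def\<close>)
    then show "?e ^ card (\<Union>\<S>) = (\<Prod>C\<in>\<S>. ?e ^ card C)" by (simp only: power_sum)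
  qed simp
  also have "\<dots> \<le> (\<Sum>\<S>\<in>Pow ?K - {{}}. \<Prod>C\<in>\<S>. ?e ^ card C)"
    by (rule sum_mono2) (use finK in \<open>auto intro: prod_nonneg\<close>)
  also have "\<dots> = (\<Sum>\<S>\<in>Pow ?K. \<Prod>C\<in>\<S>. ?e ^ card C) - 1"
    using finK by (simp add: sum_diff1)
  also have "(\<Sum>\<S>\<in>Pow ?K. \<Prod>C\<in>\<S>. ?e ^ card C) = (\<Prod>C\<in>?K. ?e ^ card C + 1)"
    using prod_add[OF finK, of "\<lambda>C. ?e ^ card C" "\<lambda>_. 1"] by simp
  also have "\<dots> \<le> (\<Prod>C\<in>?K. exp (?e ^ card C))"
    by (rule prod_mono) (auto intro: exp_ge_add_one_self simp: add.commute add_nonneg_nonneg)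
  also have "\<dots> = exp (\<Sum>C\<in>?K. ?e ^ card C)" using finK by (simp add: exp_sum)
  also have "\<dots> \<le> exp (1 / 2)" using sum_large_knots[OF assms] by simp
  also have "\<dots> \<le> 2" using exp_bound_half[of "1 / 2 :: real"] by simp
  finally show ?thesis by simp
qed

section \<open>Peeling off knots\<close>

context gauge_theory
begin

lemma wsum_empty_pos: "0 < pf {}"
proof -
  let ?o = "\<lambda>e\<in>edges \<Lambda>. \<one>"
  let ?f = "\<lambda>\<sigma>. of_bool (supp \<sigma> = {}) * (of_real (weight \<sigma>) * 1) :: real"
  have o: "?o \<in> C" by (auto simp: configs_def)
  have h: "hol ?o p = \<one>" if "p \<in> plaquettes \<Lambda>" for p
    by (rule holonomy_one[OF boundary_oriented[OF that]]) simp
  have "?f ?o = 1" unfolding supp_def weight_def using h w_one by simp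
  moreover have "?f ?o \<le> pf {}"
    unfolding wsum_def by (rule member_le_sum[OF o _ finite_C]) (simp add: weight_nonneg)
  ultimately show ?thesis by simp
qed

lemma wsum_nonneg: "0 \<le> pf P"
  unfolding wsum_def by (intro sum_nonneg) (simp add: weight_nonneg)

lemma wsum_of_real: "wsum (\<lambda>_. 1::complex) P = of_real (pf P)"
  unfolding wsum_def of_real_sum by (rule sum.cong) (auto simp: of_bool_def)

text \<open>Only the excited plaquettes of \<open>D\<close> are counted, since a rectangle inside
  \<open>D\<close> does not by itself obstruct a flat slice.\<close>

definition small :: "plaquette set \<Rightarrow> plaquette set \<Rightarrow> bool" where
  "small P D \<longleftrightarrow> (\<forall>i. int (card (P \<inter> D)) \<le> b $ i - a $ i)"

text \<open>
  If the box spans the lattice in direction \<open>i\<close>, then it has more slices orthogonal to \<open>i\<close> than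
  \<open>P \<inter> D\<close> has plaquettes, so one of the slices is flat.
\<close>

lemma knot_gaugeable:
  assumes uv: "a \<le> u" "u \<le> v" "v \<le> b"
    and avoid: "\<And>i c p. (i, c) \<in> inner_faces a b u v \<Longrightarrow> p \<in> plaquettes (face u v i c) \<Longrightarrow> p \<notin> D"
    and T: "T \<inter> plaquettes {u..v} \<subseteq> P \<inter> D" and small: "small P D" and fin: "finite D"
    and \<sigma>: "\<sigma> \<in> C" "supp \<sigma> \<inter> plaquettes {u..v} \<subseteq> T"
  shows "\<sigma> \<in> gaugeable (shell a b u v)"
proof -
  have sub: "edges {u..v} \<subseteq> edges \<Lambda>" using edges_mono box_subset uv by blast
  have bad: "p \<in> P \<inter> D" if "p \<in> plaquettes (face u v i c)" "hol \<sigma> p \<noteq> \<one>" for p i c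
  proof -
    have "face u v i c \<subseteq> {u..v}" by (auto simp: face_def)
    then have pV: "p \<in> plaquettes {u..v}" using that(1) plaquettes_mono by blast
    then have "p \<in> plaquettes \<Lambda>" using plaquettes_mono[OF box_subset] uv by blast
    then have "p \<in> supp \<sigma>" using that(2) by (simp add: supp_def)
    then show ?thesis using pV \<sigma>(2) T by blast
  qed
  have "\<exists>h\<in>UNIV \<rightarrow> carrier G. pure_gauge G h \<sigma> (shell a b u v)"
  proof (rule shell_pure_gauge[OF uv(2)])
    show "\<sigma> e \<in> carrier G" if "e \<in> edges {u..v}" for e using that sub CD[OF \<sigma>(1)] by blast
    show "flat G \<sigma> (face u v i c)" if "(i, c) \<in> inner_faces a b u v" for i c
      unfolding flat_def using bad avoid[OF that] by blast
    show "\<exists>c. u $ i \<le> c \<and> c \<le> v $ i \<and> flat G \<sigma> (face u v i c)"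
      if "\<forall>c. (i, c) \<notin> inner_faces a b u v" for i
    proof -
      have "\<not> a $ i < u $ i" "\<not> v $ i < b $ i" using that by (auto simp: inner_faces_def)
      then have ai: "u $ i = a $ i" "v $ i = b $ i" using uv by (auto simp: less_eq_vec_def order_le_less)
      \<comment> \<open>A plaquette can obstruct only the slice that contains its centre, and there
        are more slices than plaquettes in \<open>P \<inter> D\<close>.\<close>
      let ?f = "\<lambda>p. cen p $ i div 2"
      have finPD: "finite (P \<inter> D)" using fin by simp
      have "a $ i \<le> b $ i" using ab by (simp add: less_eq_vec_def)
      then have "card (?f ` (P \<inter> D)) < card {a $ i..b $ i}"
        using card_image_le[OF finPD, of ?f] small unfolding small_def
        by (smt (verit, best) card_atLeastAtMost_int int_nat_eq of_nat_less_iff of_nat_le_iff)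
      then have "\<not> {a $ i..b $ i} \<subseteq> ?f ` (P \<inter> D)" using card_mono[OF finite_imageI[OF finPD, of ?f]] by (meson leD)
      then obtain c where c: "c \<in> {a $ i..b $ i}" "c \<notin> ?f ` (P \<inter> D)" by blast
      have "flat G \<sigma> (face u v i c)"
        unfolding flat_def
      proof (intro ballI, rule ccontr)
        fix p assume p: "p \<in> plaquettes (face u v i c)" "hol \<sigma> p \<noteq> \<one>"
        then have "p \<in> P \<inter> D" by (rule bad)
        moreover have "?f p = c" using cen_face[OF p(1)] by simp
        ultimately show False using c(2) by blast
      qed
      then show ?thesis using c(1) ai by auto
    qed
  qed
  then show ?thesis using \<sigma>(1) by (simp add: gaugeable_def)
qed

text \<open>All plaquettes of the box are near \<open>D\<close>, and another knot of at least the
  same size contains none of these.\<close>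

lemma smallest_knot:
  assumes dec: "knot_decomposition Q \<P>" and Q: "Q \<subseteq> plaquettes \<Lambda>" and T: "\<T> \<subseteq> \<P>" "D \<in> \<T>"
    and least: "\<And>D'. D' \<in> \<T> \<Longrightarrow> card D \<le> card D'" and small: "small P D"
  obtains u v where "a \<le> u" "v \<le> b" "D \<subseteq> plaquettes {u..v}" "\<Union>\<T> \<inter> plaquettes {u..v} = D"
    "P \<inter> \<Union>\<T> \<inter> plaquettes {u..v} = P \<inter> D" "P \<inter> \<Union>\<T> - plaquettes {u..v} = P \<inter> \<Union>(\<T> - {D})"
    "\<forall>\<sigma>\<in>C. supp \<sigma> \<inter> plaquettes {u..v} \<subseteq> P \<inter> \<Union>\<T> \<longrightarrow> \<sigma> \<in> gaugeable (shell a b u v)"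
proof -
  have D: "knot D" "D \<subseteq> plaquettes \<Lambda>"
    using knot_decompositionD(2,3)[OF dec] T Q by blast+
  obtain u v where uv: "a \<le> u" "u \<le> v" "v \<le> b" and DV: "D \<subseteq> plaquettes {u..v}"
    and near: "\<And>p. p \<in> plaquettes {u..v} \<Longrightarrow> near D p"
    and avoid: "\<And>i c p. (i, c) \<in> inner_faces a b u v \<Longrightarrow> p \<in> plaquettes (face u v i c) \<Longrightarrow> p \<notin> D"
    using knot_box[OF knot_finite[OF D(1)] knot_nonempty[OF D(1)] D(2)] by blast
  have iso: "p \<notin> plaquettes {u..v}" if "p \<in> D'" "D' \<in> \<T>" "D' \<noteq> D" for p D'
    using near knot_decompositionD(5)[OF dec, of D D' p] that T least by blast
  have 1: "\<Union>\<T> \<inter> plaquettes {u..v} = D" using iso DV T(2) by blast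
  then have 2: "P \<inter> \<Union>\<T> \<inter> plaquettes {u..v} = P \<inter> D" by blast
  have 3: "P \<inter> \<Union>\<T> - plaquettes {u..v} = P \<inter> \<Union>(\<T> - {D})" using iso DV by blast
  show ?thesis
  proof (rule that[OF uv(1,3) DV 1 2 3])
    have "\<sigma> \<in> gaugeable (shell a b u v)" if "\<sigma> \<in> C" "supp \<sigma> \<inter> plaquettes {u..v} \<subseteq> P \<inter> \<Union>\<T>" for \<sigma>
      by (rule knot_gaugeable[OF uv avoid _ small knot_finite[OF D(1)] that]) (use 2 in auto)
    then show "\<forall>\<sigma>\<in>C. supp \<sigma> \<inter> plaquettes {u..v} \<subseteq> P \<inter> \<Union>\<T> \<longrightarrow> \<sigma> \<in> gaugeable (shell a b u v)"
      by blast
  qed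
qed

lemma wsum_peel:
  assumes "knot_decomposition Q \<P>" "Q \<subseteq> plaquettes \<Lambda>" "\<T> \<subseteq> \<P>" "D \<in> \<T>"
    "\<And>D'. D' \<in> \<T> \<Longrightarrow> card D \<le> card D'" "small P D"
  shows "pf (P \<inter> \<Union>\<T>) * pf {} = pf (P \<inter> D) * pf (P \<inter> \<Union>(\<T> - {D}))"
proof -
  obtain u v where uv: "a \<le> u" "v \<le> b" and
    s: "P \<inter> \<Union>\<T> \<inter> plaquettes {u..v} = P \<inter> D" "P \<inter> \<Union>\<T> - plaquettes {u..v} = P \<inter> \<Union>(\<T> - {D})" and
    "\<forall>\<sigma>\<in>C. supp \<sigma> \<inter> plaquettes {u..v} \<subseteq> P \<inter> \<Union>\<T> \<longrightarrow> \<sigma> \<in> gaugeable (shell a b u v)"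
    by (rule smallest_knot[OF assms]) blast
  then have g: "\<And>\<sigma>. \<sigma> \<in> C \<Longrightarrow> supp \<sigma> \<inter> plaquettes {u..v} \<subseteq> P \<inter> \<Union>\<T> \<Longrightarrow> \<sigma> \<in> gaugeable (shell a b u v)"
    by blast
  have "wsum (\<lambda>_. 1 * 1 :: real) (P \<inter> \<Union>\<T>) * pf {}
      = pf (P \<inter> D) * pf (P \<inter> \<Union>(\<T> - {D}))"
    unfolding s[symmetric]
    by (rule wsum_split[OF uv g gauge_inv_const depends_on_const gauge_inv_const depends_on_const])
  then show ?thesis by simp
qed

text \<open>The smallest member goes first each time. \<open>order\<close> makes sure that the
  smallest one among those to be peeled is the smallest of all, so the kept family never has to be
  cut.\<close>

lemma wsum_peel_all:
  assumes dec: "knot_decomposition Q \<P>" and Q: "Q \<subseteq> plaquettes \<Lambda>" and T: "\<S> \<subseteq> \<T>" "\<T> \<subseteq> \<P>"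
    and small: "\<And>D. D \<in> \<T> - \<S> \<Longrightarrow> small P D"
    and order: "\<And>D D'. D \<in> \<T> - \<S> \<Longrightarrow> D' \<in> \<S> \<Longrightarrow> card D \<le> card D'"
  shows "pf (P \<inter> \<Union>\<T>) = pf (P \<inter> \<Union>\<S>) * (\<Prod>D\<in>\<T> - \<S>. pf (P \<inter> D) / pf {})"
  using T small order
proof (induction "card (\<T> - \<S>)" arbitrary: \<T>)
  case 0
  have "finite \<T>" using knot_decompositionD(1)[OF dec] 0 finite_subset by blast
  then have "\<T> - \<S> = {}" using 0 by simp
  then have "\<T> = \<S>" using 0 by blast
  then show ?case by simp
next
  case (Suc n)
  have fin: "finite \<T>" using knot_decompositionD(1)[OF dec] Suc.prems finite_subset by blast
  have ne: "\<T> - \<S> \<noteq> {}" using Suc.hyps(2) by force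
  obtain D where D: "D \<in> \<T> - \<S>" and least: "\<And>D'. D' \<in> \<T> - \<S> \<Longrightarrow> card D \<le> card D'"
    using ex_min_if_finite[of "card ` (\<T> - \<S>)"] ne fin by (metis (no_types, lifting) arg_min_if_finite(1) arg_min_least finite_Diff)
  have least': "card D \<le> card D'" if "D' \<in> \<T>" for D'
    using least[of D'] Suc.prems(4)[OF D, of D'] that by blast
  have eq: "\<T> - \<S> = insert D (\<T> - {D} - \<S>)" using D by blast
  have c: "n = card (\<T> - {D} - \<S>)" using Suc.hyps(2) fin unfolding eq by simp
  have IH: "pf (P \<inter> \<Union>(\<T> - {D}))
      = pf (P \<inter> \<Union>\<S>) * (\<Prod>D\<in>\<T> - {D} - \<S>. pf (P \<inter> D) / pf {})"
    by (rule Suc.hyps(1)[OF c]) (use Suc.prems D in blast)+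
  have "pf (P \<inter> \<Union>\<T>) = pf (P \<inter> D) / pf {} * pf (P \<inter> \<Union>(\<T> - {D}))"
    using wsum_peel[OF dec Q Suc.prems(2) _ least' Suc.prems(3)[OF D]] D wsum_empty_pos by (simp add: field_simps)
  also have "\<dots> = pf (P \<inter> \<Union>\<S>) * (\<Prod>D\<in>\<T> - \<S>. pf (P \<inter> D) / pf {})"
    unfolding IH eq using fin by simp
  finally show ?case .
qed

text \<open>If the smallest knot contains the plaquettes of a rectangle, its box separates
  \<open>u1\<close> from \<open>u2\<close> and both factors vanish. Otherwise both observables live
  outside the box and the knot is peeled off with the constant observable inside.\<close>

lemma wsum_zero:
  fixes u1 u2 :: "(edge \<Rightarrow> 'a) \<Rightarrow> complex"
  assumes dec: "knot_decomposition Q \<P>" and Q: "Q \<subseteq> plaquettes \<Lambda>"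
    and C12: "C1 \<in> \<P>" "C2 \<in> \<P>" "C1 \<noteq> C2" and S: "plaquettes S1 \<subseteq> C1" "plaquettes S2 \<subseteq> C2"
    and cover: "\<And>e. e \<in> edges S1 \<Longrightarrow> \<exists>p\<in>plaquettes S1. e \<in> plaquette_edges p"
      "\<And>e. e \<in> edges S2 \<Longrightarrow> \<exists>p\<in>plaquettes S2. e \<in> plaquette_edges p"
    and inv: "gauge_inv u1" "gauge_inv u2" and dep: "depends_on u1 (edges S1)" "depends_on u2 (edges S2)"
    and odd: "\<And>P. wsum u1 P = 0" "\<And>P. wsum u2 P = 0"
    and small: "\<And>D. D \<in> \<P> \<Longrightarrow> small P D" and T: "\<T> \<subseteq> \<P>" "C1 \<in> \<T>" "C2 \<in> \<T>"
  shows "wsum (\<lambda>\<sigma>. u1 \<sigma> * u2 \<sigma>) (P \<inter> \<Union>\<T>) = 0"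
  using T
proof (induction "card \<T>" arbitrary: \<T> rule: less_induct)
  case less
  have fin: "finite \<T>" using knot_decompositionD(1)[OF dec] less.prems finite_subset by blast
  obtain D where D: "D \<in> \<T>" and least: "\<And>D'. D' \<in> \<T> \<Longrightarrow> card D \<le> card D'"
    using less.prems(2) fin by (metis arg_min_if_finite(1) arg_min_least empty_iff)
  obtain u v where uv: "a \<le> u" "v \<le> b" and DV: "D \<subseteq> plaquettes {u..v}" "\<Union>\<T> \<inter> plaquettes {u..v} = D" and
    s: "P \<inter> \<Union>\<T> \<inter> plaquettes {u..v} = P \<inter> D" "P \<inter> \<Union>\<T> - plaquettes {u..v} = P \<inter> \<Union>(\<T> - {D})" and
    "\<forall>\<sigma>\<in>C. supp \<sigma> \<inter> plaquettes {u..v} \<subseteq> P \<inter> \<Union>\<T> \<longrightarrow> \<sigma> \<in> gaugeable (shell a b u v)"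
    by (rule smallest_knot[OF dec Q less.prems(1) D least small]) (use D less.prems(1) in blast)+
  then have g: "\<And>\<sigma>. \<sigma> \<in> C \<Longrightarrow> supp \<sigma> \<inter> plaquettes {u..v} \<subseteq> P \<inter> \<Union>\<T> \<Longrightarrow> \<sigma> \<in> gaugeable (shell a b u v)"
    by blast
  have inside: "depends_on f (edges {u..v})"
    if "depends_on f (edges S)" "plaquettes S \<subseteq> D" "\<And>e. e \<in> edges S \<Longrightarrow> \<exists>p\<in>plaquettes S. e \<in> plaquette_edges p"
    for f :: "(edge \<Rightarrow> 'a) \<Rightarrow> complex" and S
  proof -
    have "edges S \<subseteq> edges {u..v}" using that(2,3) DV(1) plaquette_inner by blast
    then show ?thesis using that(1) unfolding depends_on_def by blast
  qed
  have outside: "depends_on f (outer_edges u v)"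
    if "depends_on f (edges S)" "plaquettes S \<subseteq> D'" "D' \<in> \<T>" "D' \<noteq> D"
      "\<And>e. e \<in> edges S \<Longrightarrow> \<exists>p\<in>plaquettes S. e \<in> plaquette_edges p"
    for f :: "(edge \<Rightarrow> 'a) \<Rightarrow> complex" and S D'
  proof -
    have "D' \<inter> D = {}" using knot_decompositionD(4)[OF dec] that(3,4) D less.prems(1) by blast
    then have "p \<notin> plaquettes {u..v}" "p \<in> plaquettes \<Lambda>" if "p \<in> plaquettes S" for p
      using that DV(2) \<open>D' \<in> \<T>\<close> \<open>plaquettes S \<subseteq> D'\<close> knot_decompositionD(2)[OF dec] Q less.prems(1) by blast+
    then have "edges S \<subseteq> outer_edges u v" using plaquette_outer that(5) by blast
    then show ?thesis using that(1) unfolding depends_on_def by blast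
  qed
  have pos: "wsum (\<lambda>_. 1::complex) {} \<noteq> 0" using wsum_empty_pos unfolding wsum_of_real by simp
  consider "D = C1" | "D = C2" | "D \<noteq> C1" "D \<noteq> C2" by blast
  then show ?case
  proof cases
    case 1
    have "wsum (\<lambda>\<sigma>. u1 \<sigma> * u2 \<sigma>) (P \<inter> \<Union>\<T>) * wsum (\<lambda>_. 1) {} = wsum u1 (P \<inter> D) * wsum u2 (P \<inter> \<Union>(\<T> - {D}))"
      unfolding s[symmetric]
      by (rule wsum_split[OF uv g inv(1) inside[OF dep(1)] inv(2) outside[OF dep(2)]])
        (use S C12 1 less.prems cover in blast)+
    then show ?thesis using odd pos by simp
  next
    case 2
    have "wsum (\<lambda>\<sigma>. u2 \<sigma> * u1 \<sigma>) (P \<inter> \<Union>\<T>) * wsum (\<lambda>_. 1) {} = wsum u2 (P \<inter> D) * wsum u1 (P \<inter> \<Union>(\<T> - {D}))"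
      unfolding s[symmetric]
      by (rule wsum_split[OF uv g inv(2) inside[OF dep(2)] inv(1) outside[OF dep(1)]])
        (use S C12 2 less.prems cover in blast)+
    then show ?thesis using odd pos by (simp add: mult.commute)
  next
    case 3
    have d: "depends_on (\<lambda>\<sigma>. u1 \<sigma> * u2 \<sigma>) (outer_edges u v)"
      by (rule depends_on_mult[OF outside[OF dep(1)] outside[OF dep(2)]]) (use S C12 3 less.prems cover in blast)+
    have "wsum (\<lambda>\<sigma>. 1 * (u1 \<sigma> * u2 \<sigma>)) (P \<inter> \<Union>\<T>) * wsum (\<lambda>_. 1) {}
        = wsum (\<lambda>_. 1) (P \<inter> D) * wsum (\<lambda>\<sigma>. u1 \<sigma> * u2 \<sigma>) (P \<inter> \<Union>(\<T> - {D}))"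
      unfolding s[symmetric]
      by (rule wsum_split[OF uv g gauge_inv_const depends_on_const gauge_inv_mult[OF inv] d]) blast
    moreover have "wsum (\<lambda>\<sigma>. u1 \<sigma> * u2 \<sigma>) (P \<inter> \<Union>(\<T> - {D})) = 0"
    proof (rule less.hyps)
      show "card (\<T> - {D}) < card \<T>" using D fin by (rule card_Diff1_less[rotated])
    qed (use less.prems 3 in blast)+
    ultimately show ?thesis using pos by simp
  qed
qed

section \<open>Supports that contribute, and their cores\<close>

text \<open>
  The parts of the support that keep \<open>u1 * u2\<close> from averaging to zero: a knot joining the two rectangles,
  or the union of all knots with more plaquettes than the side \<open>N\<close> of the lattice.
\<close>

definition cores :: "nat \<Rightarrow> plaquette \<Rightarrow> plaquette set set" where
  "cores N p = knots_at a b p \<union> {\<Union>\<S> |\<S>. \<S> \<subseteq> large_knots a b N \<and> \<S> \<noteq> {} \<and> pairwise disjnt \<S>}"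

lemma finite_cores: "finite (cores N p)"
  by (rule finite_subset[of _ "Pow (plaquettes \<Lambda>)"])
    (auto simp: cores_def knots_at_def large_knots_def finite_plaq)

lemma sum_cores:
  assumes "\<And>i. b $ i - a $ i = int N"
  shows "(\<Sum>U\<in>cores N p. (1 / 10 ^ 20 :: real) ^ card U) \<le> 2"
proof -
  let ?F = "{\<Union>\<S> |\<S>. \<S> \<subseteq> large_knots a b N \<and> \<S> \<noteq> {} \<and> pairwise disjnt \<S>}"
  let ?f = "\<lambda>U :: plaquette set. (1 / 10 ^ 20 :: real) ^ card U"
  have fin: "finite (knots_at a b p)" "finite ?F"
    using finite_cores[of N p] unfolding cores_def by simp_all
  have "knots_at a b p = {C \<in> knots_at a b p. Suc 0 \<le> card C}"
    using knot_card_pos by (auto simp: knots_at_def)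
  then have "sum ?f (knots_at a b p) \<le> 2 / 10 ^ 20 * (1 / 10 ^ 7) ^ 0"
    using sum_knots_at[where n = 0 and a = a and b = b and p = p] by simp
  also have "\<dots> \<le> 1" by simp
  finally have 1: "sum ?f (knots_at a b p) \<le> 1" .
  have 2: "sum ?f ?F \<le> 1" by (rule sum_knot_families[OF assms])
  have "sum ?f (cores N p) + sum ?f (knots_at a b p \<inter> ?F) = sum ?f (knots_at a b p) + sum ?f ?F"
    unfolding cores_def by (rule sum.union_inter[OF fin])
  moreover have "0 \<le> sum ?f (knots_at a b p \<inter> ?F)" by (rule sum_nonneg) simp
  ultimately show ?thesis using 1 2 by linarith
qed

text \<open>The knots outside the core also peel off in the absence of the core, so the product of
  their factors is, up to normalisation, the partition function of a single support, namely
  \<open>P\<close> without the core.\<close>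

lemma wsum_core_split:
  assumes dec: "knot_decomposition Q \<P>" and Q: "P \<subseteq> Q" "Q \<subseteq> plaquettes \<Lambda>" and S: "\<S> \<subseteq> \<P>"
    and rest: "pf P = pf (P \<inter> \<Union>\<S>) * (\<Prod>D\<in>\<P> - \<S>. pf (P \<inter> D) / pf {})"
    and small: "\<And>D. D \<in> \<P> - \<S> \<Longrightarrow> small P D"
  shows "pf P * pf {} = pf (P \<inter> \<Union>\<S>) * pf (P - \<Union>\<S>)"
proof -
  have "P - \<Union>\<S> = P \<inter> \<Union>(\<P> - \<S>)"
  proof -
    have "D \<inter> D' = {}" if "D \<in> \<P> - \<S>" "D' \<in> \<S>" for D D'
      using knot_decompositionD(4)[OF dec, of D D'] that S by blast
    moreover have "P \<subseteq> \<Union>\<P>" using knot_decompositionD(2)[OF dec] Q by blast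
    ultimately show ?thesis by blast
  qed
  then have "pf (P - \<Union>\<S>) = pf (P \<inter> \<Union>{}) * (\<Prod>D\<in>\<P> - \<S> - {}. pf (P \<inter> D) / pf {})"
    using wsum_peel_all[OF dec Q(2), of "{}" "\<P> - \<S>" P] small by simp
  then show ?thesis unfolding rest by simp
qed

text \<open>If every knot is small, both rectangles lie in one knot by \<open>wsum_zero\<close>, and
  its passage between them needs \<open>L - 1\<close> excited plaquettes. If not, the large knots
  together form the core; one of them has more excited plaquettes than the side of the lattice,
  which is at least \<open>L\<close>.\<close>

lemma core_exists:
  fixes u1 u2 :: "(edge \<Rightarrow> 'a) \<Rightarrow> complex"
  assumes N: "\<And>i. b $ i - a $ i = int N"
    and S: "{x1..y1} \<subseteq> \<Lambda>" "{x2..y2} \<subseteq> \<Lambda>"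
    and p0: "p0 \<in> plaquettes {x1..y1}" and ne: "plaquettes {x2..y2} \<noteq> {}"
    and L: "1 \<le> L" "L \<le> real_of_int (x2 $ k - y1 $ k) \<or> L \<le> real_of_int (x1 $ k - y2 $ k)"
    and inv: "gauge_inv u1" "gauge_inv u2"
    and dep: "depends_on u1 (edges {x1..y1})" "depends_on u2 (edges {x2..y2})"
    and odd: "\<And>P. wsum u1 P = 0" "\<And>P. wsum u2 P = 0"
    and P: "P \<subseteq> plaquettes \<Lambda>" "wsum (\<lambda>\<sigma>. u1 \<sigma> * u2 \<sigma>) P \<noteq> 0"
  defines "B \<equiv> plaquettes {x1..y1} \<union> plaquettes {x2..y2}"
  shows "\<exists>U\<in>cores N p0. U - B \<subseteq> P \<and> L - 1 \<le> real (card (P \<inter> U)) \<and>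
    pf P * pf {} = pf (P \<inter> U) * pf (P - U)"
proof -
  have ne1: "plaquettes {x1..y1} \<noteq> {}" using p0 by blast
  \<comment> \<open>With its plaquettes added, each rectangle lies in a single knot, which confines
    its observable even where nothing is excited.\<close>
  define Q where "Q = P \<union> B"
  have B: "B \<subseteq> plaquettes \<Lambda>" unfolding B_def using plaquettes_mono S by blast
  have Q: "P \<subseteq> Q" "Q \<subseteq> plaquettes \<Lambda>" using P(1) B by (auto simp: Q_def)
  then have "finite Q" using finite_plaq finite_subset by blast
  then obtain \<P> where dec: "knot_decomposition Q \<P>" using knot_decomposition_exists by blast
  note un = knot_decompositionD(2)[OF dec]
  have finP: "finite P" using P(1) finite_plaq finite_subset by blast
  obtain C1 where C1: "C1 \<in> \<P>" "plaquettes {x1..y1} \<subseteq> C1"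
    using box_in_knot[OF dec _ ne1] by (auto simp: Q_def B_def)
  obtain C2 where C2: "C2 \<in> \<P>" "plaquettes {x2..y2} \<subseteq> C2"
    using box_in_knot[OF dec _ ne] by (auto simp: Q_def B_def)
  have PP: "P \<inter> \<Union>\<P> = P" using un Q by blast
  have knots: "knot D" "D \<subseteq> plaquettes \<Lambda>" "D - B \<subseteq> P" if "D \<in> \<P>" for D
    using knot_decompositionD(3)[OF dec that] un that Q by (auto simp: Q_def)
  have LN: "L \<le> real N"
  proof -
    have "x1 \<in> \<Lambda>" "y1 \<in> \<Lambda>" "x2 \<in> \<Lambda>" "y2 \<in> \<Lambda>"
    proof -
      obtain z i j where "(z, i, j) \<in> plaquettes {x1..y1}" using p0 by (cases p0) auto
      then have "x1 \<le> y1" by (auto simp: plaquettes_iff)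
      obtain z' i' j' where "(z', i', j') \<in> plaquettes {x2..y2}" using ne by (metis ex_in_conv surj_pair)
      then have "x2 \<le> y2" by (auto simp: plaquettes_iff)
      show "x1 \<in> \<Lambda>" "y1 \<in> \<Lambda>" "x2 \<in> \<Lambda>" "y2 \<in> \<Lambda>" using S \<open>x1 \<le> y1\<close> \<open>x2 \<le> y2\<close> by (auto simp del: atLeastatMost_subset_iff)
    qed
    then have "a $ k \<le> y1 $ k" "x2 $ k \<le> b $ k" "a $ k \<le> y2 $ k" "x1 $ k \<le> b $ k" unfolding box_iff by blast+
    then have "x2 $ k - y1 $ k \<le> int N" "x1 $ k - y2 $ k \<le> int N" using N[of k] by linarith+
    then have "real_of_int (x2 $ k - y1 $ k) \<le> real N" "real_of_int (x1 $ k - y2 $ k) \<le> real N" by linarith+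
    then show ?thesis using L(2) by linarith
  qed
  show ?thesis
  proof (cases "\<forall>D\<in>\<P>. small P D")
    case True
    have C12: "C1 = C2"
    proof (rule ccontr)
      assume "C1 \<noteq> C2"
      then have "wsum (\<lambda>\<sigma>. u1 \<sigma> * u2 \<sigma>) (P \<inter> \<Union>\<P>) = 0"
        by (rule wsum_zero[OF dec Q(2) C1(1) C2(1) _ C1(2) C2(2) edge_in_plaquette[OF ne1] edge_in_plaquette[OF ne] inv dep odd])
          (use True C1 C2 in auto)
      then show False using P(2) PP by simp
    qed
    \<comment> \<open>\<open>C1\<close> need not be the largest knot, so it cannot simply be kept
      while the others are peeled. All knots are peeled and its factor is put back.\<close>
    have "pf P = pf (P \<inter> \<Union>{}) * (\<Prod>D\<in>\<P> - {}. pf (P \<inter> D) / pf {})"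
      using wsum_peel_all[OF dec Q(2), of "{}" \<P> P] True unfolding PP by simp
    also have "\<dots> = pf {} * (pf (P \<inter> C1) / pf {} * (\<Prod>D\<in>\<P> - {C1}. pf (P \<inter> D) / pf {}))"
      using prod.remove[OF knot_decompositionD(1)[OF dec] C1(1), of "\<lambda>D. pf (P \<inter> D) / pf {}"] by simp
    also have "\<dots> = pf (P \<inter> \<Union>{C1}) * (\<Prod>D\<in>\<P> - {C1}. pf (P \<inter> D) / pf {})"
      using wsum_empty_pos by simp
    finally have "pf P * pf {} = pf (P \<inter> \<Union>{C1}) * pf (P - \<Union>{C1})"
      by (rule wsum_core_split[OF dec Q, rotated]) (use True C1 in auto)
    moreover have "C1 \<in> cores N p0" using knots[OF C1(1)] C1(2) p0 by (auto simp: cores_def knots_at_def)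
    moreover have "L - 1 \<le> real (card (P \<inter> C1))"
    proof -
      have mid: "real D - 1 \<le> real (card (P \<inter> C1))" if "D - 1 \<le> card (C1 - B)" for D
      proof -
        have "card (C1 - B) \<le> card (P \<inter> C1)" by (rule card_mono) (use finP knots[OF C1(1)] in auto)
        then show ?thesis using that by linarith
      qed
      obtain q2 where q2: "q2 \<in> plaquettes {x2..y2}" using ne by blast
      have bd: "2 * x $ k \<le> cen p $ k" "cen p $ k \<le> 2 * y $ k" if "p \<in> plaquettes {x..y}" for p x y
        using cen_bounds that by (cases p; blast)+
      have inC: "p0 \<in> C1" "q2 \<in> C1" using p0 C1 q2 C2 C12 by blast+
      from L(2) show ?thesis
      proof
        assume l: "L \<le> real_of_int (x2 $ k - y1 $ k)"
        define D where "D = nat (x2 $ k - y1 $ k)"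
        have D: "L \<le> real D" "x2 $ k = y1 $ k + int D" using l L(1) unfolding D_def by linarith+
        have "D - 1 \<le> card (C1 - B)"
        proof (rule knot_crossing[OF knots(1)[OF C1(1)] inC(1) _ inC(2), of k "y1 $ k"])
          show "cen p0 $ k \<le> 2 * y1 $ k" using bd p0 by blast
          show "2 * y1 $ k + 2 * int D \<le> cen q2 $ k" using bd(1)[OF q2] D(2) by linarith
          show "cen r $ k \<le> 2 * y1 $ k \<or> 2 * y1 $ k + 2 * int D \<le> cen r $ k" if "r \<in> B" for r
            using that bd(2)[of r x1 y1] bd(1)[of r x2 y2] D(2) unfolding B_def by auto
        qed
        then show ?thesis using mid D(1) by fastforce
      next
        assume l: "L \<le> real_of_int (x1 $ k - y2 $ k)"
        define D where "D = nat (x1 $ k - y2 $ k)"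
        have D: "L \<le> real D" "x1 $ k = y2 $ k + int D" using l L(1) unfolding D_def by linarith+
        have "D - 1 \<le> card (C1 - B)"
        proof (rule knot_crossing[OF knots(1)[OF C1(1)] inC(2) _ inC(1), of k "y2 $ k"])
          show "cen q2 $ k \<le> 2 * y2 $ k" using bd q2 by blast
          show "2 * y2 $ k + 2 * int D \<le> cen p0 $ k" using bd(1)[OF p0] D(2) by linarith
          show "cen r $ k \<le> 2 * y2 $ k \<or> 2 * y2 $ k + 2 * int D \<le> cen r $ k" if "r \<in> B" for r
            using that bd(2)[of r x2 y2] bd(1)[of r x1 y1] D(2) unfolding B_def by auto
        qed
        then show ?thesis using mid D(1) by fastforce
      qed
    qed
    ultimately show ?thesis using knots(3)[OF C1(1)] by (intro bexI[of _ C1]) auto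
  next
    case False
    then obtain D where D: "D \<in> \<P>" "\<not> small P D" by blast
    then have cD: "Suc N \<le> card (P \<inter> D)" unfolding small_def N by auto
    \<comment> \<open>Size is measured with all plaquettes, as in the order of peeling; the knots
      kept are then larger than all the others.\<close>
    define \<S> where "\<S> = {D \<in> \<P>. Suc N \<le> card D}"
    have "finite D" using knot_finite knots(1)[OF D(1)] by blast
    then have "card (P \<inter> D) \<le> card D" by (intro card_mono) auto
    then have DS: "D \<in> \<S>" using cD D by (simp add: \<S>_def)
    have small: "small P D" if "D \<in> \<P> - \<S>" for D
    proof -
      have "finite D" "card D \<le> N" using that knot_finite knots(1) by (auto simp: \<S>_def)
      then have "card (P \<inter> D) \<le> N" by (meson Int_lower2 card_mono order_trans)
      then show ?thesis unfolding small_def N by simp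
    qed
    have "pf (P \<inter> \<Union>\<P>) = pf (P \<inter> \<Union>\<S>) * (\<Prod>D\<in>\<P> - \<S>. pf (P \<inter> D) / pf {})"
      by (rule wsum_peel_all[OF dec Q(2) _ _ small]) (auto simp: \<S>_def)
    then have "pf P * pf {} = pf (P \<inter> \<Union>\<S>) * pf (P - \<Union>\<S>)"
      unfolding PP by (rule wsum_core_split[OF dec Q, rotated]) (use small in \<open>auto simp: \<S>_def\<close>)
    moreover have "\<Union>\<S> \<in> cores N p0"
    proof -
      have "\<S> \<subseteq> large_knots a b N" using knots by (auto simp: \<S>_def large_knots_def)
      moreover have "pairwise disjnt \<S>"
        using knot_decompositionD(4)[OF dec] unfolding \<S>_def pairwise_def disjnt_def by blast
      ultimately show ?thesis using DS unfolding cores_def by blast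
    qed
    moreover have "L - 1 \<le> real (card (P \<inter> \<Union>\<S>))"
    proof -
      have "card (P \<inter> D) \<le> card (P \<inter> \<Union>\<S>)" by (rule card_mono) (use finP DS in auto)
      then show ?thesis using cD LN by linarith
    qed
    moreover have "\<Union>\<S> - B \<subseteq> P" using knots(3) by (auto simp: \<S>_def)
    ultimately show ?thesis by blast
  qed
qed

section \<open>Summation over supports\<close>

lemma sum_weight:
  fixes F :: "(edge \<Rightarrow> 'a) \<Rightarrow> 'c::real_field"
  shows "(\<Sum>\<sigma>\<in>C. of_real (weight \<sigma>) * F \<sigma>) = (\<Sum>P\<in>Pow (plaquettes \<Lambda>). wsum F P)"
proof -
  have "(\<Sum>P\<in>Pow (plaquettes \<Lambda>). wsum F P)
      = (\<Sum>\<sigma>\<in>C. \<Sum>P\<in>Pow (plaquettes \<Lambda>). of_bool (supp \<sigma> = P) * (of_real (weight \<sigma>) * F \<sigma>))"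
    unfolding wsum_def by (rule sum.swap)
  also have "\<dots> = (\<Sum>\<sigma>\<in>C. of_real (weight \<sigma>) * F \<sigma>)"
  proof (rule sum.cong)
    fix \<sigma>
    have "(\<Sum>P\<in>Pow (plaquettes \<Lambda>). of_bool (supp \<sigma> = P) * (of_real (weight \<sigma>) * F \<sigma>))
        = (\<Sum>P\<in>Pow (plaquettes \<Lambda>). if P = supp \<sigma> then of_real (weight \<sigma>) * F \<sigma> else 0)"
      by (rule sum.cong) auto
    also have "\<dots> = of_real (weight \<sigma>) * F \<sigma>"
      using finite_plaq supp_subset[of \<sigma>] by simp
    finally show "(\<Sum>P\<in>Pow (plaquettes \<Lambda>). of_bool (supp \<sigma> = P) * (of_real (weight \<sigma>) * F \<sigma>)) = of_real (weight \<sigma>) * F \<sigma>" .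
  qed simp
  finally show ?thesis by simp
qed

lemma norm_wsum_le:
  fixes F :: "(edge \<Rightarrow> 'a) \<Rightarrow> complex"
  assumes "\<And>\<sigma>. \<sigma> \<in> C \<Longrightarrow> cmod (F \<sigma>) \<le> M"
  shows "cmod (wsum F P) \<le> M * pf P"
proof -
  have "cmod (wsum F P) \<le> (\<Sum>\<sigma>\<in>C. M * (of_bool (supp \<sigma> = P) * (of_real (weight \<sigma>) * 1)))"
    unfolding wsum_def
  proof (rule sum_norm_le)
    fix \<sigma> assume s: "\<sigma> \<in> C"
    have "weight \<sigma> * cmod (F \<sigma>) \<le> weight \<sigma> * M" by (rule mult_left_mono[OF assms[OF s] weight_nonneg[OF s]])
    then show "cmod (of_bool (supp \<sigma> = P) * (complex_of_real (weight \<sigma>) * F \<sigma>)) \<le> M * (of_bool (supp \<sigma> = P) * (of_real (weight \<sigma>) * 1))"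
      using weight_nonneg[OF s] by (simp add: norm_mult mult.commute)
  qed
  then show ?thesis by (simp add: wsum_def sum_distrib_left)
qed

text \<open>A contributing support is encoded by its core, its part in the core and the rectangles,
  and the rest. Core plaquettes off the rectangles are all excited, so the encoding is injective.
  Summing over the rest restores the full partition function, without a volume factor.\<close>

lemma correlation_bound:
  fixes u1 u2 :: "(edge \<Rightarrow> 'a) \<Rightarrow> complex"
  assumes N: "\<And>i. b $ i - a $ i = int N"
    and S: "{x1..y1} \<subseteq> \<Lambda>" "{x2..y2} \<subseteq> \<Lambda>"
    and ne: "plaquettes {x1..y1} \<noteq> {}" "plaquettes {x2..y2} \<noteq> {}"
    and L: "1 \<le> L" "L \<le> real_of_int (x2 $ k - y1 $ k) \<or> L \<le> real_of_int (x1 $ k - y2 $ k)"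
    and inv: "gauge_inv u1" "gauge_inv u2"
    and dep: "depends_on u1 (edges {x1..y1})" "depends_on u2 (edges {x2..y2})"
    and odd: "\<And>P. wsum u1 P = 0" "\<And>P. wsum u2 P = 0"
    and M: "0 \<le> M" "\<And>\<sigma>. \<sigma> \<in> C \<Longrightarrow> cmod (u1 \<sigma> * u2 \<sigma>) \<le> M"
    and x: "0 \<le> x" "real (card (carrier G)) * \<delta> \<le> 1 / 10 ^ 20 * exp (- x)"
  defines "B \<equiv> plaquettes {x1..y1} \<union> plaquettes {x2..y2}"
  shows "cmod (\<Sum>\<sigma>\<in>C. of_real (weight \<sigma>) * (u1 \<sigma> * u2 \<sigma>))
    \<le> 2 * M * (2 * 10 ^ 20) ^ card B * exp (- x * (L - 1)) * (\<Sum>\<sigma>\<in>C. weight \<sigma>)"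
proof -
  let ?\<Pi> = "plaquettes \<Lambda>" and ?e = "1 / 10 ^ 20 :: real"
  define Z where "Z = (\<Sum>P\<in>Pow ?\<Pi>. pf P)"
  have Z: "Z = (\<Sum>\<sigma>\<in>C. weight \<sigma>)" unfolding Z_def using sum_weight[of "\<lambda>_. 1::real"] by simp
  obtain p0 where p0: "p0 \<in> plaquettes {x1..y1}" using ne by blast
  define Bad where "Bad = {P \<in> Pow ?\<Pi>. wsum (\<lambda>\<sigma>. u1 \<sigma> * u2 \<sigma>) P \<noteq> 0}"
  have "\<forall>P\<in>Bad. \<exists>U\<in>cores N p0. U - B \<subseteq> P \<and> L - 1 \<le> real (card (P \<inter> U)) \<and>
      pf P * pf {} = pf (P \<inter> U) * pf (P - U)"
    unfolding Bad_def B_def using core_exists[OF N S p0 ne(2) L inv dep odd] by blast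
  then obtain U where U: "\<And>P. P \<in> Bad \<Longrightarrow> U P \<in> cores N p0" "\<And>P. P \<in> Bad \<Longrightarrow> U P - B \<subseteq> P"
      "\<And>P. P \<in> Bad \<Longrightarrow> L - 1 \<le> real (card (P \<inter> U P))"
      "\<And>P. P \<in> Bad \<Longrightarrow> pf P * pf {} = pf (P \<inter> U P) * pf (P - U P)"
    by metis
  have finB: "finite B" unfolding B_def by (simp add: finite_plaquettes finite_box)
  \<comment> \<open>A core plaquette in the rectangles need not be excited; the factor
    \<open>10^20\<close> refunds what \<open>?e ^ card (U P)\<close> charges for it.\<close>
  define K where "K = exp (- x * (L - 1)) * (10 ^ 20) ^ card B"
  have K: "0 \<le> K" by (simp add: K_def)
  have each: "pf P \<le> K * ?e ^ card (U P) * pf (P - U P)" if P: "P \<in> Bad" for P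
  proof -
    have sub: "P \<subseteq> ?\<Pi>" using P by (simp add: Bad_def)
    then have finP: "finite P" using finite_plaq finite_subset by blast
    let ?n = "card (P \<inter> U P)" and ?t = "real (card (carrier G)) * \<delta>"
    have t: "0 \<le> ?t" using \<delta>_nonneg by simp
    have "pf P * pf {} \<le> (?t ^ ?n * pf {}) * pf (P - U P)"
      unfolding U(4)[OF P] by (rule mult_right_mono[OF wsum_le wsum_nonneg]) (use sub in blast)
    then have "pf P * pf {} \<le> (?t ^ ?n * pf (P - U P)) * pf {}" by (simp only: ac_simps)
    then have "pf P \<le> ?t ^ ?n * pf (P - U P)" using wsum_empty_pos by (rule mult_right_le_imp_le)
    also have "\<dots> \<le> (K * ?e ^ card (U P)) * pf (P - U P)"
    proof (rule mult_right_mono[OF _ wsum_nonneg])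
      have "?t ^ ?n \<le> (?e * exp (- x)) ^ ?n" by (rule power_mono[OF x(2) t])
      also have "\<dots> = exp (- x * real ?n) * ?e ^ ?n"
      proof -
        have "exp (- x * real ?n) = exp (- x) ^ ?n" using exp_of_nat_mult[of ?n "- x"] by (simp add: mult.commute)
        then show ?thesis by (simp only: power_mult_distrib mult.commute)
      qed
      also have "\<dots> \<le> exp (- x * (L - 1)) * ((10 ^ 20) ^ card B * ?e ^ card (U P))"
      proof (rule mult_mono)
        show "exp (- x * real ?n) \<le> exp (- x * (L - 1))"
          using mult_left_mono[OF U(3)[OF P] x(1)] by simp
        have "card (U P) \<le> card (P \<inter> U P \<union> B)" by (rule card_mono) (use finP finB U(2)[OF P] in auto)
        also have "\<dots> \<le> ?n + card B" by (rule card_Un_le)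
        finally have "?e ^ (?n + card B) \<le> ?e ^ card (U P)" by (rule power_decreasing) auto
        then have m1: "(10 ^ 20) ^ card B * ?e ^ (?n + card B) \<le> (10 ^ 20) ^ card B * ?e ^ card (U P)"
          by (rule mult_left_mono) simp
        have m2: "(10 ^ 20) ^ card B * ?e ^ (?n + card B) = ?e ^ ?n"
          by (simp add: power_add power_divide)
        show "?e ^ ?n \<le> (10 ^ 20) ^ card B * ?e ^ card (U P)" by (rule m1[unfolded m2])
      qed auto
      finally show "?t ^ ?n \<le> K * ?e ^ card (U P)" by (simp only: K_def mult.assoc)
    qed
    finally show ?thesis .
  qed
  define \<phi> where "\<phi> P = (U P, P \<inter> U P \<inter> B, P - U P)" for P
  have inj: "inj_on \<phi> Bad"
  proof (rule inj_onI)
    fix P P' assume PP: "P \<in> Bad" "P' \<in> Bad" "\<phi> P = \<phi> P'"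
    have rec: "P = (U P - B) \<union> (P \<inter> U P \<inter> B) \<union> (P - U P)" if "P \<in> Bad" for P
      using U(2)[OF that] by blast
    have e: "U P = U P'" "P \<inter> U P \<inter> B = P' \<inter> U P' \<inter> B" "P - U P = P' - U P'"
      using PP(3) unfolding \<phi>_def prod.inject by blast+
    have "P = (U P - B) \<union> (P \<inter> U P \<inter> B) \<union> (P - U P)" by (rule rec[OF PP(1)])
    also have "\<dots> = (U P' - B) \<union> (P' \<inter> U P' \<inter> B) \<union> (P' - U P')" by (simp only: e(1) e(2,3)[unfolded e(1)])
    also have "\<dots> = P'" by (rule rec[OF PP(2), symmetric])
    finally show "P = P'" .
  qed
  have "(\<Sum>P\<in>Bad. pf P) \<le> (\<Sum>P\<in>Bad. K * ?e ^ card (U P) * pf (P - U P))" by (rule sum_mono[OF each])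
  also have "\<dots> = (\<Sum>(V, A, R)\<in>\<phi> ` Bad. K * ?e ^ card V * pf R)"
    unfolding sum.reindex[OF inj] by (simp add: \<phi>_def)
  also have "\<dots> \<le> (\<Sum>(V, A, R)\<in>cores N p0 \<times> Pow B \<times> Pow ?\<Pi>. K * ?e ^ card V * pf R)"
  proof (rule sum_mono2)
    show "finite (cores N p0 \<times> Pow B \<times> Pow ?\<Pi>)" using finite_cores finB finite_plaq by simp
    show "\<phi> ` Bad \<subseteq> cores N p0 \<times> Pow B \<times> Pow ?\<Pi>"
      using U(1) by (auto simp: \<phi>_def Bad_def)
    fix z assume "z \<in> cores N p0 \<times> Pow B \<times> Pow ?\<Pi> - \<phi> ` Bad"
    show "0 \<le> (case z of (V, A, R) \<Rightarrow> K * ?e ^ card V * pf R)"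
      using K wsum_nonneg by (simp add: case_prod_beta)
  qed
  also have "\<dots> = (\<Sum>V\<in>cores N p0. \<Sum>A\<in>Pow B. \<Sum>R\<in>Pow ?\<Pi>. K * ?e ^ card V * pf R)"
    by (simp only: sum.cartesian_product)
  also have "\<dots> = K * 2 ^ card B * Z * (\<Sum>V\<in>cores N p0. ?e ^ card V)"
  proof -
    have inner: "(\<Sum>A\<in>Pow B. \<Sum>R\<in>Pow ?\<Pi>. K * ?e ^ card V * pf R) = K * 2 ^ card B * Z * ?e ^ card V" for V
    proof -
      have "(\<Sum>R\<in>Pow ?\<Pi>. K * ?e ^ card V * pf R) = K * ?e ^ card V * Z"
        unfolding Z_def by (rule sum_distrib_left[symmetric])
      then show ?thesis by (simp add: card_Pow[OF finB])
    qed
    show ?thesis unfolding sum_distrib_left by (intro sum.cong refl inner[unfolded sum_distrib_left])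
  qed
  also have "\<dots> \<le> K * 2 ^ card B * Z * 2"
  proof (rule mult_left_mono[OF sum_cores[OF N]])
    have "0 \<le> Z" unfolding Z_def by (intro sum_nonneg wsum_nonneg)
    then show "0 \<le> K * 2 ^ card B * Z" using K by simp
  qed
  finally have bad: "(\<Sum>P\<in>Bad. pf P) \<le> K * 2 ^ card B * Z * 2" .
  have "cmod (\<Sum>\<sigma>\<in>C. of_real (weight \<sigma>) * (u1 \<sigma> * u2 \<sigma>)) = cmod (\<Sum>P\<in>Pow ?\<Pi>. wsum (\<lambda>\<sigma>. u1 \<sigma> * u2 \<sigma>) P)"
    by (simp only: sum_weight)
  also have "(\<Sum>P\<in>Pow ?\<Pi>. wsum (\<lambda>\<sigma>. u1 \<sigma> * u2 \<sigma>) P) = (\<Sum>P\<in>Bad. wsum (\<lambda>\<sigma>. u1 \<sigma> * u2 \<sigma>) P)"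
    by (rule sum.mono_neutral_right) (auto simp: Bad_def finite_plaq)
  also have "cmod \<dots> \<le> (\<Sum>P\<in>Bad. M * pf P)" by (rule sum_norm_le) (rule norm_wsum_le[OF M(2)])
  also have "\<dots> = M * (\<Sum>P\<in>Bad. pf P)" by (simp add: sum_distrib_left)
  also have "\<dots> \<le> M * (K * 2 ^ card B * Z * 2)" by (rule mult_left_mono[OF bad M(1)])
  also have "\<dots> = 2 * M * ((2 ^ card B) * (10 ^ 20) ^ card B) * exp (- x * (L - 1)) * Z" by (simp only: K_def ac_simps)
  also have "(2 ^ card B) * (10 ^ 20) ^ card B = (2 * 10 ^ 20 :: real) ^ card B" by (rule power_mult_distrib[symmetric])
  finally show ?thesis by (simp only: Z)
qed

end

section \<open>Pairs of fields\<close>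

text \<open>Unnormalised, so that the division by the partition function is postponed to
  \<open>Cov_eq\<close>.\<close>

lemma covariance_double_sum:
  fixes w :: "'s \<Rightarrow> complex"
  shows "(\<Sum>\<sigma>\<in>A. \<Sum>\<tau>\<in>A. w \<sigma> * w \<tau> * ((X \<sigma> - X \<tau>) * (Y \<sigma> - Y \<tau>)))
    = 2 * (sum w A * (\<Sum>\<sigma>\<in>A. w \<sigma> * (X \<sigma> * Y \<sigma>)) - (\<Sum>\<sigma>\<in>A. w \<sigma> * X \<sigma>) * (\<Sum>\<sigma>\<in>A. w \<sigma> * Y \<sigma>))"
proof -
  have prod: "(\<Sum>\<sigma>\<in>A. \<Sum>\<tau>\<in>A. f \<sigma> * g \<tau>) = sum f A * sum g A" for f g :: "'s \<Rightarrow> complex"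
    by (rule sum_product[symmetric])
  have "(\<Sum>\<sigma>\<in>A. \<Sum>\<tau>\<in>A. w \<sigma> * w \<tau> * ((X \<sigma> - X \<tau>) * (Y \<sigma> - Y \<tau>)))
      = (\<Sum>\<sigma>\<in>A. \<Sum>\<tau>\<in>A. (w \<sigma> * (X \<sigma> * Y \<sigma>)) * w \<tau> + w \<sigma> * (w \<tau> * (X \<tau> * Y \<tau>))
          - (w \<sigma> * X \<sigma>) * (w \<tau> * Y \<tau>) - (w \<sigma> * Y \<sigma>) * (w \<tau> * X \<tau>))"
    by (intro sum.cong refl) (simp add: algebra_simps)
  then show ?thesis unfolding sum_subtractf sum.distrib prod by (simp add: algebra_simps)
qed

section \<open>Fields with values in the squared group\<close>

definition left :: "site set \<Rightarrow> (edge \<Rightarrow> 'g \<times> 'g) \<Rightarrow> edge \<Rightarrow> 'g" where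
  "left S \<zeta> = (\<lambda>e\<in>edges S. fst (\<zeta> e))"

definition right :: "site set \<Rightarrow> (edge \<Rightarrow> 'g \<times> 'g) \<Rightarrow> edge \<Rightarrow> 'g" where
  "right S \<zeta> = (\<lambda>e\<in>edges S. snd (\<zeta> e))"

context group
begin

lemma holonomy_DirProd:
  assumes "set es \<subseteq> oriented_edges S" "\<And>e. e \<in> edges S \<Longrightarrow> \<zeta> e \<in> carrier G \<times> carrier G"
  shows "holonomy (G \<times>\<times> G) \<zeta> es = (holonomy G (left S \<zeta>) es, holonomy G (right S \<zeta>) es)"
proof -
  have "edge_value (G \<times>\<times> G) \<zeta> e = (edge_value G (left S \<zeta>) e, edge_value G (right S \<zeta>) e)"
    if "e \<in> oriented_edges S" for e
    using that
  proof (cases rule: oriented_edgesE)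
    case 1
    then have "e \<in> edges UNIV" using edges_mono by blast
    then show ?thesis using 1 by (simp add: edge_value_def left_def right_def)
  next
    case 2
    obtain g h where gh: "\<zeta> (snd e, fst e) = (g, h)" by (cases "\<zeta> (snd e, fst e)")
    then have "g \<in> carrier G" "h \<in> carrier G" using assms(2)[OF 2(2)] by auto
    then show ?thesis using 2 gh inv_DirProd[OF is_group is_group]
      by (simp add: edge_value_def left_def right_def)
  qed
  then show ?thesis using assms(1) unfolding holonomy_def by (induction es) auto
qed

text \<open>Each loop is conjugated by the value at its own starting vertex, which is where
  invariance under independent conjugations enters. Inverse values are supplied because the
  definition conjugates as \<open>h^-1 g h\<close>.\<close>

lemma wilson_gauge:
  assumes f: "conjugacy_invariant G (length \<gamma>) f" and loops: "\<And>es. es \<in> set \<gamma> \<Longrightarrow> closed_loop S es"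
    and \<sigma>: "\<sigma> \<in> configs G S" and h: "h \<in> UNIV \<rightarrow> carrier G"
  shows "f (map (holonomy G (gauge G S h \<sigma>)) \<gamma>) = f (map (holonomy G \<sigma>) \<gamma>)"
proof -
  have hc[simp]: "h x \<in> carrier G" for x using h by auto
  have s: "\<sigma> e \<in> carrier G" if "e \<in> edges S" for e using \<sigma> that by (auto simp: configs_def)
  let ?x = "\<lambda>es :: edge list. fst (hd es)"
  have hol: "holonomy G \<sigma> es \<in> carrier G" if "es \<in> set \<gamma>" for es
    by (rule holonomy_closed[OF closed_loop_chain(2)[OF loops[OF that]] s])
  have tr: "holonomy G (gauge G S h \<sigma>) es = h (?x es) \<otimes> holonomy G \<sigma> es \<otimes> inv h (?x es)" if "es \<in> set \<gamma>" for es
    by (rule holonomy_transport[OF closed_loop_chain(2,1)[OF loops[OF that]] s h]) (simp_all add: gauge_def)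
  have m: "map2 (\<lambda>g h. inv h \<otimes> g \<otimes> h) (map (holonomy G \<sigma>) \<gamma>) (map (\<lambda>es. inv h (?x es)) \<gamma>)
      = map (holonomy G (gauge G S h \<sigma>)) \<gamma>"
    unfolding map2_map_map by (rule map_cong) (simp_all add: tr)
  have "map (holonomy G \<sigma>) \<gamma> \<in> tuples G (length \<gamma>)" "map (\<lambda>es. inv h (?x es)) \<gamma> \<in> tuples G (length \<gamma>)"
    using hol by (auto simp: tuples_def)
  then have "f (map2 (\<lambda>g h. inv h \<otimes> g \<otimes> h) (map (holonomy G \<sigma>) \<gamma>) (map (\<lambda>es. inv h (?x es)) \<gamma>))
      = f (map (holonomy G \<sigma>) \<gamma>)"
    using f unfolding conjugacy_invariant_def by blast
  then show ?thesis unfolding m .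
qed

end

lemma norm_le_sup_norm:
  assumes "finite (carrier G)" "gs \<in> tuples G k"
  shows "cmod (f gs) \<le> sup_norm G k f"
proof -
  have "tuples G k = {xs. set xs \<subseteq> carrier G \<and> length xs = k}" by (auto simp: tuples_def)
  then have "finite (tuples G k)" using finite_lists_length_eq[OF assms(1)] by metis
  then show ?thesis unfolding sup_norm_def by (intro cSUP_upper assms(2)) (simp add: bdd_above_finite)
qed

locale lattice_yang_mills = group G for G (structure) +
  fixes \<rho> :: "'a \<Rightarrow> complex^'n^'n" and a b :: site and \<beta> :: real
  assumes fin_G: "finite (carrier G)"
    and rep: "unitary_rep G \<rho>"
    and gap_pos: "0 < gap G \<rho>"
    and a_le_b: "a \<le> b"
    and \<beta>_nonneg: "0 \<le> \<beta>"
begin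

abbreviation Lat :: "site set" where "Lat \<equiv> {a..b}"

definition energy :: "'a \<Rightarrow> real" where
  "energy g = Re (character \<rho> \<one> - character \<rho> g)"

definition pair_weight :: "'a \<times> 'a \<Rightarrow> real" where
  "pair_weight gh = exp (- \<beta> * energy (fst gh)) * exp (- \<beta> * energy (snd gh))"

lemma energy_one: "energy \<one> = 0"
  by (simp add: energy_def)

lemma energy_conj:
  assumes "g \<in> carrier G" "h \<in> carrier G"
  shows "energy (h \<otimes> g \<otimes> inv h) = energy g"
proof -
  have mult: "\<rho> (x \<otimes> y) = \<rho> x ** \<rho> y" if "x \<in> carrier G" "y \<in> carrier G" for x y
    using rep that by (auto simp: unitary_rep_def)
  have "\<rho> (h \<otimes> g \<otimes> inv h) = \<rho> (h \<otimes> g) ** \<rho> (inv h)" by (rule mult) (use assms in simp_all)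
  then have "trace (\<rho> (h \<otimes> g \<otimes> inv h)) = trace (\<rho> (inv h) ** \<rho> (h \<otimes> g))"
    by (simp only: trace_mul_sym[of "\<rho> (h \<otimes> g)"])
  also have "\<rho> (inv h) ** \<rho> (h \<otimes> g) = \<rho> (inv h \<otimes> (h \<otimes> g))"
    by (rule mult[symmetric]) (use assms in simp_all)
  also have "inv h \<otimes> (h \<otimes> g) = g" using assms by (simp add: m_assoc[symmetric])
  finally show ?thesis by (simp add: energy_def character_def)
qed

lemma gap_le_energy: "g \<in> carrier G \<Longrightarrow> g \<noteq> \<one> \<Longrightarrow> gap G \<rho> \<le> energy g"
  unfolding gap_def energy_def by (rule Min_le) (use fin_G in auto)

lemma energy_nonneg: "g \<in> carrier G \<Longrightarrow> 0 \<le> energy g"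
  using gap_le_energy[of g] gap_pos energy_one by (cases "g = \<one>") auto

sublocale pair: gauge_theory "G \<times>\<times> G" a b pair_weight "exp (- \<beta> * gap G \<rho>)"
proof (rule gauge_theory.intro)
  show "group (G \<times>\<times> G)" by (rule DirProd_group[OF is_group is_group])
  show "gauge_theory_axioms (G \<times>\<times> G) a b pair_weight (exp (- \<beta> * gap G \<rho>))"
  proof
    show "finite (carrier (G \<times>\<times> G))" using fin_G by simp
    show "pair_weight \<one>\<^bsub>G \<times>\<times> G\<^esub> = 1" by (simp add: pair_weight_def energy_one)
    fix g assume g: "g \<in> carrier (G \<times>\<times> G)"
    show "0 \<le> pair_weight g" by (simp add: pair_weight_def)
    show "pair_weight (h \<otimes>\<^bsub>G \<times>\<times> G\<^esub> g \<otimes>\<^bsub>G \<times>\<times> G\<^esub> inv\<^bsub>G \<times>\<times> G\<^esub> h) = pair_weight g" if "h \<in> carrier (G \<times>\<times> G)" for h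
      using g that by (cases g; cases h) (simp add: pair_weight_def energy_conj inv_DirProd[OF is_group is_group])
    \<comment> \<open>One excited copy already costs the gap, and the energy of the other is
      nonnegative.\<close>
    show "pair_weight g \<le> exp (- \<beta> * gap G \<rho>)" if "g \<noteq> \<one>\<^bsub>G \<times>\<times> G\<^esub>"
    proof -
      obtain g1 g2 where g12: "g = (g1, g2)" by (cases g)
      have c: "g1 \<in> carrier G" "g2 \<in> carrier G" "g1 \<noteq> \<one> \<or> g2 \<noteq> \<one>" using g that g12 by auto
      have "gap G \<rho> \<le> energy g1 + energy g2"
        using c gap_le_energy[of g1] gap_le_energy[of g2] energy_nonneg[of g1] energy_nonneg[of g2] by fastforce
      then have "\<beta> * gap G \<rho> \<le> \<beta> * (energy g1 + energy g2)" by (rule mult_left_mono[OF _ \<beta>_nonneg])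
      then show ?thesis by (simp add: g12 pair_weight_def algebra_simps flip: exp_add)
    qed
  qed (use a_le_b in auto)
qed

abbreviation Conf :: "(edge \<Rightarrow> 'a) set" where "Conf \<equiv> configs G Lat"

abbreviation boltzmann :: "(edge \<Rightarrow> 'a) \<Rightarrow> real" where "boltzmann \<sigma> \<equiv> exp (- \<beta> * action G \<rho> Lat \<sigma>)"

definition join :: "(edge \<Rightarrow> 'a) \<Rightarrow> (edge \<Rightarrow> 'a) \<Rightarrow> edge \<Rightarrow> 'a \<times> 'a" where
  "join \<sigma> \<tau> = (\<lambda>e\<in>edges Lat. (\<sigma> e, \<tau> e))"

lemma finite_Conf: "finite Conf"
  unfolding configs_def by (intro finite_PiE finite_edges finite_box fin_G)

lemma join_in: "\<sigma> \<in> Conf \<Longrightarrow> \<tau> \<in> Conf \<Longrightarrow> join \<sigma> \<tau> \<in> pair.C"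
  by (auto simp: join_def configs_def)

lemma left_right_in: "\<zeta> \<in> pair.C \<Longrightarrow> left Lat \<zeta> \<in> Conf" "\<zeta> \<in> pair.C \<Longrightarrow> right Lat \<zeta> \<in> Conf"
  unfolding configs_def left_def right_def by (auto simp: PiE_iff mem_Times_iff)

lemma left_join: "\<sigma> \<in> Conf \<Longrightarrow> left Lat (join \<sigma> \<tau>) = \<sigma>"
  unfolding configs_def left_def join_def by (rule ext) (auto simp: PiE_iff extensional_def)

lemma right_join: "\<tau> \<in> Conf \<Longrightarrow> right Lat (join \<sigma> \<tau>) = \<tau>"
  unfolding configs_def right_def join_def by (rule ext) (auto simp: PiE_iff extensional_def)

lemma join_left_right: "\<zeta> \<in> pair.C \<Longrightarrow> join (left Lat \<zeta>) (right Lat \<zeta>) = \<zeta>"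
  unfolding configs_def left_def right_def join_def by (rule ext) (auto simp: PiE_iff extensional_def)

lemma sum_pair: "(\<Sum>\<zeta>\<in>pair.C. F \<zeta>) = (\<Sum>\<sigma>\<in>Conf. \<Sum>\<tau>\<in>Conf. F (join \<sigma> \<tau>))"
proof -
  have "(\<Sum>\<zeta>\<in>pair.C. F \<zeta>) = (\<Sum>(\<sigma>, \<tau>)\<in>Conf \<times> Conf. F (join \<sigma> \<tau>))"
    by (rule sum.reindex_bij_witness[of _ "\<lambda>(\<sigma>, \<tau>). join \<sigma> \<tau>" "\<lambda>\<zeta>. (left Lat \<zeta>, right Lat \<zeta>)"])
      (auto simp: join_left_right left_right_in left_join right_join join_in)
  then show ?thesis by (simp add: sum.cartesian_product)
qed

lemma pair_holonomy:
  assumes "\<zeta> \<in> pair.C" "set es \<subseteq> oriented_edges Lat"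
  shows "holonomy (G \<times>\<times> G) \<zeta> es = (holonomy G (left Lat \<zeta>) es, holonomy G (right Lat \<zeta>) es)"
  by (rule holonomy_DirProd[OF assms(2)]) (use pair.CD[OF assms(1)] in simp)

lemma pair_weight_eq:
  assumes "\<zeta> \<in> pair.C"
  shows "pair.weight \<zeta> = boltzmann (left Lat \<zeta>) * boltzmann (right Lat \<zeta>)"
proof -
  have "pair.weight \<zeta> = (\<Prod>p\<in>plaquettes Lat. exp (- \<beta> * energy (holonomy G (left Lat \<zeta>) (boundary p)))
      * exp (- \<beta> * energy (holonomy G (right Lat \<zeta>) (boundary p))))"
    unfolding pair.weight_def
    by (rule prod.cong) (simp_all add: pair_holonomy[OF assms boundary_oriented] pair_weight_def)
  then show ?thesis
    by (simp add: prod.distrib action_def energy_def sum_distrib_left exp_sum pair.finite_plaq)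
qed

definition swap :: "(edge \<Rightarrow> 'a \<times> 'a) \<Rightarrow> edge \<Rightarrow> 'a \<times> 'a" where
  "swap \<zeta> = join (right Lat \<zeta>) (left Lat \<zeta>)"

lemma swap:
  assumes "\<zeta> \<in> pair.C"
  shows "swap \<zeta> \<in> pair.C" "swap (swap \<zeta>) = \<zeta>" "left Lat (swap \<zeta>) = right Lat \<zeta>" "right Lat (swap \<zeta>) = left Lat \<zeta>"
    "pair.weight (swap \<zeta>) = pair.weight \<zeta>" "pair.supp (swap \<zeta>) = pair.supp \<zeta>"
proof -
  note lr = left_right_in[OF assms]
  show s: "swap \<zeta> \<in> pair.C" unfolding swap_def using lr join_in by blast
  show l: "left Lat (swap \<zeta>) = right Lat \<zeta>" and r: "right Lat (swap \<zeta>) = left Lat \<zeta>"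
    unfolding swap_def using lr by (simp_all add: left_join right_join)
  show "swap (swap \<zeta>) = \<zeta>" unfolding swap_def[of "swap \<zeta>"] l r by (rule join_left_right[OF assms])
  show "pair.weight (swap \<zeta>) = pair.weight \<zeta>"
    unfolding pair_weight_eq[OF s] pair_weight_eq[OF assms] l r by (rule mult.commute)
  show "pair.supp (swap \<zeta>) = pair.supp \<zeta>"
    unfolding pair.supp_def
    using pair_holonomy[OF s boundary_oriented] pair_holonomy[OF assms boundary_oriented] l r by auto
qed

definition difference :: "((edge \<Rightarrow> 'a) \<Rightarrow> complex) \<Rightarrow> (edge \<Rightarrow> 'a \<times> 'a) \<Rightarrow> complex" where
  "difference F \<zeta> = F (left Lat \<zeta>) - F (right Lat \<zeta>)"

text \<open>Exchanging the copies preserves weight and support and reverses the sign, so the sum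
  vanishes for each support separately.\<close>

lemma wsum_difference: "pair.wsum (difference F) P = 0"
proof -
  have "pair.wsum (difference F) P = pair.wsum (\<lambda>\<zeta>. - difference F \<zeta>) P"
    unfolding pair.wsum_def
    by (rule sum.reindex_bij_witness[of _ swap swap]) (simp_all add: swap difference_def)
  also have "\<dots> = - pair.wsum (difference F) P" by (simp add: pair.wsum_def sum_negf)
  finally show ?thesis by simp
qed

lemma difference_gauge_inv:
  assumes "\<And>\<sigma> h. \<sigma> \<in> Conf \<Longrightarrow> h \<in> UNIV \<rightarrow> carrier G \<Longrightarrow> F (gauge G Lat h \<sigma>) = F \<sigma>"
  shows "pair.gauge_inv (difference F)"
  unfolding pair.gauge_inv_def
proof (intro ballI)
  fix \<zeta> and h :: "site \<Rightarrow> 'a \<times> 'a"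
  assume z: "\<zeta> \<in> pair.C" and h: "h \<in> UNIV \<rightarrow> carrier (G \<times>\<times> G)"
  have hc: "fst (h x) \<in> carrier G" "snd (h x) \<in> carrier G" for x using h by (auto simp: Pi_iff mem_Times_iff)
  have i: "inv\<^bsub>G \<times>\<times> G\<^esub> h x = (inv fst (h x), inv snd (h x))" for x
    using inv_DirProd[OF is_group is_group hc(1)[of x] hc(2)[of x]] by simp
  have "left Lat (gauge (G \<times>\<times> G) Lat h \<zeta>) = gauge G Lat (fst \<circ> h) (left Lat \<zeta>)"
    "right Lat (gauge (G \<times>\<times> G) Lat h \<zeta>) = gauge G Lat (snd \<circ> h) (right Lat \<zeta>)"
    unfolding left_def right_def gauge_def by (rule ext; simp add: mult_DirProd' i)+
  moreover have "fst \<circ> h \<in> UNIV \<rightarrow> carrier G" "snd \<circ> h \<in> UNIV \<rightarrow> carrier G" using hc by auto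
  ultimately show "difference F (gauge (G \<times>\<times> G) Lat h \<zeta>) = difference F \<zeta>"
    unfolding difference_def using assms left_right_in[OF z] by simp
qed

lemma difference_depends_on:
  assumes "D \<subseteq> edges Lat" "\<And>\<sigma> \<tau>. (\<And>e. e \<in> D \<Longrightarrow> \<sigma> e = \<tau> e) \<Longrightarrow> F \<sigma> = F \<tau>"
  shows "pair.depends_on (difference F) D"
  unfolding pair.depends_on_def
proof (intro ballI impI)
  fix \<zeta> \<xi> :: "edge \<Rightarrow> 'a \<times> 'a" assume "\<forall>e\<in>D. \<zeta> e = \<xi> e"
  then have "F (left Lat \<zeta>) = F (left Lat \<xi>)" "F (right Lat \<zeta>) = F (right Lat \<xi>)"
    by (intro assms(2); simp add: left_def right_def)+
  then show "difference F \<zeta> = difference F \<xi>" by (simp add: difference_def)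
qed

section \<open>Covariances as sums over pairs of fields\<close>

lemma partition_fun_pos: "0 < partition_fun G \<rho> Lat \<beta>"
proof -
  have "(\<lambda>e\<in>edges Lat. \<one>) \<in> Conf" by (auto simp: configs_def)
  then have "Conf \<noteq> {}" by blast
  then show ?thesis unfolding partition_fun_def by (intro sum_pos finite_Conf) auto
qed

lemma sum_pair_weight: "(\<Sum>\<zeta>\<in>pair.C. pair.weight \<zeta>) = (partition_fun G \<rho> Lat \<beta>)\<^sup>2"
proof -
  have "(\<Sum>\<zeta>\<in>pair.C. pair.weight \<zeta>) = (\<Sum>\<sigma>\<in>Conf. \<Sum>\<tau>\<in>Conf. boltzmann \<sigma> * boltzmann \<tau>)"
    unfolding sum_pair by (intro sum.cong refl) (simp add: pair_weight_eq join_in left_join right_join)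
  then show ?thesis unfolding partition_fun_def power2_eq_square sum_product by simp
qed

lemma sum_pair_difference:
  "(\<Sum>\<zeta>\<in>pair.C. of_real (pair.weight \<zeta>) * (difference X \<zeta> * difference Y \<zeta>))
    = 2 * (of_real (partition_fun G \<rho> Lat \<beta>) * (\<Sum>\<sigma>\<in>Conf. of_real (boltzmann \<sigma>) * (X \<sigma> * Y \<sigma>))
        - (\<Sum>\<sigma>\<in>Conf. of_real (boltzmann \<sigma>) * X \<sigma>) * (\<Sum>\<sigma>\<in>Conf. of_real (boltzmann \<sigma>) * Y \<sigma>))"
proof -
  have "(\<Sum>\<zeta>\<in>pair.C. of_real (pair.weight \<zeta>) * (difference X \<zeta> * difference Y \<zeta>))
      = (\<Sum>\<sigma>\<in>Conf. \<Sum>\<tau>\<in>Conf. complex_of_real (boltzmann \<sigma>) * of_real (boltzmann \<tau>) * ((X \<sigma> - X \<tau>) * (Y \<sigma> - Y \<tau>)))"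
    unfolding sum_pair
    by (intro sum.cong refl) (simp add: pair_weight_eq join_in left_join right_join difference_def)
  then show ?thesis unfolding covariance_double_sum partition_fun_def of_real_sum .
qed

lemma expectation_eq:
  fixes X :: "(edge \<Rightarrow> 'a) \<Rightarrow> complex"
  assumes \<Sigma>: "\<Sigma> \<in> M \<rightarrow>\<^sub>M count_space Conf"
    and law: "distr M (count_space Conf) \<Sigma> = gauge_measure G \<rho> Lat \<beta>"
  shows "(\<integral>\<omega>. X (\<Sigma> \<omega>) \<partial>M) = (\<Sum>\<sigma>\<in>Conf. of_real (boltzmann \<sigma>) * X \<sigma>) / of_real (partition_fun G \<rho> Lat \<beta>)"
proof -
  have "(\<integral>\<omega>. X (\<Sigma> \<omega>) \<partial>M) = (\<integral>\<sigma>. X \<sigma> \<partial>distr M (count_space Conf) \<Sigma>)"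
    by (rule integral_distr[OF \<Sigma>, symmetric]) simp
  also have "\<dots> = (\<Sum>\<sigma>\<in>Conf. (boltzmann \<sigma> / partition_fun G \<rho> Lat \<beta>) *\<^sub>R X \<sigma>)"
    unfolding law gauge_measure_def
    by (rule lebesgue_integral_point_measure_finite[OF finite_Conf]) (use partition_fun_pos in simp)
  finally show ?thesis by (simp add: scaleR_conv_of_real sum_divide_distrib)
qed

lemma Cov_eq:
  fixes X Y :: "(edge \<Rightarrow> 'a) \<Rightarrow> complex"
  assumes "\<Sigma> \<in> M \<rightarrow>\<^sub>M count_space Conf" "distr M (count_space Conf) \<Sigma> = gauge_measure G \<rho> Lat \<beta>"
  shows "Cov M (\<lambda>\<omega>. X (\<Sigma> \<omega>)) (\<lambda>\<omega>. Y (\<Sigma> \<omega>))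
    = (\<Sum>\<zeta>\<in>pair.C. of_real (pair.weight \<zeta>) * (difference X \<zeta> * difference Y \<zeta>)) / of_real (2 * (partition_fun G \<rho> Lat \<beta>)\<^sup>2)"
proof -
  have "complex_of_real (partition_fun G \<rho> Lat \<beta>) \<noteq> 0" using partition_fun_pos by simp
  then show ?thesis
    unfolding Cov_def expectation_eq[OF assms] expectation_eq[OF assms, of "\<lambda>\<sigma>. X \<sigma> * Y \<sigma>"] sum_pair_difference
    by (simp add: field_simps power2_eq_square)
qed

lemma difference_bound:
  assumes "\<And>\<sigma>. \<sigma> \<in> Conf \<Longrightarrow> cmod (X \<sigma>) \<le> m" "\<And>\<sigma>. \<sigma> \<in> Conf \<Longrightarrow> cmod (Y \<sigma>) \<le> n" "\<zeta> \<in> pair.C"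
  shows "cmod (difference X \<zeta> * difference Y \<zeta>) \<le> 4 * m * n"
proof -
  note lr = left_right_in[OF assms(3)]
  have "cmod (difference X \<zeta>) \<le> 2 * m"
    unfolding difference_def using norm_triangle_ineq4[of "X (left Lat \<zeta>)" "X (right Lat \<zeta>)"] assms(1)[OF lr(1)] assms(1)[OF lr(2)] by linarith
  moreover have "cmod (difference Y \<zeta>) \<le> 2 * n"
    unfolding difference_def using norm_triangle_ineq4[of "Y (left Lat \<zeta>)" "Y (right Lat \<zeta>)"] assms(2)[OF lr(1)] assms(2)[OF lr(2)] by linarith
  ultimately have "cmod (difference X \<zeta>) * cmod (difference Y \<zeta>) \<le> (2 * m) * (2 * n)"
    by (intro mult_mono') auto
  then show ?thesis by (simp add: norm_mult)
qed

lemma wilson_le_sup_norm: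
  assumes "\<And>es. es \<in> set \<gamma> \<Longrightarrow> closed_loop S es" "S \<subseteq> Lat" "\<sigma> \<in> Conf"
  shows "cmod (f (map (holonomy G \<sigma>) \<gamma>)) \<le> sup_norm G (length \<gamma>) f"
proof -
  have "holonomy G \<sigma> es \<in> carrier G" if "es \<in> set \<gamma>" for es
  proof (rule holonomy_closed)
    show "set es \<subseteq> oriented_edges Lat"
      using closed_loop_chain(2)[OF assms(1)[OF that]] oriented_edges_mono[OF assms(2)] by blast
    show "\<sigma> e \<in> carrier G" if "e \<in> edges Lat" for e using assms(3) that by (auto simp: configs_def)
  qed
  then have "map (holonomy G \<sigma>) \<gamma> \<in> tuples G (length \<gamma>)" by (auto simp: tuples_def)
  then show ?thesis by (rule norm_le_sup_norm[OF fin_G])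
qed

lemma sup_norm_nonneg: "0 \<le> sup_norm G k f"
proof -
  have "replicate k \<one> \<in> tuples G k" by (auto simp: tuples_def)
  from norm_le_sup_norm[OF fin_G this, of f] show ?thesis using norm_ge_zero order_trans by blast
qed

text \<open>Loops in a box without plaquettes only backtrack, so their holonomy is trivial.\<close>

lemma wilson_degenerate:
  assumes "\<And>es. es \<in> set \<gamma> \<Longrightarrow> closed_loop {x..y} es" "plaquettes {x..y} = {}" "{x..y} \<subseteq> Lat" "\<sigma> \<in> Conf"
  shows "f (map (holonomy G \<sigma>) \<gamma>) = f (map (\<lambda>_. \<one>) \<gamma>)"
proof -
  have "\<sigma> e \<in> carrier G" if "e \<in> edges {x..y}" for e
    using edges_mono[OF assms(3)] assms(4) that by (auto simp: configs_def)
  then obtain h where h: "h \<in> UNIV \<rightarrow> carrier G" "pure_gauge G h \<sigma> (edges {x..y})"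
    using flat_box_pure_gauge[of x y \<sigma>] assms(2) by (auto simp: flat_def)
  have "holonomy G \<sigma> es = \<one>" if "es \<in> set \<gamma>" for es
    using holonomy_pure_gauge[OF closed_loop_chain(2,1)[OF assms(1)[OF that]] h] h(1) by (auto simp: Pi_iff)
  then show ?thesis by (intro arg_cong[of _ _ f] map_cong) simp_all
qed

lemma norm_Cov:
  assumes "\<Sigma> \<in> M \<rightarrow>\<^sub>M count_space Conf" "distr M (count_space Conf) \<Sigma> = gauge_measure G \<rho> Lat \<beta>"
    and "cmod (\<Sum>\<zeta>\<in>pair.C. of_real (pair.weight \<zeta>) * (difference X \<zeta> * difference Y \<zeta>)) \<le> K * (\<Sum>\<zeta>\<in>pair.C. pair.weight \<zeta>)"
  shows "cmod (Cov M (\<lambda>\<omega>. X (\<Sigma> \<omega>)) (\<lambda>\<omega>. Y (\<Sigma> \<omega>))) \<le> K / 2"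
proof -
  have "0 < (partition_fun G \<rho> Lat \<beta>)\<^sup>2" using partition_fun_pos by simp
  then show ?thesis using assms(3) unfolding Cov_eq[OF assms(1,2)] norm_divide sum_pair_weight
    by (simp add: norm_mult norm_power field_simps)
qed

end

text \<open>The points \<open>p\<close> and \<open>q\<close> are closest in all coordinates at once:
  facing end points where the intervals are disjoint, a common value where they overlap. Their
  distance is therefore a gap in one coordinate, and \<open>1 \<le> L\<close> rules out an overlap
  there.\<close>

lemma linf_separated_boxes:
  assumes "x1 \<le> y1" "x2 \<le> y2" "1 \<le> L"
    and "\<And>p q. p \<in> {x1..y1} \<Longrightarrow> q \<in> {x2..y2} \<Longrightarrow> L \<le> real_of_int (linf_dist p q)"
  shows "\<exists>k. L \<le> real_of_int (x2 $ k - y1 $ k) \<or> L \<le> real_of_int (x1 $ k - y2 $ k)"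
proof -
  define p :: site where "p = (\<chi> k. if y1 $ k < x2 $ k then y1 $ k else max (x1 $ k) (x2 $ k))"
  define q :: site where "q = (\<chi> k. if y2 $ k < x1 $ k then y2 $ k else max (x1 $ k) (x2 $ k))"
  have xy: "x1 $ k \<le> y1 $ k" "x2 $ k \<le> y2 $ k" for k using assms(1,2) by (auto simp: less_eq_vec_def)
  have "x1 $ k \<le> p $ k \<and> p $ k \<le> y1 $ k" "x2 $ k \<le> q $ k \<and> q $ k \<le> y2 $ k" for k
    using xy[of k] by (auto simp: p_def q_def)
  then have pq: "p \<in> {x1..y1}" "q \<in> {x2..y2}" unfolding box_iff by blast+
  have "linf_dist p q \<in> range (\<lambda>i. \<bar>p $ i - q $ i\<bar>)" unfolding linf_dist_def by (intro Max_in) auto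
  then obtain k where k: "linf_dist p q = \<bar>p $ k - q $ k\<bar>" by auto
  have "L \<le> real_of_int \<bar>p $ k - q $ k\<bar>" using assms(4)[OF pq] k by simp
  moreover have "\<bar>p $ k - q $ k\<bar> = (if y1 $ k < x2 $ k then x2 $ k - y1 $ k else if y2 $ k < x1 $ k then x1 $ k - y2 $ k else 0)"
    using xy[of k] by (auto simp: p_def q_def)
  ultimately show ?thesis using assms(3) by (intro exI[of _ k]) (auto split: if_splits)
qed

theorem theorem1p1:
  fixes G :: "('g, 'r) monoid_scheme"
    and \<rho> :: "'g \<Rightarrow> complex^'n^'n"
    and \<Lambda> B1 B2 :: "site set"
    and \<beta> L :: real
    and k1 k2 :: nat
    and f1 f2 :: "'g list \<Rightarrow> complex"
    and \<gamma>1 \<gamma>2 :: "edge list list"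
    and M :: "'w measure"
    and \<Sigma> :: "'w \<Rightarrow> edge \<Rightarrow> 'g"
  assumes "group G" and "finite (carrier G)" and "carrier G \<noteq> {\<one>\<^bsub>G\<^esub>}"
    and "unitary_rep G \<rho>" and "gap G \<rho> > 0"
    and "is_cube \<Lambda>"
    and "\<beta> \<ge> 1 / gap G \<rho> * (114 + 4 * ln (real (order G)))"
    and "L \<ge> 0"
    and "is_rectangle B1" and "B1 \<subseteq> \<Lambda>"
    and "is_rectangle B2" and "B2 \<subseteq> \<Lambda>"
    and "\<And>x y. x \<in> B1 \<Longrightarrow> y \<in> B2 \<Longrightarrow> real_of_int (linf_dist x y) \<ge> L"
    and "k1 \<ge> 1" and "k2 \<ge> 1"
    and "conjugacy_invariant G k1 f1" and "conjugacy_invariant G k2 f2"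
    and "length \<gamma>1 = k1" and "\<And>es. es \<in> set \<gamma>1 \<Longrightarrow> closed_loop B1 es"
    and "length \<gamma>2 = k2" and "\<And>es. es \<in> set \<gamma>2 \<Longrightarrow> closed_loop B2 es"
    and "prob_space M"
    and "\<Sigma> \<in> M \<rightarrow>\<^sub>M count_space (configs G \<Lambda>)"
    and "distr M (count_space (configs G \<Lambda>)) \<Sigma> = gauge_measure G \<rho> \<Lambda> \<beta>"
  shows "cmod (Cov M (\<lambda>\<omega>. f1 (map (holonomy G (\<Sigma> \<omega>)) \<gamma>1)) (\<lambda>\<omega>. f2 (map (holonomy G (\<Sigma> \<omega>)) \<gamma>2)))
    \<le> 4 * (4 * 10^24 * (real (order G))\<^sup>2) ^ (card (plaquettes B1) + card (plaquettes B2))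
        * sup_norm G k1 f1 * sup_norm G k2 f2 * exp (- (\<beta> / 2) * gap G \<rho> * (L - 1))"
proof -
  obtain a b where ab: "a \<le> b" "\<And>i j. b $ i - a $ i = b $ j - a $ j" and \<Lambda>: "\<Lambda> = {a..b}"
    using assms(6) by (auto simp: is_cube_def)
  obtain x1 y1 where xy1: "x1 \<le> y1" and B1: "B1 = {x1..y1}" using assms(9) by (auto simp: is_rectangle_def)
  obtain x2 y2 where xy2: "x2 \<le> y2" and B2: "B2 = {x2..y2}" using assms(11) by (auto simp: is_rectangle_def)
  define N where "N = nat (b $ 0 - a $ 0)"
  have N: "b $ i - a $ i = int N" for i
    using ab(2)[of i 0] ab(1) unfolding N_def less_eq_vec_def by (metis diff_ge_0_iff_ge int_nat_eq)
  let ?n = "real (order G)" and ?b = "card (plaquettes B1) + card (plaquettes B2)"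
  have "order G \<noteq> 0" using assms(1,2) by (simp add: order_def group.is_monoid monoid.one_closed card_eq_0_iff) 
      (metis empty_iff group.is_monoid monoid.one_closed)
  then have n: "1 \<le> ?n" by simp
  have \<beta>gap: "114 + 4 * ln ?n \<le> \<beta> * gap G \<rho>"
    using mult_right_mono[OF assms(7), of "gap G \<rho>"] assms(5) by simp
  have "0 \<le> \<beta>"
  proof -
    have "0 \<le> 1 / gap G \<rho> * (114 + 4 * ln ?n)" using assms(5) n by simp
    then show ?thesis using assms(7) by linarith
  qed
  then interpret lattice_yang_mills G \<rho> a b \<beta>
    using assms(1,2,4,5) ab(1) by (simp add: lattice_yang_mills_def lattice_yang_mills_axioms_def)
  note law = assms(23,24)[unfolded \<Lambda>]
  have sub: "{x1..y1} \<subseteq> Lat" "{x2..y2} \<subseteq> Lat" using assms(10,12) by (simp_all only: \<Lambda> B1 B2)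
  have loops: "\<And>es. es \<in> set \<gamma>1 \<Longrightarrow> closed_loop {x1..y1} es" "\<And>es. es \<in> set \<gamma>2 \<Longrightarrow> closed_loop {x2..y2} es"
    using assms(19,21) by (simp_all only: B1 B2)
  define F1 where "F1 \<sigma> = f1 (map (holonomy G \<sigma>) \<gamma>1)" for \<sigma>
  define F2 where "F2 \<sigma> = f2 (map (holonomy G \<sigma>) \<gamma>2)" for \<sigma>
  let ?m1 = "sup_norm G k1 f1" and ?m2 = "sup_norm G k2 f2"
  have F: "cmod (F1 \<sigma>) \<le> ?m1" "cmod (F2 \<sigma>) \<le> ?m2" if "\<sigma> \<in> Conf" for \<sigma>
    using wilson_le_sup_norm[OF loops(1) sub(1) that, where f = f1 and \<gamma> = \<gamma>1] wilson_le_sup_norm[OF loops(2) sub(2) that, where f = f2 and \<gamma> = \<gamma>2]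
    by (simp_all add: F1_def F2_def assms(18,20))
  have m: "0 \<le> ?m1" "0 \<le> ?m2" by (rule sup_norm_nonneg)+
  let ?E = "exp (- (\<beta> / 2) * gap G \<rho> * (L - 1))" and ?Q = "4 * 10 ^ 24 * ?n\<^sup>2"
  have "1 \<le> ?n\<^sup>2" using n by simp
  \<comment> \<open>The argument gives the base \<open>2 * 10^20\<close> for the rectangles, which
    the base of the statement dominates.\<close>
  then have Q: "2 * 10 ^ 20 \<le> ?Q" by simp
  let ?R = "4 * ?Q ^ ?b * ?m1 * ?m2 * ?E"
  let ?S = "\<Sum>\<zeta>\<in>pair.C. of_real (pair.weight \<zeta>) * (difference F1 \<zeta> * difference F2 \<zeta>)"
  \<comment> \<open>Twice the claimed bound, since the covariance is half of this
    expectation.\<close>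
  have "cmod ?S \<le> (2 * ?R) * (\<Sum>\<zeta>\<in>pair.C. pair.weight \<zeta>)"
  proof -
    have Znn: "0 \<le> (\<Sum>\<zeta>\<in>pair.C. pair.weight \<zeta>)" by (intro sum_nonneg pair.weight_nonneg)
    have R: "0 \<le> ?R" using m by simp
    \<comment> \<open>Without plaquettes an observable is constant. For \<open>L < 1\<close> the
      exponential is at least one and the trivial bound suffices.\<close>
    consider (deg) "plaquettes B1 = {} \<or> plaquettes B2 = {}" | (near) "L < 1"
      | (main) "1 \<le> L" "plaquettes {x1..y1} \<noteq> {}" "plaquettes {x2..y2} \<noteq> {}" using B1 B2 by fastforce
    then show ?thesis
    proof cases
      case deg
      have "difference F1 \<zeta> * difference F2 \<zeta> = 0" if z: "\<zeta> \<in> pair.C" for \<zeta>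
        using deg
      proof
        assume "plaquettes B1 = {}"
        then have "F1 \<sigma> = f1 (map (\<lambda>_. \<one>\<^bsub>G\<^esub>) \<gamma>1)" if "\<sigma> \<in> Conf" for \<sigma>
          unfolding F1_def by (intro wilson_degenerate[of \<gamma>1, OF loops(1) _ sub(1) that]) (simp_all only: B1)
        then show ?thesis using left_right_in[OF z] by (simp add: difference_def)
      next
        assume "plaquettes B2 = {}"
        then have "F2 \<sigma> = f2 (map (\<lambda>_. \<one>\<^bsub>G\<^esub>) \<gamma>2)" if "\<sigma> \<in> Conf" for \<sigma>
          unfolding F2_def by (intro wilson_degenerate[of \<gamma>2, OF loops(2) _ sub(2) that]) (simp_all only: B2)
        then show ?thesis using left_right_in[OF z] by (simp add: difference_def)
      qed
      then have "?S = 0" by (intro sum.neutral) simp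
      then show ?thesis using R Znn by simp
    next
      case near
      have "cmod ?S \<le> (\<Sum>\<zeta>\<in>pair.C. pair.weight \<zeta> * (4 * ?m1 * ?m2))"
      proof (rule sum_norm_le)
        fix \<zeta> assume z: "\<zeta> \<in> pair.C"
        show "cmod (of_real (pair.weight \<zeta>) * (difference F1 \<zeta> * difference F2 \<zeta>)) \<le> pair.weight \<zeta> * (4 * ?m1 * ?m2)"
          using mult_left_mono[OF difference_bound[OF F z] pair.weight_nonneg[OF z]] pair.weight_nonneg[OF z]
          by (simp add: norm_mult)
      qed
      also have "\<dots> = (4 * ?m1 * ?m2) * (\<Sum>\<zeta>\<in>pair.C. pair.weight \<zeta>)"
        by (simp add: sum_distrib_left mult.commute)
      also have "\<dots> \<le> (2 * ?R) * (\<Sum>\<zeta>\<in>pair.C. pair.weight \<zeta>)"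
      proof (rule mult_right_mono[OF _ Znn])
        have "1 \<le> ?Q ^ ?b" by (rule one_le_power, rule order_trans[OF _ Q]) simp
        moreover have "1 \<le> ?E"
          using near \<open>0 \<le> \<beta>\<close> assms(5) by (simp add: mult_nonneg_nonpos)
        ultimately have "1 * 1 \<le> ?Q ^ ?b * ?E" by (intro mult_mono) auto
        then have "(4 * ?m1 * ?m2) * 1 \<le> (4 * ?m1 * ?m2) * (?Q ^ ?b * ?E)"
          by (intro mult_left_mono) (use m in auto)
        also have "\<dots> = ?R" by (simp only: ac_simps)
        finally have le: "(4 * ?m1 * ?m2) * 1 \<le> ?R" .
        have "r \<le> 2 * r" if "0 \<le> r" for r :: real using that by simp
        from order_trans[OF le this[OF R]] show "4 * ?m1 * ?m2 \<le> 2 * ?R" by (simp only: mult_1_right)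
      qed
      finally show ?thesis .
    next
      case main
      obtain k where k: "L \<le> real_of_int (x2 $ k - y1 $ k) \<or> L \<le> real_of_int (x1 $ k - y2 $ k)"
        using linf_separated_boxes[OF xy1 xy2 main(1)] assms(13) unfolding B1 B2 by blast
      \<comment> \<open>Half of the exponent is reserved for the decay; in the other half
        \<open>57 = 114 / 2\<close> gives the \<open>10^-20\<close> and \<open>2 ln ?n\<close>
        cancels the size of the squared group.\<close>
      define x where "x = \<beta> / 2 * gap G \<rho>"
      have x: "57 + 2 * ln ?n \<le> x" using \<beta>gap by (simp add: x_def)
      have "0 \<le> ln ?n" using n by simp
      then have x0: "0 \<le> x" using x by linarith
      let ?B = "plaquettes {x1..y1} \<union> plaquettes {x2..y2}"
      have t: "real (card (carrier (G \<times>\<times> G))) * exp (- \<beta> * gap G \<rho>) \<le> 1 / 10 ^ 20 * exp (- x)"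
      proof -
        \<comment> \<open>The number \<open>5 / 2\<close> is the lower bound
          \<open>1 + 1 + 1 / 2\<close> for \<open>e\<close>.\<close>
        have "(10 ^ 20 :: real) \<le> (5 / 2) ^ 57" by (simp add: power_divide)
        also have "\<dots> \<le> exp (1::real) ^ 57"
          using exp_lower_Taylor_quadratic[of "1::real"] by (intro power_mono) auto
        also have "\<dots> = exp (57::real)" using exp_of_nat_mult[of 57 "1::real"] by simp
        finally have e57: "10 ^ 20 \<le> exp (57::real)" .
        have "?n\<^sup>2 * exp (- x) \<le> ?n\<^sup>2 * exp (- (57 + 2 * ln ?n))" using x by (intro mult_left_mono) auto
        also have "\<dots> = exp (- 57)"
        proof -
          have "exp (2 * ln ?n) = ?n\<^sup>2" using n exp_of_nat_mult[of 2 "ln ?n"] by simp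
          then have "?n\<^sup>2 * exp (- (57 + 2 * ln ?n)) = exp (2 * ln ?n) * exp (- (57 + 2 * ln ?n))" by simp
          also have "\<dots> = exp (- 57)" unfolding exp_add[symmetric] by simp
          finally show ?thesis .
        qed
        also have "\<dots> \<le> 1 / 10 ^ 20" using e57 by (simp add: exp_minus field_simps)
        finally have "(?n\<^sup>2 * exp (- x)) * exp (- x) \<le> 1 / 10 ^ 20 * exp (- x)" by (rule mult_right_mono) simp
        moreover have "exp (- \<beta> * gap G \<rho>) = exp (- x) * exp (- x)" unfolding exp_add[symmetric] by (simp add: x_def)
        moreover have "real (card (carrier (G \<times>\<times> G))) = ?n\<^sup>2"
          by (simp add: order_def card_cartesian_product power2_eq_square)
        ultimately show ?thesis by (simp only: mult.assoc)
      qed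
      have hol_dep: "f (map (holonomy G \<sigma>) \<gamma>) = f (map (holonomy G \<tau>) \<gamma>)"
        if "\<And>es. es \<in> set \<gamma> \<Longrightarrow> closed_loop S es" "\<And>e. e \<in> edges S \<Longrightarrow> \<sigma> e = \<tau> e"
        for f :: "'g list \<Rightarrow> complex" and \<gamma> S \<sigma> \<tau>
      proof -
        show ?thesis
          by (rule arg_cong[of _ _ f], rule map_cong[OF refl]) (rule holonomy_cong[OF closed_loop_chain(2)[OF that(1)] that(2)])
      qed
      have loopsL: "\<And>es. es \<in> set \<gamma>1 \<Longrightarrow> closed_loop Lat es" "\<And>es. es \<in> set \<gamma>2 \<Longrightarrow> closed_loop Lat es"
        using loops oriented_edges_mono[OF sub(1)] oriented_edges_mono[OF sub(2)] unfolding closed_loop_def by blast+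
      have "cmod ?S \<le> 2 * (4 * ?m1 * ?m2) * (2 * 10 ^ 20) ^ card ?B * exp (- x * (L - 1)) * (\<Sum>\<zeta>\<in>pair.C. pair.weight \<zeta>)"
      proof (rule pair.correlation_bound[OF N sub main(2,3,1) k])
        show "pair.gauge_inv (difference F1)" "pair.gauge_inv (difference F2)"
          unfolding F1_def F2_def using assms(16,17,18,20)
          by (intro difference_gauge_inv wilson_gauge loopsL; simp)+
        show "pair.depends_on (difference F1) (edges {x1..y1})"
          by (rule difference_depends_on[OF edges_mono[OF sub(1)]], unfold F1_def, rule hol_dep[of \<gamma>1, OF loops(1)]) blast+
        show "pair.depends_on (difference F2) (edges {x2..y2})"
          by (rule difference_depends_on[OF edges_mono[OF sub(2)]], unfold F2_def, rule hol_dep[of \<gamma>2, OF loops(2)]) blast+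
        show "cmod (difference F1 \<zeta> * difference F2 \<zeta>) \<le> 4 * ?m1 * ?m2" if "\<zeta> \<in> pair.C" for \<zeta>
          by (rule difference_bound[OF F that])
      qed (use m x0 t wsum_difference in auto)
      also have "\<dots> \<le> (2 * ?R) * (\<Sum>\<zeta>\<in>pair.C. pair.weight \<zeta>)"
      proof (rule mult_right_mono[OF _ Znn])
        have "card ?B \<le> ?b" unfolding B1 B2 by (rule card_Un_le)
        then have "(2 * 10 ^ 20 :: real) ^ card ?B \<le> (2 * 10 ^ 20) ^ ?b" by (intro power_increasing) auto
        also have "\<dots> \<le> ?Q ^ ?b" by (rule power_mono[OF Q]) simp
        finally have "(8 * ?m1 * ?m2 * ?E) * (2 * 10 ^ 20) ^ card ?B \<le> (8 * ?m1 * ?m2 * ?E) * ?Q ^ ?b"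
          by (rule mult_left_mono) (use m in simp)
        moreover have E: "exp (- x * (L - 1)) = ?E" by (simp add: x_def)
        moreover have "2 * (4 * r * s) * p * e = (8 * r * s * e) * p" "2 * (4 * p * r * s * e) = (8 * r * s * e) * p"
          for r s p e :: real by simp_all
        ultimately show "2 * (4 * ?m1 * ?m2) * (2 * 10 ^ 20) ^ card ?B * exp (- x * (L - 1)) \<le> 2 * ?R"
          by (simp only:)
      qed
      finally show ?thesis .
    qed
  qed
  from norm_Cov[OF law this] show ?thesis
    unfolding F1_def F2_def by (simp only: nonzero_mult_div_cancel_left[OF zero_neq_numeral[symmetric]])
qed

end
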